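(* There exists a function $\varphi\in S(\mathbb{R})$ (the Schwartz space) such that for every set $\Lambda\subset\mathbb{R}$ of the form $\Lambda=\{n+a_n : n\in\mathbb{Z}\}$, where $a_n\in\mathbb{R}$, $a_n\neq 0$ for all $n\in\mathbb{Z}$, and $|a_n|<C r^{|n|}$ for all $n\in\mathbb{Z}$ with some constants $C>0$ and $0<r<1$ (which may depend on $\Lambda$), the set of translates $\{\varphi(t-\lambda) : \lambda\in\Lambda\}$ spans the whole space $L^p(\mathbb{R})$ for each $1<p<\infty$.
   Context: $L^p(\mathbb{R})$ is the space of complex-valued functions with the usual norm with respect to Lebesgue measure. A family of elements spans a Banach space if its finite linear combinations with complex coefficients are dense in the space. The same function $\varphi$ serves for all such $\Lambda$ and all such $p$. *)

theory Defs
  imports "HOL-Analysis.Analysis"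
begin

definition nth_vderiv :: "nat \<Rightarrow> (real \<Rightarrow> complex) \<Rightarrow> real \<Rightarrow> complex" where
  "nth_vderiv k f = ((\<lambda>g t. vector_derivative g (at t)) ^^ k) f"

definition schwartz_space :: "(real \<Rightarrow> complex) set" where
  "schwartz_space = {f.
     (\<forall>k t. nth_vderiv k f differentiable (at t)) \<and>
     (\<forall>m k. bounded (range (\<lambda>t. t ^ m *\<^sub>R nth_vderiv k f t)))}"

(* Elements of L^p are represented by functions, not by classes modulo
   equality almost everywhere; Lp_norm is then a seminorm, and density is
   unaffected by the choice of representatives. *)

definition Lp_space :: "real \<Rightarrow> (real \<Rightarrow> complex) set" where
  "Lp_space p = {f. f \<in> borel_measurable lebesgue \<and>
     integrable lebesgue (\<lambda>t. cmod (f t) powr p)}"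

(* Meaningful only on Lp_space p: the integral of a non-integrable function is 0. *)

definition Lp_norm :: "real \<Rightarrow> (real \<Rightarrow> complex) \<Rightarrow> real" where
  "Lp_norm p f = (LINT t|lebesgue. cmod (f t) powr p) powr (1 / p)"

(* The inclusion in Lp_space p guarantees that Lp_norm is only applied to
   elements of Lp_space p. *)

definition spans_Lp :: "real \<Rightarrow> (real \<Rightarrow> complex) set \<Rightarrow> bool" where
  "spans_Lp p S \<longleftrightarrow> S \<subseteq> Lp_space p \<and>
     (\<forall>f \<in> Lp_space p. \<forall>\<epsilon>>0. \<exists>F c. finite F \<and> F \<subseteq> S \<and>
        Lp_norm p (\<lambda>t. f t - (\<Sum>g\<in>F. c g * g t)) < \<epsilon>)"

definition translates :: "(real \<Rightarrow> complex) \<Rightarrow> real set \<Rightarrow> (real \<Rightarrow> complex) set" where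
  "translates \<phi> \<Lambda> = (\<lambda>l t. \<phi> (t - l)) ` \<Lambda>"

end

theory Submission
  imports Defs
begin

text \<open>Let \<open>X f t = f t - f (t - 1)\<close>. The generator is \<open>\<phi> = u \<star> exp (- t\<^sup>2)\<close>, where \<open>u\<close> is an explicit
  rapidly decreasing sequence that is divisible by every power of \<open>X\<close>, so that its symbol has a zero of
  infinite order at frequency \<open>0\<close> and no other zeros. By the flatness of \<open>u\<close>, a combination of the
  integer translates of \<open>\<phi>\<close> whose coefficients are a slowly cut off polynomial is nearly zero; as
  polynomials are dense in the sequences weighted by \<open>r ^ \<bar>n\<bar>\<close>, each \<open>\<phi> (t - m)\<close> is nearly a combination
  of the \<open>\<phi> (t - n)\<close> with coefficients that are small against \<open>r ^ - \<bar>n\<bar>\<close>. Since \<open>\<phi> (t - n)\<close> is within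
  \<open>O(r ^ \<bar>n\<bar>)\<close> of the span of the \<open>\<Lambda>\<close>-translates, it lies in the closed span. Dividing by the nonzero
  \<open>a n\<close> and iterating, one obtains all the derivatives \<open>\<phi>\<^sup>(\<^sup>j\<^sup>) (t - n)\<close>, that is, \<open>u\<close> convolved with
  every polynomial times the Gaussian, hence \<open>u \<star> f\<close> for all continuous \<open>f\<close> with compact support.
  Finally, convolution with \<open>u\<close> has dense range in \<open>L\<^sup>p\<close> for \<open>p > 1\<close>, because \<open>X\<close> does: the averages of
  \<open>f\<close> over many translates are uniformly small and bounded in \<open>L\<^sup>1\<close>.\<close>

section \<open>A flat sequence\<close>

text \<open>The zero of infinite order serves the polynomials: \<open>X ^ (D + 3)\<close> must be
  split off to make a cut-off polynomial of degree \<open>D\<close> negligible, and all degrees are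
  wanted. The price is that \<open>\<phi>\<close> has integral 0, and so have all combinations of
  its translates, which are therefore not dense among the integrable functions; this is why
  \<open>p > 1\<close> is natural. The symbol of \<open>u\<close> is never formed: flatness is used
  as the identities \<open>u = X ^ i v\<close> with summable \<open>v\<close>, and the absence of
  other zeros as a recursion that undoes the factors of \<open>u\<close> one at a time. Neither
  duality nor a Fourier transform occurs; every approximation is explicit. Its error is measured in
  the sup norm and the L1 norm together, which makes everything before the last section independent
  of \<open>p\<close>. No lower bound for \<open>\<bar>a n\<bar>\<close> is available, so division
  by powers of \<open>a n\<close> costs an unbounded factor; it is paid for by approximating the
  lower derivatives, which already lie in the closed span, with a tolerance that depends on
  \<open>n\<close>.\<close>

text \<open>The coefficients of the entire function \<open>(1 - x) (1 - x/2) (1 - x/4) \<dots>\<close>, which vanishes at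
  all the powers of two.\<close>

primrec euler_coeff :: "nat \<Rightarrow> real" where
  "euler_coeff 0 = 1"
| "euler_coeff (Suc m) = - 2 * euler_coeff m / (2 ^ Suc m - 1)"

text \<open>The ratio of consecutive coefficients tends to 0, so every radius \<open>R\<close> is
  admissible. This later absorbs the growth \<open>(2 ^ j) ^ m\<close> in the decay
  estimate.\<close>

lemma summable_euler_coeff: "summable (\<lambda>m. \<bar>euler_coeff m\<bar> * R ^ m)"
proof -
  have "(\<lambda>m. (1/2::real) ^ m) \<longlonglongrightarrow> 0" by (rule LIMSEQ_power_zero) simp
  then have "(\<lambda>m. 2 * \<bar>R\<bar> * (1/2) ^ m) \<longlonglongrightarrow> 0" by (rule tendsto_mult_right_zero)
  then have "eventually (\<lambda>m. 2 * \<bar>R\<bar> * (1/2) ^ m < 1/2) sequentially"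
    by (rule order_tendstoD) auto
  then obtain N where N: "\<And>m. m \<ge> N \<Longrightarrow> 2 * \<bar>R\<bar> * (1/2) ^ m < 1/2"
    by (auto simp: eventually_sequentially)
  show ?thesis
  proof (rule summable_ratio_test[of "1/2" N])
    fix m assume "N \<le> m"
    have p: "(2::real) ^ Suc m - 1 > 0" using one_less_power[of "2::real" "Suc m"] by simp
    have "norm (\<bar>euler_coeff (Suc m)\<bar> * R ^ Suc m)
        = (2 * \<bar>R\<bar> / (2 ^ Suc m - 1)) * norm (\<bar>euler_coeff m\<bar> * R ^ m)"
      using p by (simp add: abs_mult power_abs)
    also have "2 * \<bar>R\<bar> / (2 ^ Suc m - 1) \<le> 1/2"
    proof -
      have "2 * \<bar>R\<bar> / (2 ^ Suc m - 1) \<le> 2 * \<bar>R\<bar> / 2 ^ m"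
      proof (rule divide_left_mono)
        have "(1::real) \<le> 2 ^ m" by simp
        then show "(2::real) ^ m \<le> 2 ^ Suc m - 1" unfolding power_Suc by linarith
      qed (use p in \<open>auto intro!: mult_pos_pos simp del: power_Suc\<close>)
      also have "\<dots> = 2 * \<bar>R\<bar> * (1/2) ^ m" by (simp add: power_one_over)
      finally show ?thesis using N[OF \<open>N \<le> m\<close>] by linarith
    qed
    then have "(2 * \<bar>R\<bar> / (2 ^ Suc m - 1)) * norm (\<bar>euler_coeff m\<bar> * R ^ m)
        \<le> 1/2 * norm (\<bar>euler_coeff m\<bar> * R ^ m)"
      by (rule mult_right_mono) simp
    finally show "norm (\<bar>euler_coeff (Suc m)\<bar> * R ^ Suc m) \<le> 1/2 * norm (\<bar>euler_coeff m\<bar> * R ^ m)" .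
  qed auto
qed

definition euler_fun :: "real \<Rightarrow> real" where
  "euler_fun x = (\<Sum>m. euler_coeff m * x ^ m)"

lemma summable_euler_fun: "summable (\<lambda>m. euler_coeff m * x ^ m)"
  by (rule summable_norm_cancel) (use summable_euler_coeff[of "\<bar>x\<bar>"] in \<open>simp add: abs_mult power_abs\<close>)

lemma euler_coeff_Suc: "euler_coeff (Suc m) * (2 ^ Suc m - 1) = - 2 * euler_coeff m"
proof -
  have p: "(2::real) ^ Suc m - 1 > 0" using one_less_power[of "2::real" "Suc m"] by simp
  then show ?thesis by simp
qed

text \<open>The coefficient recursion summed against \<open>x ^ m\<close>. On the product side,
  doubling \<open>x\<close> shifts the factors by one and brings in the new factor
  \<open>1 - 2 * x\<close>.\<close>

lemma euler_fun_double: "euler_fun (2 * x) = (1 - 2 * x) * euler_fun x"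
proof -
  have "euler_fun (2 * x) - euler_fun x = (\<Sum>m. euler_coeff m * (2 ^ m - 1) * x ^ m)"
    unfolding euler_fun_def
    by (subst suminf_diff[OF summable_euler_fun summable_euler_fun]) (simp add: algebra_simps)
  also have "\<dots> = (\<Sum>m. euler_coeff (Suc m) * (2 ^ Suc m - 1) * x ^ Suc m)"
    by (subst suminf_split_head)
       (use summable_diff[OF summable_euler_fun[of "2 * x"] summable_euler_fun[of x]] in
         \<open>auto simp: algebra_simps\<close>)
  also have "\<dots> = (\<Sum>m. - (2 * x) * (euler_coeff m * x ^ m))"
    unfolding euler_coeff_Suc by (simp add: algebra_simps)
  also have "\<dots> = - (2 * x) * euler_fun x"
    unfolding euler_fun_def by (rule suminf_mult[OF summable_euler_fun])
  finally show ?thesis by (simp add: algebra_simps)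
qed

lemma euler_fun_power_2: "euler_fun (2 ^ i) = 0"
proof (induction i)
  case 0 then show ?case using euler_fun_double[of "1/2"] by simp
next
  case (Suc i) then show ?case using euler_fun_double[of "2 ^ i"] by simp
qed

text \<open>A zero at \<open>1/2\<close> would pass through the doubling equation to all smaller
  powers of \<open>1/2\<close> and by continuity to 0, where the value is 1. The number is the
  multiple of the unit that survives in \<open>compact_support_in_Lp_closure\<close>.\<close>

lemma euler_fun_half: "euler_fun (1/2) \<noteq> 0"
proof
  assume z: "euler_fun (1/2) = 0"
  have *: "euler_fun ((1/2) ^ Suc n) = 0" for n
  proof (induction n)
    case (Suc n)
    have "(1/2::real) ^ Suc n < 1" by (rule power_Suc_less_one) auto
    then show ?case using Suc euler_fun_double[of "(1/2) ^ Suc (Suc n)"] by simp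
  qed (use z in simp)
  have "isCont euler_fun 0"
    unfolding euler_fun_def by (rule isCont_powser[OF summable_euler_fun[of 1]]) auto
  moreover have "(\<lambda>n. (1/2::real) ^ Suc n) \<longlonglongrightarrow> 0" 
    by (rule LIMSEQ_Suc[OF LIMSEQ_power_zero]) simp
  ultimately have "(\<lambda>n. euler_fun ((1/2) ^ Suc n)) \<longlonglongrightarrow> euler_fun 0"
    by (rule isCont_tendsto_compose)
  then have "euler_fun 0 = 0" unfolding * by (simp add: LIMSEQ_const_iff)
  then show False by (simp add: euler_fun_def powser_zero)
qed

text \<open>The coefficients of \<open>\<eta> / (X + \<eta>)\<close> with \<open>\<eta> = 2^(-m)\<close>, where \<open>1 - X\<close> is the unit shift.
  As a formal series this is \<open>1 - X/\<eta> + X\<^sup>2/\<eta>\<^sup>2 - \<dots>\<close>, so that the zeros of \<^const>\<open>euler_fun\<close> make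
  all the coefficients of \<open>flat_seq 0 1\<close> with respect to the powers of \<open>X\<close> vanish.\<close>

definition resolvent_coeff :: "nat \<Rightarrow> nat \<Rightarrow> real" where
  "resolvent_coeff m k = (1/2) ^ m / (1 + (1/2) ^ m) ^ Suc k"

text \<open>The two parameters keep the family closed under both relations used below:
  multiplication by \<open>X\<close> halves \<open>x\<close>, and doubling \<open>x\<close> raises
  \<open>s\<close>, which moves the poles from \<open>- (1/2) ^ m\<close> to
  \<open>- (1/2) ^ (m + s)\<close>.\<close>

definition flat_seq :: "nat \<Rightarrow> real \<Rightarrow> nat \<Rightarrow> real" where
  "flat_seq s x k = (\<Sum>m. euler_coeff m * x ^ m * resolvent_coeff (m + s) k)"

definition seq_diff :: "(nat \<Rightarrow> real) \<Rightarrow> nat \<Rightarrow> real" where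
  "seq_diff a k = a k - (if k = 0 then 0 else a (k - 1))"

lemma resolvent_coeff_pos: "0 < resolvent_coeff m k"
  unfolding resolvent_coeff_def by (intro divide_pos_pos zero_less_power add_pos_pos) auto

lemma resolvent_coeff_le: "resolvent_coeff m k \<le> (1/2) ^ m"
proof -
  have "1 \<le> (1 + (1/2::real) ^ m) ^ Suc k" by (rule one_le_power) auto
  then show ?thesis unfolding resolvent_coeff_def
    by (simp add: divide_le_eq mult_left_le del: power_Suc)
qed

lemma resolvent_coeff_le_1: "resolvent_coeff m k \<le> 1"
  using resolvent_coeff_le[of m k] power_le_one[of "1/2::real" m] by simp

text \<open>The complete series is geometric with sum 1, whatever \<open>m\<close> is; hence the
  \<open>l1\<close> bound for \<open>flat_seq s x\<close> below is uniform in
  \<open>s\<close>.\<close>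

lemma sum_resolvent_coeff_le: "(\<Sum>k<K. resolvent_coeff m k) \<le> 1"
proof -
  define e where "e = (1/2::real) ^ m"
  have e: "e > 0" by (simp add: e_def)
  have "(\<Sum>k<K. resolvent_coeff m k) = 1 - 1 / (1 + e) ^ K"
  proof (induction K)
    case (Suc K)
    define q where "q = (1 + e) ^ K"
    have q: "q > 0" using e by (simp add: q_def)
    have "(\<Sum>k<Suc K. resolvent_coeff m k) = 1 - 1 / q + e / ((1 + e) * q)"
      using Suc by (simp add: resolvent_coeff_def e_def q_def)
    also have "1 / q = (1 + e) / ((1 + e) * q)" using e by simp
    then have "1 - 1 / q + e / ((1 + e) * q) = 1 - 1 / ((1 + e) * q)"
      by (simp only: add_divide_distrib)
    finally show ?case by (simp add: q_def)
  qed simp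
  then show ?thesis using e by simp
qed

text \<open>With \<open>\<eta> = (1/2) ^ m\<close> this is
  \<open>X \<eta> / (X + \<eta>) = \<eta> (1 - \<eta> / (X + \<eta>))\<close>, read off
  coefficientwise.\<close>

lemma seq_diff_resolvent_coeff:
  "seq_diff (resolvent_coeff m) k = (1/2) ^ m * ((if k = 0 then 1 else 0) - resolvent_coeff m k)"
proof -
  define e where "e = (1/2::real) ^ m"
  have e: "e > 0" by (simp add: e_def)
  show ?thesis
  proof (cases k)
    case 0
    have "(1 + e) / (1 + e) = 1" using e by simp
    then have "1 - e / (1 + e) = 1 / (1 + e)" unfolding add_divide_distrib by simp
    then have "e / (1 + e) = e * (1 - e / (1 + e))" by simp
    then show ?thesis using 0 by (simp add: seq_diff_def resolvent_coeff_def flip: e_def)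
  next
    case (Suc j)
    define q where "q = (1 + e) ^ Suc j"
    have q: "q > 0" using e by (simp add: q_def)
    have "e / q = (e + e * e) / ((1 + e) * q)"
      using e nonzero_mult_divide_mult_cancel_left[of "1 + e" e q] by (simp add: distrib_right)
    then have "e / ((1 + e) * q) - e / q = e * (0 - e / ((1 + e) * q))"
      by (simp add: add_divide_distrib)
    then show ?thesis using Suc
      by (simp add: seq_diff_def resolvent_coeff_def q_def flip: e_def)
  qed
qed

lemma summable_flat_seq_aux:
  assumes "\<And>m. \<bar>g m\<bar> \<le> 1"
  shows "summable (\<lambda>m. \<bar>euler_coeff m * x ^ m * g m\<bar>)"
proof (rule summable_comparison_test')
  show "summable (\<lambda>m. \<bar>euler_coeff m\<bar> * \<bar>x\<bar> ^ m)" by (rule summable_euler_coeff)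
  show "norm \<bar>euler_coeff m * x ^ m * g m\<bar> \<le> \<bar>euler_coeff m\<bar> * \<bar>x\<bar> ^ m" if "m \<ge> 0" for m
    using mult_left_mono[OF assms[of m], of "\<bar>euler_coeff m\<bar> * \<bar>x\<bar> ^ m"]
    by (simp add: abs_mult power_abs)
qed

lemma summable_flat_seq: "summable (\<lambda>m. euler_coeff m * x ^ m * resolvent_coeff (m + s) k)"
  by (rule summable_rabs_cancel, rule summable_flat_seq_aux)
     (use resolvent_coeff_pos resolvent_coeff_le_1 in \<open>auto simp: abs_of_pos\<close>)

text \<open>The resolvent identity is applied term by term: its factor \<open>(1/2) ^ m\<close>
  turns \<open>x\<close> into \<open>x/2\<close>, and the units add up to
  \<open>euler_fun (x/2)\<close>. For \<open>x = 2 ^ Suc i\<close> this number vanishes and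
  \<open>X\<close> acts within the family; for \<open>x = 1\<close> it does not, and the unit
  reappears.\<close>

lemma seq_diff_flat_seq:
  "seq_diff (flat_seq s x) k = (1/2) ^ s * ((if k = 0 then euler_fun (x/2) else 0) - flat_seq s (x/2) k)"
proof -
  have sm: "summable (\<lambda>m. if k = 0 then euler_coeff m * (x/2) ^ m else 0)"
    using summable_euler_fun[of "x/2"] by (cases "k = 0") simp_all
  have "seq_diff (flat_seq s x) k
      = (\<Sum>m. euler_coeff m * x ^ m * seq_diff (resolvent_coeff (m + s)) k)"
  proof (cases "k = 0")
    case True
    then show ?thesis by (simp add: seq_diff_def flat_seq_def)
  next
    case False
    have "(\<Sum>m. euler_coeff m * x ^ m * resolvent_coeff (m + s) k)
        - (\<Sum>m. euler_coeff m * x ^ m * resolvent_coeff (m + s) (k - 1))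
        = (\<Sum>m. euler_coeff m * x ^ m * resolvent_coeff (m + s) k
              - euler_coeff m * x ^ m * resolvent_coeff (m + s) (k - 1))"
      by (rule suminf_diff[OF summable_flat_seq summable_flat_seq])
    then show ?thesis using False
      unfolding seq_diff_def flat_seq_def by (simp only: if_False right_diff_distrib)
  qed
  also have "\<dots> = (\<Sum>m. (1/2) ^ s * ((if k = 0 then euler_coeff m * (x/2) ^ m else 0)
        - euler_coeff m * (x/2) ^ m * resolvent_coeff (m + s) k))"
  proof (intro arg_cong[where f = suminf] ext)
    fix m
    have "(1/2::real) ^ (m + s) = (1/2) ^ s * (1/2) ^ m" by (simp only: power_add mult.commute)
    moreover have "(x/2) ^ m = x ^ m * (1/2) ^ m" by (simp flip: power_mult_distrib)
    ultimately show "euler_coeff m * x ^ m * seq_diff (resolvent_coeff (m + s)) k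
        = (1/2) ^ s * ((if k = 0 then euler_coeff m * (x/2) ^ m else 0)
          - euler_coeff m * (x/2) ^ m * resolvent_coeff (m + s) k)"
      unfolding seq_diff_resolvent_coeff by (cases "k = 0") (simp_all only: if_True if_False ring_distribs mult_ac, simp_all)
  qed
  also have "\<dots> = (1/2) ^ s * (\<Sum>m. (if k = 0 then euler_coeff m * (x/2) ^ m else 0)
        - euler_coeff m * (x/2) ^ m * resolvent_coeff (m + s) k)"
    by (intro suminf_mult summable_diff sm summable_flat_seq)
  also have "\<dots> = (1/2) ^ s * ((\<Sum>m. if k = 0 then euler_coeff m * (x/2) ^ m else 0)
        - (\<Sum>m. euler_coeff m * (x/2) ^ m * resolvent_coeff (m + s) k))"
    by (intro arg_cong[where f = "\<lambda>z. (1/2) ^ s * z"] suminf_diff[symmetric] sm summable_flat_seq)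
  finally show ?thesis by (cases "k = 0") (simp_all add: flat_seq_def euler_fun_def)
qed

text \<open>The same recursion as in \<open>euler_fun_double\<close>; here the index shift is taken
  up by \<open>s\<close>.\<close>

lemma flat_seq_double: "flat_seq s (2 * x) k - flat_seq s x k = - 2 * x * flat_seq (Suc s) x k"
proof -
  let ?f = "\<lambda>m. euler_coeff m * (2 ^ m - 1) * x ^ m * resolvent_coeff (m + s) k"
  have eq: "(\<lambda>m. euler_coeff m * (2 * x) ^ m * resolvent_coeff (m + s) k
       - euler_coeff m * x ^ m * resolvent_coeff (m + s) k) = ?f"
    by (auto simp: algebra_simps power_mult_distrib)
  have sf: "summable ?f"
    using summable_diff[OF summable_flat_seq[of "2 * x" s k] summable_flat_seq[of x s k]] unfolding eq .
  have "flat_seq s (2 * x) k - flat_seq s x k = suminf ?f"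
    unfolding flat_seq_def by (subst suminf_diff[OF summable_flat_seq summable_flat_seq]) (simp only: eq)
  also have "\<dots> = (\<Sum>m. ?f (Suc m))"
    by (subst suminf_split_head[OF sf]) simp
  also have "\<dots> = (\<Sum>m. (- 2 * x) * (euler_coeff m * x ^ m * resolvent_coeff (m + Suc s) k))"
    unfolding euler_coeff_Suc by (simp add: algebra_simps)
  also have "\<dots> = - 2 * x * flat_seq (Suc s) x k"
    unfolding flat_seq_def by (rule suminf_mult[OF summable_flat_seq])
  finally show ?thesis .
qed

text \<open>Iterated, this shows that \<open>flat_seq 0 1\<close> is \<open>(- X) ^ i\<close> times
  the summable sequence \<open>flat_seq 0 (2 ^ i)\<close> for every \<open>i\<close>: a zero of
  infinite order expressed without a symbol.\<close>

lemma seq_diff_flat_seq_power: "seq_diff (flat_seq 0 (2 ^ Suc i)) k = - flat_seq 0 (2 ^ i) k"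
  by (simp add: seq_diff_flat_seq euler_fun_power_2)

text \<open>By \<open>flat_seq_double\<close>, \<open>2 * flat_seq (Suc s) 1\<close> is
  \<open>flat_seq s 1 - flat_seq s 2\<close>, and \<open>X\<close> sends \<open>flat_seq s 2\<close>
  to \<open>- (1/2) ^ s * flat_seq s 1\<close> because \<open>euler_fun 1 = 0\<close>. This relation
  takes the place of a statement about the remaining zeros of the symbol.\<close>

lemma seq_diff_add_flat_seq:
  "seq_diff (flat_seq s 1) k + (1/2) ^ s * flat_seq s 1 k = 2 * seq_diff (flat_seq (Suc s) 1) k"
proof -
  have eq: "flat_seq (Suc s) 1 j = (flat_seq s 1 j - flat_seq s 2 j) / 2" for j
    using flat_seq_double[of s 1 j] by simp
  have "2 * seq_diff (flat_seq (Suc s) 1) k = seq_diff (flat_seq s 1) k - seq_diff (flat_seq s 2) k"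
    unfolding seq_diff_def eq by (simp add: field_simps)
  also have "seq_diff (flat_seq s 2) k = - ((1/2) ^ s * flat_seq s 1 k)"
    using seq_diff_flat_seq[of s 2 k] euler_fun_power_2[of 0] by simp
  finally show ?thesis by simp
qed

section \<open>Size and decay of the flat sequence\<close>

definition abs_euler :: "real \<Rightarrow> real" where
  "abs_euler x = (\<Sum>m. \<bar>euler_coeff m\<bar> * \<bar>x\<bar> ^ m)"

text \<open>Geometric growth \<open>y ^ m\<close> in the bound for the resolvents is harmless
  because the majorant converges everywhere. The case \<open>y = 1\<close> gives the sup bound,
  \<open>y = 2 ^ j\<close> the decay in \<open>k\<close>.\<close>

lemma abs_flat_seq_le:
  assumes "\<And>m. resolvent_coeff (m + s) k \<le> B * y ^ m" "y \<ge> 0"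
  shows "\<bar>flat_seq s x k\<bar> \<le> B * abs_euler (x * y)"
proof -
  have "\<bar>flat_seq s x k\<bar> \<le> (\<Sum>m. \<bar>euler_coeff m * x ^ m * resolvent_coeff (m + s) k\<bar>)"
    unfolding flat_seq_def
    by (rule summable_rabs, rule summable_flat_seq_aux)
       (use resolvent_coeff_pos resolvent_coeff_le_1 in \<open>auto simp: abs_of_pos\<close>)
  also have "\<dots> \<le> (\<Sum>m. B * (\<bar>euler_coeff m\<bar> * \<bar>x * y\<bar> ^ m))"
  proof (rule suminf_le)
    show "summable (\<lambda>m. \<bar>euler_coeff m * x ^ m * resolvent_coeff (m + s) k\<bar>)"
      by (rule summable_flat_seq_aux)
         (use resolvent_coeff_pos resolvent_coeff_le_1 in \<open>auto simp: abs_of_pos\<close>)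
    show "summable (\<lambda>m. B * (\<bar>euler_coeff m\<bar> * \<bar>x * y\<bar> ^ m))"
      by (intro summable_mult summable_euler_coeff)
    fix m
    have "\<bar>euler_coeff m * x ^ m * resolvent_coeff (m + s) k\<bar>
        = \<bar>euler_coeff m\<bar> * \<bar>x\<bar> ^ m * resolvent_coeff (m + s) k"
      using resolvent_coeff_pos[of "m + s" k] by (simp add: abs_mult power_abs)
    also have "\<dots> \<le> \<bar>euler_coeff m\<bar> * \<bar>x\<bar> ^ m * (B * y ^ m)"
      using assms(1) by (intro mult_left_mono) auto
    finally show "\<bar>euler_coeff m * x ^ m * resolvent_coeff (m + s) k\<bar> \<le> B * (\<bar>euler_coeff m\<bar> * \<bar>x * y\<bar> ^ m)"
      using assms(2) by (simp add: abs_mult power_mult_distrib algebra_simps)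
  qed
  also have "\<dots> = B * abs_euler (x * y)"
    unfolding abs_euler_def by (rule suminf_mult[OF summable_euler_coeff])
  finally show ?thesis .
qed

lemma abs_euler_nonneg: "abs_euler x \<ge> 0"
  unfolding abs_euler_def by (intro suminf_nonneg summable_euler_coeff) auto

text \<open>Together with the \<open>l1\<close> bound below, in which \<open>s\<close> does not
  occur, this makes \<open>flat_seq s x\<close> uniformly small but merely bounded in
  \<open>l1\<close> as \<open>s\<close> grows, which suffices for \<open>p > 1\<close>.\<close>

lemma flat_seq_sup: "\<bar>flat_seq s x k\<bar> \<le> (1/2) ^ s * abs_euler x"
proof -
  have "resolvent_coeff (m + s) k \<le> (1/2) ^ s * 1 ^ m" for m
  proof -
    have "resolvent_coeff (m + s) k \<le> (1/2) ^ (m + s)" by (rule resolvent_coeff_le)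
    also have "\<dots> \<le> (1/2) ^ s" by (rule power_decreasing) auto
    finally show ?thesis by simp
  qed
  from abs_flat_seq_le[OF this] show ?thesis by simp
qed

lemma sum_abs_flat_seq_le: "(\<Sum>k<K. \<bar>flat_seq s x k\<bar>) \<le> abs_euler x"
proof -
  let ?f = "\<lambda>m k. \<bar>euler_coeff m * x ^ m * resolvent_coeff (m + s) k\<bar>"
  have sm: "summable (\<lambda>m. ?f m k)" for k
    by (rule summable_flat_seq_aux)
       (use resolvent_coeff_pos resolvent_coeff_le_1 in \<open>auto simp: abs_of_pos\<close>)
  have "(\<Sum>k<K. \<bar>flat_seq s x k\<bar>) \<le> (\<Sum>k<K. \<Sum>m. ?f m k)"
    unfolding flat_seq_def by (intro sum_mono summable_rabs sm)
  also have "\<dots> = (\<Sum>m. \<Sum>k<K. ?f m k)"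
    by (rule suminf_sum[symmetric]) (rule sm)
  also have "\<dots> \<le> (\<Sum>m. \<bar>euler_coeff m\<bar> * \<bar>x\<bar> ^ m)"
  proof (rule suminf_le)
    fix m
    have "(\<Sum>k<K. ?f m k) = \<bar>euler_coeff m\<bar> * \<bar>x\<bar> ^ m * (\<Sum>k<K. resolvent_coeff (m + s) k)"
      using resolvent_coeff_pos by (simp add: abs_mult power_abs sum_distrib_left abs_of_pos)
    also have "\<dots> \<le> \<bar>euler_coeff m\<bar> * \<bar>x\<bar> ^ m * 1"
      by (intro mult_left_mono sum_resolvent_coeff_le) auto
    finally show "(\<Sum>k<K. ?f m k) \<le> \<bar>euler_coeff m\<bar> * \<bar>x\<bar> ^ m" by simp
  qed (auto intro: summable_sum sm summable_euler_coeff)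
  finally show ?thesis unfolding abs_euler_def .
qed

lemma summable_abs_flat_seq: "summable (\<lambda>k. \<bar>flat_seq s x k\<bar>)"
  by (rule bounded_imp_summable[where B = "abs_euler x"])
     (use sum_abs_flat_seq_le[of s x "Suc _"] in \<open>auto simp: lessThan_Suc_atMost\<close>)

lemma suminf_abs_flat_seq_le: "(\<Sum>k. \<bar>flat_seq s x k\<bar>) \<le> abs_euler x"
  by (rule suminf_le_const[OF summable_abs_flat_seq sum_abs_flat_seq_le])

lemma power_le_fact_mult_exp:
  assumes "y \<ge> (0::real)"
  shows "y ^ j \<le> fact j * exp y"
proof -
  have s: "summable (\<lambda>n. y ^ n /\<^sub>R fact n)" by (rule summable_exp_generic)
  have "sum (\<lambda>n. y ^ n /\<^sub>R fact n) {j} \<le> (\<Sum>n. y ^ n /\<^sub>R fact n)"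
    by (rule sum_le_suminf[OF s]) (use assms in auto)
  then have "y ^ j / fact j \<le> exp y" by (simp add: exp_def field_simps)
  then show ?thesis by (simp add: field_simps)
qed

text \<open>With \<open>e = (1/2) ^ (m + s)\<close>, the power \<open>(1 + e) ^ Suc k\<close> is at
  least \<open>exp (Suc k * e / 2)\<close>, hence at least
  \<open>(Suc k * e / 2) ^ j / fact j\<close>. Dividing by it costs \<open>1 / e ^ j\<close>, whose
  growth in \<open>m\<close> is \<open>(2 ^ j) ^ m\<close> and is absorbed by
  \<open>abs_flat_seq_le\<close>.\<close>

lemma flat_seq_decay: "\<exists>C. \<forall>k. real (Suc k) ^ j * \<bar>flat_seq s x k\<bar> \<le> C"
proof (intro exI allI)
  fix k
  have "resolvent_coeff (m + s) k \<le> (fact j * 2 ^ j * (2 ^ s) ^ j / real (Suc k) ^ j) * (2 ^ j) ^ m" for m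
  proof -
    define e where "e = (1/2::real) ^ (m + s)"
    have e: "0 < e" "e \<le> 1" by (auto simp: e_def power_le_one)
    have "1 + e/2 + (e/2) ^ 2 \<ge> exp (e/2)" using exp_bound[of "e/2"] e by auto
    moreover have "(e/2) ^ 2 \<le> e/2" using e by (auto simp: power2_eq_square intro: mult_left_le)
    ultimately have ee: "exp (e/2) \<le> 1 + e" by simp
    have "(real (Suc k) * (e/2)) ^ j \<le> fact j * exp (real (Suc k) * (e/2))"
      using e by (intro power_le_fact_mult_exp) auto
    also have "exp (real (Suc k) * (e/2)) = exp (e/2) ^ Suc k" by (rule exp_of_nat_mult)
    also have "fact j * exp (e/2) ^ Suc k \<le> fact j * (1 + e) ^ Suc k"
      by (intro mult_left_mono power_mono ee) auto
    finally have *: "(real (Suc k) * (e/2)) ^ j \<le> fact j * (1 + e) ^ Suc k" .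
    have "resolvent_coeff (m + s) k \<le> 1 / (1 + e) ^ Suc k"
      using e by (simp add: resolvent_coeff_def divide_right_mono flip: e_def)
    also have "\<dots> \<le> fact j / (real (Suc k) * (e/2)) ^ j"
      using * e by (simp add: divide_le_eq le_divide_eq mult.commute del: power_Suc of_nat_Suc)
    also have "\<dots> = (fact j * 2 ^ j * (2 ^ s) ^ j / real (Suc k) ^ j) * (2 ^ j) ^ m"
    proof -
      have "e = 1 / (2 ^ m * 2 ^ s)" by (simp add: e_def power_add power_one_over)
      then have "real (Suc k) * (e/2) = real (Suc k) / (2 * 2 ^ s * 2 ^ m)" by simp
      then have "(real (Suc k) * (e/2)) ^ j = real (Suc k) ^ j / (2 ^ j * (2 ^ s) ^ j * (2 ^ m) ^ j)"
        by (simp only: power_divide power_mult_distrib)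
      moreover have "((2::real) ^ m) ^ j = (2 ^ j) ^ m" by (metis power_mult mult.commute)
      ultimately show ?thesis by simp
    qed
    finally show ?thesis .
  qed
  from abs_flat_seq_le[OF this, of x]
  have "\<bar>flat_seq s x k\<bar> \<le> fact j * 2 ^ j * (2 ^ s) ^ j / real (Suc k) ^ j * abs_euler (x * 2 ^ j)"
    by simp
  then show "real (Suc k) ^ j * \<bar>flat_seq s x k\<bar> \<le> fact j * 2 ^ j * (2 ^ s) ^ j * abs_euler (x * 2 ^ j)"
    by (simp add: le_divide_eq mult.commute del: of_nat_Suc)
qed

section \<open>Convolution with summable sequences\<close>

text \<open>Controls all exponents at once, since the \<open>p\<close>-th power of
  \<open>cmod (f t)\<close> is at most \<open>A powr (p - 1) * cmod (f t)\<close>. The two bounds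
  are kept apart because in the last section \<open>A\<close> tends to 0 while \<open>B\<close>
  stays merely bounded.\<close>

definition sup_L1_le :: "real \<Rightarrow> real \<Rightarrow> (real \<Rightarrow> complex) \<Rightarrow> bool" where
  "sup_L1_le A B f \<longleftrightarrow> f \<in> borel_measurable borel \<and> (\<forall>t. cmod (f t) \<le> A) \<and>
     integrable lborel f \<and> (LINT t|lborel. cmod (f t)) \<le> B"

lemma sup_L1_leD:
  assumes "sup_L1_le A B f"
  shows "f \<in> borel_measurable borel" "cmod (f t) \<le> A" "integrable lborel f"
    "(LINT t|lborel. cmod (f t)) \<le> B" "0 \<le> A" "0 \<le> B"
proof -
  show 1: "f \<in> borel_measurable borel" "cmod (f t) \<le> A" "integrable lborel f"
    "(LINT t|lborel. cmod (f t)) \<le> B" for t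
    using assms by (auto simp: sup_L1_le_def)
  show "0 \<le> A" using 1(2)[of 0] norm_ge_zero[of "f 0"] by linarith
  have "0 \<le> (LINT t|lborel. cmod (f t))" by simp
  then show "0 \<le> B" using 1(4) by linarith
qed

lemma sup_L1_le_mono: "sup_L1_le A B f \<Longrightarrow> A \<le> A' \<Longrightarrow> B \<le> B' \<Longrightarrow> sup_L1_le A' B' f"
  unfolding sup_L1_le_def by (meson order_trans)

lemma sup_L1_le_add:
  assumes f: "sup_L1_le A B f" and g: "sup_L1_le A' B' g"
  shows "sup_L1_le (A + A') (B + B') (\<lambda>t. f t + g t)"
  unfolding sup_L1_le_def
proof (intro conjI allI)
  note f' = sup_L1_leD[OF f] and g' = sup_L1_leD[OF g]
  show "(\<lambda>t. f t + g t) \<in> borel_measurable borel" using f'(1) g'(1) by measurable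
  show "cmod (f t + g t) \<le> A + A'" for t
    using norm_triangle_ineq[of "f t" "g t"] f'(2)[of t] g'(2)[of t] by linarith
  show "integrable lborel (\<lambda>t. f t + g t)" using f'(3) g'(3) by simp
  have "(LINT t|lborel. cmod (f t + g t)) \<le> (LINT t|lborel. cmod (f t) + cmod (g t))"
    using f'(3) g'(3) by (intro integral_mono) (auto intro: norm_triangle_ineq)
  then show "(LINT t|lborel. cmod (f t + g t)) \<le> B + B'"
    using f'(3,4) g'(3,4) by simp
qed

lemma sup_L1_le_cmult:
  assumes f: "sup_L1_le A B f"
  shows "sup_L1_le (cmod c * A) (cmod c * B) (\<lambda>t. c * f t)"
  using sup_L1_leD[OF f] unfolding sup_L1_le_def
  by (auto simp: norm_mult intro!: mult_left_mono)

lemma sup_L1_le_zero: "0 \<le> A \<Longrightarrow> 0 \<le> B \<Longrightarrow> sup_L1_le A B (\<lambda>t. 0)"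
  by (simp add: sup_L1_le_def)

lemma sup_L1_le_sum:
  assumes "\<And>i. i \<in> I \<Longrightarrow> sup_L1_le (A i) (B i) (f i)"
  shows "sup_L1_le (\<Sum>i\<in>I. A i) (\<Sum>i\<in>I. B i) (\<lambda>t. \<Sum>i\<in>I. f i t)"
  using assms
proof (induction I rule: infinite_finite_induct)
  case (insert x F)
  then show ?case by (simp add: sup_L1_le_add)
qed (simp_all add: sup_L1_le_zero)

lemma sup_L1_le_translate:
  assumes f: "sup_L1_le A B f"
  shows "sup_L1_le A B (\<lambda>t. f (t - x))"
  unfolding sup_L1_le_def
proof (intro conjI allI)
  note f' = sup_L1_leD[OF f]
  show "(\<lambda>t. f (t - x)) \<in> borel_measurable borel" using f'(1) by measurable
  show "cmod (f (t - x)) \<le> A" for t by (rule f'(2))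
  show "integrable lborel (\<lambda>t. f (t - x))"
    using lborel_integrable_real_affine[OF f'(3), of 1 "- x"] by (simp add: add.commute)
  have "(LINT t|lborel. cmod (f t)) = (LINT t|lborel. cmod (f (t - x)))"
    using lborel_integral_real_affine[of 1 "\<lambda>t. cmod (f t)" "- x"] by (simp add: add.commute)
  then show "(LINT t|lborel. cmod (f (t - x))) \<le> B" using f'(4) by simp
qed

lemma integrable_inverse_1_plus_square_lborel:
  "integrable lborel (\<lambda>t::real. 1 / (1 + t\<^sup>2))" "(LINT t|lborel. 1 / (1 + (t::real)\<^sup>2)) = pi"
proof -
  let ?f = "\<lambda>t::real. 1 / (1 + t\<^sup>2)"
  have nz: "1 + t\<^sup>2 \<noteq> 0" for t :: real by (metis add_pos_nonneg less_irrefl zero_le_power2 zero_less_one)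
  have A: "((arctan \<circ> real_of_ereal) \<longlongrightarrow> - pi/2) (at_right (-\<infinity>))"
    by (simp add: ereal_tendsto_simps1 tendsto_arctan_at_bot)
  have B: "((arctan \<circ> real_of_ereal) \<longlongrightarrow> pi/2) (at_left \<infinity>)"
    by (simp add: ereal_tendsto_simps1 tendsto_arctan_at_top)
  have D: "DERIV arctan x :> ?f x" for x
    using DERIV_arctan[of x] by (simp add: divide_inverse)
  have C: "isCont ?f x" for x using nz by (intro continuous_intros) auto
  note FTC = interval_integral_FTC_nonneg[of "-\<infinity>" \<infinity> arctan ?f "- pi/2" "pi/2", OF _ D C _ A B]
  have "set_integrable lborel (einterval (-\<infinity>) \<infinity>) ?f" by (rule FTC(1)) auto
  then show "integrable lborel ?f" by (simp add: set_integrable_def)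
  have "(LBINT x=-\<infinity>..\<infinity>. ?f x) = pi" by (subst FTC(2)) auto
  then show "integral\<^sup>L lborel ?f = pi" 
    by (simp add: interval_lebesgue_integral_def set_lebesgue_integral_def)
qed

lemma sup_L1_le_decay:
  assumes m: "f \<in> borel_measurable borel" and b: "\<And>t. cmod (f t) \<le> C / (1 + t\<^sup>2)"
  shows "sup_L1_le C (C * pi) f"
  unfolding sup_L1_le_def
proof (intro conjI allI m)
  have C: "C \<ge> 0" using b[of 0] norm_ge_zero[of "f 0"] by (simp del: norm_ge_zero)
  have i: "integrable lborel (\<lambda>t::real. C / (1 + t\<^sup>2))"
    using integrable_mult_right[OF integrable_inverse_1_plus_square_lborel(1), of C] by simp
  show "cmod (f t) \<le> C" for t
  proof -
    have "C / (1 + t\<^sup>2) \<le> C / 1" by (rule divide_left_mono) (use C in \<open>auto intro: add_pos_nonneg\<close>)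
    then show ?thesis using b[of t] by simp
  qed
  show fi: "integrable lborel f"
  proof (rule Bochner_Integration.integrable_bound[OF i])
    show "AE t in lborel. norm (f t) \<le> norm (C / (1 + t\<^sup>2))"
      using b C by (intro AE_I2) (simp add: abs_of_nonneg)
  qed (use m in simp)
  have "(LINT t|lborel. cmod (f t)) \<le> (LINT t|lborel. C / (1 + t\<^sup>2))"
    using b fi i by (intro integral_mono) auto
  also have "\<dots> = C * pi"
    using integrable_inverse_1_plus_square_lborel(2)
      Bochner_Integration.integral_mult_right[OF integrable_inverse_1_plus_square_lborel(1), of C]
    by simp
  finally show "(LINT t|lborel. cmod (f t)) \<le> C * pi" .
qed

definition conv :: "(nat \<Rightarrow> real) \<Rightarrow> (real \<Rightarrow> complex) \<Rightarrow> real \<Rightarrow> complex" where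
  "conv a f t = (\<Sum>k. a k *\<^sub>R f (t - real k))"

definition fun_diff :: "(real \<Rightarrow> complex) \<Rightarrow> real \<Rightarrow> complex" where
  "fun_diff f t = f t - f (t - 1)"

lemma summable_norm_conv:
  assumes "summable (\<lambda>k. \<bar>a k\<bar>)" "\<And>t. cmod (f t) \<le> A"
  shows "summable (\<lambda>k. norm (a k *\<^sub>R f (t - real k)))"
proof (rule summable_comparison_test')
  show "summable (\<lambda>k. \<bar>a k\<bar> * A)" using assms(1) by (rule summable_mult2)
  show "norm (norm (a k *\<^sub>R f (t - real k))) \<le> \<bar>a k\<bar> * A" if "k \<ge> 0" for k
    using assms(2) by (auto intro: mult_left_mono)
qed

lemmas summable_conv = summable_norm_cancel[OF summable_norm_conv]

lemma sup_L1_le_conv: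
  assumes a: "summable (\<lambda>k. \<bar>a k\<bar>)" and f: "sup_L1_le A B f"
  shows "sup_L1_le ((\<Sum>k. \<bar>a k\<bar>) * A) ((\<Sum>k. \<bar>a k\<bar>) * B) (conv a f)"
  unfolding sup_L1_le_def
proof (intro conjI allI)
  note f' = sup_L1_leD[OF f]
  have tr: "sup_L1_le A B (\<lambda>t. f (t - x))" for x by (rule sup_L1_le_translate[OF f])
  note tr' = sup_L1_leD[OF tr]
  note sm = summable_norm_conv[where f = f, OF a f'(2)]
  show "conv a f \<in> borel_measurable borel"
    unfolding conv_def[abs_def] using f'(1) by measurable
  show "cmod (conv a f t) \<le> (\<Sum>k. \<bar>a k\<bar>) * A" for t
  proof -
    have "cmod (conv a f t) \<le> (\<Sum>k. norm (a k *\<^sub>R f (t - real k)))"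
      unfolding conv_def by (rule summable_norm[OF sm])
    also have "\<dots> \<le> (\<Sum>k. \<bar>a k\<bar> * A)"
      using f'(2) by (intro suminf_le sm summable_mult2 a) (auto intro: mult_left_mono)
    also have "\<dots> = (\<Sum>k. \<bar>a k\<bar>) * A" by (rule suminf_mult2[symmetric, OF a])
    finally show ?thesis .
  qed
  have int: "integrable lborel (\<lambda>t. a k *\<^sub>R f (t - real k))" for k using tr'(3) by simp
  have le: "(LINT t|lborel. norm (a k *\<^sub>R f (t - real k))) \<le> \<bar>a k\<bar> * B" for k
    using tr'(4)[of "real k"] by (simp add: mult_left_mono)
  have sI: "summable (\<lambda>k. LINT t|lborel. norm (a k *\<^sub>R f (t - real k)))"
  proof (rule summable_comparison_test')
    show "summable (\<lambda>k. \<bar>a k\<bar> * B)" using a by (rule summable_mult2)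
    show "norm (LINT t|lborel. norm (a k *\<^sub>R f (t - real k))) \<le> \<bar>a k\<bar> * B" if "k \<ge> 0" for k
      using le[of k] by (subst real_norm_def, subst abs_of_nonneg) (auto simp del: norm_scaleR)
  qed
  show ci: "integrable lborel (conv a f)"
    unfolding conv_def[abs_def] by (rule integrable_suminf[OF int _ sI]) (use sm in auto)
  have in': "integrable lborel (\<lambda>t. \<Sum>k. norm (a k *\<^sub>R f (t - real k)))"
    by (rule integrable_suminf[OF integrable_norm[OF int]]) (use sm sI in auto)
  have "(LINT t|lborel. cmod (conv a f t)) \<le> (LINT t|lborel. (\<Sum>k. norm (a k *\<^sub>R f (t - real k))))"
    unfolding conv_def by (intro integral_mono in' summable_norm sm) (use ci in \<open>simp add: conv_def[abs_def]\<close>)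
  also have "\<dots> = (\<Sum>k. LINT t|lborel. norm (a k *\<^sub>R f (t - real k)))"
    by (rule integral_suminf[OF integrable_norm[OF int]]) (use sm sI in auto)
  also have "\<dots> \<le> (\<Sum>k. \<bar>a k\<bar> * B)"
    by (intro suminf_le le sI summable_mult2 a)
  also have "\<dots> = (\<Sum>k. \<bar>a k\<bar>) * B" by (rule suminf_mult2[symmetric, OF a])
  finally show "(LINT t|lborel. cmod (conv a f t)) \<le> (\<Sum>k. \<bar>a k\<bar>) * B" .
qed

lemma conv_add:
  assumes "summable (\<lambda>k. \<bar>a k\<bar>)" "\<And>t. cmod (f t) \<le> A" "\<And>t. cmod (g t) \<le> B"
  shows "conv a (\<lambda>t. f t + g t) t = conv a f t + conv a g t"
  unfolding conv_def scaleR_add_right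
  by (rule suminf_add[symmetric]; rule summable_conv[OF assms(1)]) (rule assms)+

lemma conv_cmult:
  assumes "summable (\<lambda>k. \<bar>a k\<bar>)" "\<And>t. cmod (f t) \<le> A"
  shows "conv a (\<lambda>t. c * f t) t = c * conv a f t"
  unfolding conv_def mult_scaleR_right[symmetric]
  by (rule suminf_mult, rule summable_conv[OF assms(1)]) (rule assms)

lemma conv_diff:
  assumes "summable (\<lambda>k. \<bar>a k\<bar>)" "\<And>t. cmod (f t) \<le> A" "\<And>t. cmod (g t) \<le> B"
  shows "conv a (\<lambda>t. f t - g t) t = conv a f t - conv a g t"
  unfolding conv_def scaleR_diff_right
  by (rule suminf_diff[symmetric]; rule summable_conv[OF assms(1)]) (rule assms)+

lemma conv_fun_diff:
  assumes "summable (\<lambda>k. \<bar>a k\<bar>)" "\<And>t. cmod (f t) \<le> A"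
  shows "conv a (fun_diff f) t = fun_diff (conv a f) t"
  unfolding fun_diff_def
  by (subst conv_diff[OF assms(1,2), of "\<lambda>t. f (t - 1)" A])
     (use assms(2) in \<open>auto simp: conv_def algebra_simps\<close>)

lemma summable_seq_diff:
  assumes "summable (\<lambda>k. \<bar>a k\<bar>)"
  shows "summable (\<lambda>k. \<bar>seq_diff a k\<bar>)"
proof -
  have "summable (\<lambda>k. \<bar>a (Suc k)\<bar> + \<bar>a k\<bar>)"
    using assms by (intro summable_add) (simp_all add: summable_Suc_iff[of "\<lambda>k. \<bar>a k\<bar>"])
  then have "summable (\<lambda>k. \<bar>seq_diff a (Suc k)\<bar>)"
    by (rule summable_comparison_test'[where N = 0]) (simp add: seq_diff_def)
  then show ?thesis by (subst (asm) summable_Suc_iff)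
qed

lemma conv_seq_diff:
  assumes "summable (\<lambda>k. \<bar>a k\<bar>)" "\<And>t. cmod (f t) \<le> A"
  shows "conv (seq_diff a) f t = fun_diff (conv a f) t"
proof -
  note s = summable_conv[where f = f, OF assms]
  have s1: "summable (\<lambda>k. a (Suc k) *\<^sub>R f (t - real (Suc k)))"
    using s by (subst summable_Suc_iff)
  have "conv (seq_diff a) f t = seq_diff a 0 *\<^sub>R f t + (\<Sum>k. seq_diff a (Suc k) *\<^sub>R f (t - real (Suc k)))"
    unfolding conv_def
    by (subst suminf_split_head) (use summable_conv[where f = f, OF summable_seq_diff[OF assms(1)] assms(2)] in auto)
  also have "(\<Sum>k. seq_diff a (Suc k) *\<^sub>R f (t - real (Suc k)))
      = (\<Sum>k. a (Suc k) *\<^sub>R f (t - real (Suc k)) - a k *\<^sub>R f ((t - 1) - real k))"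
    by (simp add: seq_diff_def scaleR_diff_left algebra_simps)
  also have "\<dots> = (\<Sum>k. a (Suc k) *\<^sub>R f (t - real (Suc k))) - conv a f (t - 1)"
    unfolding conv_def by (rule suminf_diff[symmetric, OF s1 s])
  also have "seq_diff a 0 *\<^sub>R f t + ((\<Sum>k. a (Suc k) *\<^sub>R f (t - real (Suc k))) - conv a f (t - 1))
      = conv a f t - conv a f (t - 1)"
    unfolding conv_def[of a f t] by (subst suminf_split_head[OF s[of t]]) (simp add: seq_diff_def)
  finally show ?thesis by (simp add: fun_diff_def)
qed

section \<open>Lattice sums of inverse squares and the sup norm of a convolution\<close>

definition int_square_sum :: real where
  "int_square_sum = 2 * (\<Sum>k. 1 / (1 + (real k)\<^sup>2))"

lemma sum_int_inverse_square_le: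
  fixes A :: "int set"
  assumes A: "finite A"
  shows "(\<Sum>n\<in>A. 1 / (1 + (real_of_int n)\<^sup>2)) \<le> int_square_sum"
proof -
  let ?g = "\<lambda>n::int. 1 / (1 + (real_of_int n)\<^sup>2)"
  have sm: "summable (\<lambda>n. 1 / (1 + (real n)\<^sup>2))"
  proof (rule summable_comparison_test'[where N = 1])
    show "summable (\<lambda>n. 1 / real n ^ 2)" using inverse_power_summable[of 2, where 'a = real] by (simp add: inverse_eq_divide)
    show "norm (1 / (1 + (real n)\<^sup>2)) \<le> 1 / real n ^ 2" if "1 \<le> n" for n
      using that by (simp add: frac_le)
  qed
  define N where "N = nat (Max (abs ` A))"
  have sub: "A \<subseteq> int ` {..N} \<union> (\<lambda>k. - int k) ` {..N}"
  proof
    fix n assume n: "n \<in> A"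
    then have "nat \<bar>n\<bar> \<le> N" unfolding N_def using A by (intro nat_mono Max_ge) auto
    then show "n \<in> int ` {..N} \<union> (\<lambda>k. - int k) ` {..N}"
      by (cases "n \<ge> 0") (auto intro!: image_eqI[where x = "nat \<bar>n\<bar>"])
  qed
  have "sum ?g A \<le> sum ?g (int ` {..N} \<union> (\<lambda>k. - int k) ` {..N})"
    using A sub by (intro sum_mono2) auto
  also have "\<dots> \<le> sum ?g (int ` {..N}) + sum ?g ((\<lambda>k. - int k) ` {..N})"
    by (subst sum_Un) (auto intro!: sum_nonneg)
  also have "\<dots> = 2 * (\<Sum>k\<le>N. 1 / (1 + (real k)\<^sup>2))"
    by (subst (1 2) sum.reindex) (auto simp: inj_on_def)
  also have "(\<Sum>k\<le>N. 1 / (1 + (real k)\<^sup>2)) \<le> (\<Sum>k. 1 / (1 + (real k)\<^sup>2))"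
    by (rule sum_le_suminf[OF sm]) auto
  finally show ?thesis by (simp add: int_square_sum_def)
qed

lemma int_square_sum_nonneg: "int_square_sum \<ge> 0"
  using sum_int_inverse_square_le[of "{}"] by simp

text \<open>An instance of Peetre's inequality; inverse-square decay survives when the argument
  moves by a bounded amount.\<close>

lemma one_plus_square_le:
  fixes x y d :: real
  assumes "\<bar>x - y\<bar> \<le> d"
  shows "1 / (1 + y\<^sup>2) \<le> (2 + 2 * d\<^sup>2) / (1 + x\<^sup>2)"
proof -
  have "x\<^sup>2 = ((x - y) + y)\<^sup>2" by simp
  also have "\<dots> \<le> 2 * (x - y)\<^sup>2 + 2 * y\<^sup>2"
    using zero_le_power2[of "(x - y) - y"] by (simp add: power2_eq_square algebra_simps)
  also have "(x - y)\<^sup>2 \<le> d\<^sup>2" using assms power_mono[of "\<bar>x - y\<bar>" d 2] by simp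
  finally have "1 + x\<^sup>2 \<le> 1 + 2 * d\<^sup>2 + 2 * y\<^sup>2" by simp
  moreover have "0 \<le> d\<^sup>2 * y\<^sup>2" by simp
  moreover have "(2 + 2 * d\<^sup>2) * (1 + y\<^sup>2) = 2 + 2 * d\<^sup>2 + 2 * y\<^sup>2 + 2 * (d\<^sup>2 * y\<^sup>2)"
    by (simp add: algebra_simps)
  ultimately have "1 + x\<^sup>2 \<le> (2 + 2 * d\<^sup>2) * (1 + y\<^sup>2)" by linarith
  moreover have "1 + x\<^sup>2 > 0" "1 + y\<^sup>2 > 0" by (auto intro: add_pos_nonneg)
  ultimately show ?thesis 
    by (simp add: pos_le_divide_eq pos_divide_le_eq mult.commute)
qed

text \<open>Only a uniform bound for the coefficients enters the estimate, because the decay of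
  \<open>f\<close> lets its integer translates overlap boundedly. The factor 4 comes from replacing
  \<open>t\<close> by its integer part, that is, from \<open>one_plus_square_le\<close> with
  \<open>d = 1\<close>. The applications are to coefficients that are uniformly small but not small
  in \<open>l1\<close>.\<close>

lemma conv_sup_le:
  assumes a: "summable (\<lambda>k. \<bar>a k\<bar>)" and al: "\<And>k. \<bar>a k\<bar> \<le> \<alpha>"
    and f: "\<And>t. cmod (f t) \<le> C / (1 + t\<^sup>2)"
  shows "cmod (conv a f t) \<le> 4 * int_square_sum * C * \<alpha>"
proof -
  have C: "C \<ge> 0" using f[of 0] norm_ge_zero[of "f 0"] by (simp del: norm_ge_zero)
  have al0: "\<alpha> \<ge> 0" using al[of 0] abs_ge_zero[of "a 0"] by linarith
  have fA: "cmod (f t) \<le> C" for t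
  proof -
    have "C / (1 + t\<^sup>2) \<le> C / 1" by (rule divide_left_mono) (use C in \<open>auto intro: add_pos_nonneg\<close>)
    then show ?thesis using f[of t] by simp
  qed
  have "(\<Sum>k<K. norm (a k *\<^sub>R f (t - real k))) \<le> 4 * int_square_sum * C * \<alpha>" for K
  proof -
    have "(\<Sum>k<K. norm (a k *\<^sub>R f (t - real k))) \<le> (\<Sum>k<K. \<alpha> * (C * (4 * (1 / (1 + (real_of_int (\<lfloor>t\<rfloor> - int k))\<^sup>2)))))"
    proof (rule sum_mono)
      fix k
      have "1 / (1 + (t - real k)\<^sup>2) \<le> (2 + 2 * 1\<^sup>2) / (1 + (real_of_int (\<lfloor>t\<rfloor> - int k))\<^sup>2)"
        by (rule one_plus_square_le) (simp, linarith)
      then have "C * (1 / (1 + (t - real k)\<^sup>2)) \<le> C * (4 * (1 / (1 + (real_of_int (\<lfloor>t\<rfloor> - int k))\<^sup>2)))"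
        using C by (intro mult_left_mono) simp_all
      then have "cmod (f (t - real k)) \<le> C * (4 * (1 / (1 + (real_of_int (\<lfloor>t\<rfloor> - int k))\<^sup>2)))"
        using f[of "t - real k"] by simp
      then show "norm (a k *\<^sub>R f (t - real k)) \<le> \<alpha> * (C * (4 * (1 / (1 + (real_of_int (\<lfloor>t\<rfloor> - int k))\<^sup>2))))"
        unfolding norm_scaleR using al al0 by (intro mult_mono) auto
    qed
    also have "\<dots> = 4 * C * \<alpha> * (\<Sum>k<K. 1 / (1 + (real_of_int (\<lfloor>t\<rfloor> - int k))\<^sup>2))"
      unfolding sum_distrib_left by (intro sum.cong refl) (simp only: mult_ac)
    also have "(\<Sum>k<K. 1 / (1 + (real_of_int (\<lfloor>t\<rfloor> - int k))\<^sup>2))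
        = (\<Sum>n\<in>(\<lambda>k. \<lfloor>t\<rfloor> - int k) ` {..<K}. 1 / (1 + (real_of_int n)\<^sup>2))"
      by (subst sum.reindex) (auto simp: inj_on_def)
    also have "4 * C * \<alpha> * \<dots> \<le> 4 * C * \<alpha> * int_square_sum"
      using C al0 by (intro mult_left_mono sum_int_inverse_square_le) auto
    finally show ?thesis by (simp add: mult_ac)
  qed
  then have "(\<Sum>k. norm (a k *\<^sub>R f (t - real k))) \<le> 4 * int_square_sum * C * \<alpha>"
    by (intro suminf_le_const summable_norm_conv[where f = f, OF a fA])
  then show ?thesis
    unfolding conv_def using summable_norm[OF summable_norm_conv[where f = f and t = t, OF a fA]] by linarith
qed

section \<open>Polynomials times a Gaussian\<close>

definition gauss_poly :: "complex poly \<Rightarrow> real \<Rightarrow> complex" where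
  "gauss_poly P t = poly P (of_real t) * of_real (exp (- t\<^sup>2))"

text \<open>Differentiation of a polynomial times the Gaussian; the iterates on 1 are the Hermite
  polynomials up to sign.\<close>

definition gauss_pderiv :: "complex poly \<Rightarrow> complex poly" where
  "gauss_pderiv P = pderiv P - [:0, 2:] * P"

lemma gauss_poly_has_vector_derivative:
  "(gauss_poly P has_vector_derivative gauss_poly (gauss_pderiv P) t) (at t)"
proof -
  have p: "((\<lambda>t. poly P (of_real t)) has_vector_derivative poly (pderiv P) (of_real t)) (at t)"
    using has_vector_derivative_real_field[OF poly_DERIV[of P "of_real t"], of UNIV] by simp
  have "((\<lambda>t. exp (- t\<^sup>2)) has_real_derivative (- 2 * t) * exp (- t\<^sup>2)) (at t)"
    by (auto intro!: derivative_eq_intros)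
  then have e: "((\<lambda>t. of_real (exp (- t\<^sup>2))) has_vector_derivative
      (of_real ((- 2 * t) * exp (- t\<^sup>2)) :: complex)) (at t)"
    by (rule has_vector_derivative_of_real)
  show ?thesis
    unfolding gauss_poly_def[abs_def]
    by (rule has_vector_derivative_eq_rhs[OF has_vector_derivative_mult[OF p e]])
       (simp add: gauss_pderiv_def algebra_simps)
qed

lemma continuous_gauss_poly: "continuous_on UNIV (gauss_poly P)"
  unfolding gauss_poly_def[abs_def] by (intro continuous_intros)

lemma poly_le_exp: "\<exists>C\<ge>0. \<forall>t::real. cmod (poly P (of_real t)) \<le> C * exp \<bar>t\<bar>"
proof (intro exI conjI allI)
  let ?C = "\<Sum>i\<le>degree P. cmod (coeff P i) * fact i"
  show "0 \<le> ?C" by (intro sum_nonneg) auto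
  fix t :: real
  have "cmod (poly P (of_real t)) \<le> (\<Sum>i\<le>degree P. cmod (coeff P i * of_real t ^ i))"
    unfolding poly_altdef by (rule norm_sum)
  also have "\<dots> \<le> (\<Sum>i\<le>degree P. cmod (coeff P i) * (fact i * exp \<bar>t\<bar>))"
    by (intro sum_mono) (auto simp: norm_mult norm_power intro!: mult_left_mono power_le_fact_mult_exp)
  finally show "cmod (poly P (of_real t)) \<le> ?C * exp \<bar>t\<bar>" by (simp add: sum_distrib_right mult.assoc)
qed

lemma gauss_poly_exp_bounded: "\<exists>C. \<forall>t. exp \<bar>t\<bar> * cmod (gauss_poly P t) \<le> C"
proof -
  obtain C where C: "C \<ge> 0" "\<And>t::real. cmod (poly P (of_real t)) \<le> C * exp \<bar>t\<bar>"
    using poly_le_exp by blast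
  show ?thesis
  proof (intro exI allI)
    fix t :: real
    have "2 * \<bar>t\<bar> - t\<^sup>2 \<le> 1" using zero_le_power2[of "\<bar>t\<bar> - 1"] by (simp add: power2_diff)
    then have "exp (\<bar>t\<bar> + \<bar>t\<bar> - t\<^sup>2) \<le> exp 1" by simp
    then have e: "exp \<bar>t\<bar> * (exp \<bar>t\<bar> * exp (- t\<^sup>2)) \<le> exp 1" by (simp flip: exp_add)
    have "exp \<bar>t\<bar> * cmod (gauss_poly P t) = cmod (poly P (of_real t)) * (exp \<bar>t\<bar> * exp (- t\<^sup>2))"
      unfolding gauss_poly_def norm_mult norm_of_real by simp
    also have "\<dots> \<le> C * exp \<bar>t\<bar> * (exp \<bar>t\<bar> * exp (- t\<^sup>2))"
      using C(2) by (intro mult_right_mono) auto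
    also have "\<dots> \<le> C * exp 1" using mult_left_mono[OF e C(1)] by (simp only: mult.assoc)
    finally show "exp \<bar>t\<bar> * cmod (gauss_poly P t) \<le> C * exp 1" .
  qed
qed

lemma gauss_poly_bounded: "\<exists>C. \<forall>t. cmod (gauss_poly P t) \<le> C"
proof -
  obtain C where C: "\<And>t. exp \<bar>t\<bar> * cmod (gauss_poly P t) \<le> C"
    using gauss_poly_exp_bounded by blast
  have "cmod (gauss_poly P t) \<le> C" for t
    using mult_right_mono[of 1 "exp \<bar>t\<bar>" "cmod (gauss_poly P t)"] C[of t] by simp
  then show ?thesis by blast
qed

lemma gauss_poly_weighted_bounded: "\<exists>C. \<forall>t. cmod (poly Q (of_real t)) * cmod (gauss_poly P t) \<le> C"
  using gauss_poly_bounded[of "Q * P"] by (simp add: gauss_poly_def norm_mult mult.assoc)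

lemma gauss_poly_decay: "\<exists>C. \<forall>t. cmod (gauss_poly P t) \<le> C / (1 + t\<^sup>2)"
proof -
  obtain C where C: "\<And>t. cmod (poly [:1, 0, 1:] (of_real t)) * cmod (gauss_poly P t) \<le> C"
    using gauss_poly_weighted_bounded by blast
  have "cmod (poly [:1, 0, 1:] (of_real t)) = 1 + t\<^sup>2" for t :: real
  proof -
    have "poly [:1, 0, 1:] (of_real t) = (of_real (1 + t\<^sup>2) :: complex)" by (simp add: power2_eq_square)
    then show ?thesis unfolding norm_of_real by (simp only: norm_of_real) simp
  qed
  then have "(1 + t\<^sup>2) * cmod (gauss_poly P t) \<le> C" for t using C[of t] by simp
  moreover have "1 + t\<^sup>2 > 0" for t :: real by (simp add: add_pos_nonneg)
  ultimately show ?thesis by (auto simp: pos_le_divide_eq mult.commute)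
qed

section \<open>Backward differences and the mean value theorem\<close>

lemma vector_mean_value_bound:
  fixes f :: "real \<Rightarrow> 'a::real_normed_vector"
  assumes d: "\<And>y. (f has_vector_derivative f' y) (at y)"
    and B: "\<And>y. y \<in> closed_segment a b \<Longrightarrow> norm (f' y) \<le> B"
  shows "norm (f b - f a) \<le> B * \<bar>b - a\<bar>"
proof -
  have "norm (f b - f a) \<le> B * norm (b - a)"
  proof (rule differentiable_bound[where S = "closed_segment a b" and f' = "\<lambda>y h. h *\<^sub>R f' y"])
    show "(f has_derivative (\<lambda>h. h *\<^sub>R f' x)) (at x within closed_segment a b)" for x
      using d[of x] unfolding has_vector_derivative_def by (rule has_derivative_at_withinI)
    show "onorm (\<lambda>h. h *\<^sub>R f' x) \<le> B" if "x \<in> closed_segment a b" for x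
    proof (rule onorm_bound)
      show "0 \<le> B" using B[OF that] norm_ge_zero[of "f' x"] by linarith
      show "norm (h *\<^sub>R f' x) \<le> B * norm h" for h
        using mult_right_mono[OF B[OF that], of "\<bar>h\<bar>"] by (simp add: mult.commute)
    qed
  qed auto
  then show ?thesis by simp
qed

definition back_diff :: "real \<Rightarrow> (real \<Rightarrow> complex) \<Rightarrow> real \<Rightarrow> complex" where
  "back_diff h f x = f x - f (x - h)"

text \<open>The differences \<open>back_diff h (F j)\<close> again form a chain of derivatives, and
  the mean value bound turns \<open>B\<close> for \<open>F (Suc i)\<close> into \<open>B * h\<close>
  for them. The derivative is bounded only on the interval that the difference reaches, so that
  decay in \<open>x\<close> is not lost.\<close>

lemma back_diff_funpow_bound:
  assumes "\<And>i y. (F i has_vector_derivative F (Suc i) y) (at y)" "h \<ge> 0"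
    and "\<And>y. y \<in> {x - real i * h..x} \<Longrightarrow> cmod (F i y) \<le> B"
  shows "cmod ((back_diff h ^^ i) (F 0) x) \<le> h ^ i * B"
  using assms
proof (induction i arbitrary: F B)
  case (Suc i)
  define F' where "F' j = back_diff h (F j)" for j
  have "cmod ((back_diff h ^^ i) (F' 0) x) \<le> h ^ i * (B * h)"
  proof (rule Suc.IH)
    show "(F' j has_vector_derivative F' (Suc j) y) (at y)" for j y
    proof -
      have sh: "((\<lambda>x. F j (x - h)) has_vector_derivative F (Suc j) (y - h)) (at y)"
        using vector_diff_chain_at[of "\<lambda>x. x - h" 1 y "F j" "F (Suc j) (y - h)"] Suc.prems(1)[of j "y - h"]
        by (simp add: o_def has_vector_derivative_diff_const)
      show ?thesis unfolding F'_def back_diff_def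
        by (rule has_vector_derivative_diff[OF Suc.prems(1) sh])
    qed
    fix y assume y: "y \<in> {x - real i * h..x}"
    have "cmod (F i y - F i (y - h)) \<le> B * \<bar>y - (y - h)\<bar>"
    proof (rule vector_mean_value_bound[OF Suc.prems(1)])
      fix z assume "z \<in> closed_segment (y - h) y"
      then have "y - h \<le> z" "z \<le> y" using Suc.prems(2) by (auto simp: closed_segment_eq_real_ivl)
      then show "cmod (F (Suc i) z) \<le> B"
        using y by (intro Suc.prems(3)) (auto simp: algebra_simps)
    qed
    then show "cmod (F' i y) \<le> B * h" using Suc.prems(2) by (simp add: F'_def back_diff_def)
  qed (use Suc.prems in auto)
  then show ?case by (simp add: F'_def funpow_Suc_right mult_ac del: funpow.simps)
qed simp


section \<open>Sums of integer translates\<close>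

definition int_diff :: "(int \<Rightarrow> complex) \<Rightarrow> int \<Rightarrow> complex" where
  "int_diff q n = q n - q (n - 1)"

text \<open>Meant for finitely supported \<open>q\<close>; for infinite support the sum is 0 by
  convention.\<close>

definition translate_sum :: "(int \<Rightarrow> complex) \<Rightarrow> (real \<Rightarrow> complex) \<Rightarrow> real \<Rightarrow> complex" where
  "translate_sum q h t = (\<Sum>n | q n \<noteq> 0. q n * h (t - of_int n))"

text \<open>Phrased with finite partial sums so that it also covers sequences of infinite support,
  such as the sampled Gaussians before truncation.\<close>

definition l1_le :: "(int \<Rightarrow> complex) \<Rightarrow> real \<Rightarrow> bool" where
  "l1_le q B \<longleftrightarrow> (\<forall>A. finite A \<longrightarrow> (\<Sum>n\<in>A. cmod (q n)) \<le> B)"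

lemma translate_sum_superset:
  assumes "finite A" "{n. q n \<noteq> 0} \<subseteq> A"
  shows "translate_sum q h t = (\<Sum>n\<in>A. q n * h (t - of_int n))"
  unfolding translate_sum_def by (rule sum.mono_neutral_left) (use assms in auto)

lemma mem_image_add_1: "(n::int) \<in> (\<lambda>n. n + 1) ` A \<longleftrightarrow> n - 1 \<in> A"
proof
  assume "n - 1 \<in> A"
  then show "n \<in> (\<lambda>n. n + 1) ` A" by (intro image_eqI[where x = "n - 1"]) simp_all
qed auto

lemma support_int_diff:
  "{n. int_diff q n \<noteq> 0} \<subseteq> {n. q n \<noteq> 0} \<union> (\<lambda>n. n + 1) ` {n. q n \<noteq> 0}"
  by (rule subsetI) (simp add: mem_image_add_1 int_diff_def, force)

lemma finite_support_int_diff: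
  assumes "finite {n. q n \<noteq> 0}"
  shows "finite {n. int_diff q n \<noteq> 0}"
  by (rule finite_subset[OF support_int_diff]) (use assms in simp)

lemma translate_sum_fun_diff:
  assumes "finite {n. q n \<noteq> 0}"
  shows "translate_sum q (fun_diff h) = translate_sum (int_diff q) h"
proof
  fix t
  let ?S = "{n. q n \<noteq> 0}" and ?T = "(\<lambda>n. n + 1) ` {n. q n \<noteq> 0}"
  have fin: "finite (?S \<union> ?T)" using assms by simp
  note sub = support_int_diff[of q]
  have "translate_sum q (fun_diff h) t
      = (\<Sum>n\<in>?S. q n * h (t - of_int n)) - (\<Sum>n\<in>?S. q n * h (t - of_int (n + 1)))"
    by (simp add: translate_sum_def fun_diff_def sum_subtractf algebra_simps)
  also have "(\<Sum>n\<in>?S. q n * h (t - of_int (n + 1))) = (\<Sum>n\<in>?T. q (n - 1) * h (t - of_int n))"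
    by (subst sum.reindex) (auto simp: inj_on_def)
  also have "\<dots> = (\<Sum>n\<in>?S \<union> ?T. q (n - 1) * h (t - of_int n))"
    using assms by (intro sum.mono_neutral_left) (simp_all add: mem_image_add_1)
  also have "(\<Sum>n\<in>?S. q n * h (t - of_int n)) = (\<Sum>n\<in>?S \<union> ?T. q n * h (t - of_int n))"
    using assms by (intro sum.mono_neutral_left) auto
  finally have "translate_sum q (fun_diff h) t = (\<Sum>n\<in>?S \<union> ?T. int_diff q n * h (t - of_int n))"
    by (simp add: int_diff_def sum_subtractf left_diff_distrib)
  then show "translate_sum q (fun_diff h) t = translate_sum (int_diff q) h t"
    unfolding translate_sum_superset[OF fin sub] .
qed

text \<open>Summation by parts, iterated. This is how flatness is exploited: the differences of a
  slowly varying \<open>q\<close> are small in \<open>l1\<close> even where \<open>q\<close> itself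
  is large.\<close>

lemma translate_sum_fun_diff_funpow:
  assumes "finite {n. q n \<noteq> 0}"
  shows "translate_sum q ((fun_diff ^^ i) h) = translate_sum ((int_diff ^^ i) q) h"
  using assms
proof (induction i arbitrary: q)
  case (Suc i)
  have "translate_sum q ((fun_diff ^^ Suc i) h) = translate_sum (int_diff q) ((fun_diff ^^ i) h)"
    using translate_sum_fun_diff[OF Suc.prems, of "(fun_diff ^^ i) h"] by simp
  also have "\<dots> = translate_sum ((int_diff ^^ i) (int_diff q)) h"
    by (rule Suc.IH[OF finite_support_int_diff[OF Suc.prems]])
  also have "(int_diff ^^ i) (int_diff q) = (int_diff ^^ Suc i) q" by (simp add: funpow_swap1)
  finally show ?case .
qed simp

lemma finite_support_int_diff_funpow:
  "finite {n. q n \<noteq> 0} \<Longrightarrow> finite {n. (int_diff ^^ i) q n \<noteq> 0}"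
  by (induction i) (auto intro: finite_support_int_diff)

lemma l1_le_diff:
  assumes "l1_le p A" "l1_le q B"
  shows "l1_le (\<lambda>n. p n - q n) (A + B)"
  unfolding l1_le_def
proof (intro allI impI)
  fix F :: "int set" assume "finite F"
  have "(\<Sum>n\<in>F. cmod (p n - q n)) \<le> (\<Sum>n\<in>F. cmod (p n) + cmod (q n))"
    by (intro sum_mono norm_triangle_ineq4)
  moreover have "(\<Sum>n\<in>F. cmod (p n)) \<le> A" "(\<Sum>n\<in>F. cmod (q n)) \<le> B"
    using assms \<open>finite F\<close> unfolding l1_le_def by simp_all
  ultimately show "(\<Sum>n\<in>F. cmod (p n - q n)) \<le> A + B"
    by (simp add: sum.distrib)
qed

lemma l1_le_int_diff:
  assumes "l1_le q B"
  shows "l1_le (int_diff q) (2 * B)"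
proof -
  have "l1_le (\<lambda>n. q (n - 1)) B"
    unfolding l1_le_def
  proof (intro allI impI)
    fix F :: "int set" assume "finite F"
    have "(\<Sum>n\<in>F. cmod (q (n - 1))) = (\<Sum>n\<in>(\<lambda>n. n - 1) ` F. cmod (q n))"
      by (subst sum.reindex) (auto simp: inj_on_def)
    also have "\<dots> \<le> B" using assms \<open>finite F\<close> by (auto simp: l1_le_def)
    finally show "(\<Sum>n\<in>F. cmod (q (n - 1))) \<le> B" .
  qed
  from l1_le_diff[OF assms this] show ?thesis by (simp add: int_diff_def[abs_def])
qed

lemma l1_le_int_diff_funpow: "l1_le q B \<Longrightarrow> l1_le ((int_diff ^^ i) q) (2 ^ i * B)"
  by (induction i) (auto dest: l1_le_int_diff simp: mult.assoc)

lemma sup_L1_le_translate_sum: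
  assumes fin: "finite {n. q n \<noteq> 0}" and l: "l1_le q C" and h: "sup_L1_le A B h"
  shows "sup_L1_le (C * A) (C * B) (translate_sum q h)"
proof -
  have "sup_L1_le (\<Sum>n | q n \<noteq> 0. cmod (q n) * A) (\<Sum>n | q n \<noteq> 0. cmod (q n) * B)
     (\<lambda>t. \<Sum>n | q n \<noteq> 0. q n * h (t - of_int n))"
    by (intro sup_L1_le_sum sup_L1_le_cmult sup_L1_le_translate h)
  moreover have "(\<Sum>n | q n \<noteq> 0. cmod (q n)) \<le> C" using fin l by (auto simp: l1_le_def)
  ultimately show ?thesis
    using sup_L1_leD(5,6)[OF h] unfolding translate_sum_def[abs_def] sum_distrib_right[symmetric]
    by (elim sup_L1_le_mono) (auto intro: mult_right_mono)
qed

text \<open>Expresses that the sum of \<open>c n * \<psi> (t - n)\<close> is zero in a limiting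
  sense: the sum with \<open>c\<close> itself is not supposed to converge in norm, so
  \<open>c\<close> is approximated by finitely supported \<open>q\<close> in the sup norm with
  weight \<open>\<rho> ^ nat \<bar>n\<bar>\<close>. The set of such \<open>c\<close> is a closed
  subspace for this norm.\<close>

definition annihilable :: "real \<Rightarrow> (real \<Rightarrow> complex) \<Rightarrow> (int \<Rightarrow> complex) \<Rightarrow> bool" where
  "annihilable \<rho> \<psi> c \<longleftrightarrow> (\<forall>\<epsilon>>0. \<exists>q. finite {n. q n \<noteq> 0} \<and>
     (\<forall>n. cmod (c n - q n) \<le> \<epsilon> * \<rho> ^ nat \<bar>n\<bar>) \<and> sup_L1_le \<epsilon> \<epsilon> (translate_sum q \<psi>))"

lemma annihilable_limit:
  assumes "\<And>\<epsilon>. \<epsilon> > 0 \<Longrightarrow> \<exists>c'. annihilable \<rho> \<psi> c' \<and> (\<forall>n. cmod (c n - c' n) \<le> \<epsilon> * \<rho> ^ nat \<bar>n\<bar>)"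
  shows "annihilable \<rho> \<psi> c"
  unfolding annihilable_def
proof (intro allI impI)
  fix \<epsilon> :: real assume e: "\<epsilon> > 0"
  then obtain c' where c': "annihilable \<rho> \<psi> c'" "\<And>n. cmod (c n - c' n) \<le> \<epsilon>/2 * \<rho> ^ nat \<bar>n\<bar>"
    using assms[of "\<epsilon>/2"] by auto
  then obtain q where q: "finite {n. q n \<noteq> 0}" "\<And>n. cmod (c' n - q n) \<le> \<epsilon>/2 * \<rho> ^ nat \<bar>n\<bar>"
    "sup_L1_le (\<epsilon>/2) (\<epsilon>/2) (translate_sum q \<psi>)"
    using e unfolding annihilable_def by (meson half_gt_zero)
  show "\<exists>q. finite {n. q n \<noteq> 0} \<and> (\<forall>n. cmod (c n - q n) \<le> \<epsilon> * \<rho> ^ nat \<bar>n\<bar>) \<and>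
     sup_L1_le \<epsilon> \<epsilon> (translate_sum q \<psi>)"
  proof (intro exI[of _ q] conjI allI q(1))
    show "sup_L1_le \<epsilon> \<epsilon> (translate_sum q \<psi>)" by (rule sup_L1_le_mono[OF q(3)]) (use e in auto)
    show "cmod (c n - q n) \<le> \<epsilon> * \<rho> ^ nat \<bar>n\<bar>" for n
      using norm_triangle_ineq[of "c n - c' n" "c' n - q n"] c'(2)[of n] q(2)[of n]
      by (simp add: field_simps)
  qed
qed

lemma annihilable_zero: "\<rho> \<ge> 0 \<Longrightarrow> annihilable \<rho> \<psi> (\<lambda>n. 0)"
  unfolding annihilable_def
  by (intro allI impI exI[of _ "\<lambda>n. 0"]) (simp add: translate_sum_def[abs_def] sup_L1_le_zero)

lemma annihilable_add:
  assumes "annihilable \<rho> \<psi> c" "annihilable \<rho> \<psi> d"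
  shows "annihilable \<rho> \<psi> (\<lambda>n. c n + d n)"
  unfolding annihilable_def
proof (intro allI impI)
  fix \<epsilon> :: real assume e: "\<epsilon> > 0"
  obtain q where q: "finite {n. q n \<noteq> 0}" "\<And>n. cmod (c n - q n) \<le> \<epsilon>/2 * \<rho> ^ nat \<bar>n\<bar>"
    "sup_L1_le (\<epsilon>/2) (\<epsilon>/2) (translate_sum q \<psi>)"
    using e assms(1) unfolding annihilable_def by (meson half_gt_zero)
  obtain p where p: "finite {n. p n \<noteq> 0}" "\<And>n. cmod (d n - p n) \<le> \<epsilon>/2 * \<rho> ^ nat \<bar>n\<bar>"
    "sup_L1_le (\<epsilon>/2) (\<epsilon>/2) (translate_sum p \<psi>)"
    using e assms(2) unfolding annihilable_def by (meson half_gt_zero)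
  let ?A = "{n. q n \<noteq> 0} \<union> {n. p n \<noteq> 0}"
  have fin: "finite ?A" using q(1) p(1) by simp
  have sub: "{n. q n + p n \<noteq> 0} \<subseteq> ?A" by auto
  show "\<exists>q. finite {n. q n \<noteq> 0} \<and> (\<forall>n. cmod (c n + d n - q n) \<le> \<epsilon> * \<rho> ^ nat \<bar>n\<bar>) \<and>
     sup_L1_le \<epsilon> \<epsilon> (translate_sum q \<psi>)"
  proof (intro exI[of _ "\<lambda>n. q n + p n"] conjI allI)
    show "finite {n. q n + p n \<noteq> 0}" by (rule finite_subset[OF sub fin])
    show "cmod (c n + d n - (q n + p n)) \<le> \<epsilon> * \<rho> ^ nat \<bar>n\<bar>" for n
      using norm_triangle_ineq[of "c n - q n" "d n - p n"] q(2)[of n] p(2)[of n]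
      by (simp add: field_simps)
    have "translate_sum (\<lambda>n. q n + p n) \<psi> = (\<lambda>t. translate_sum q \<psi> t + translate_sum p \<psi> t)"
      by (rule ext) (simp add: translate_sum_superset[OF fin] sub distrib_right sum.distrib)
    then show "sup_L1_le \<epsilon> \<epsilon> (translate_sum (\<lambda>n. q n + p n) \<psi>)"
      using sup_L1_le_add[OF q(3) p(3)] by simp
  qed
qed

lemma annihilable_cmult:
  assumes "annihilable \<rho> \<psi> c"
  shows "annihilable \<rho> \<psi> (\<lambda>n. a * c n)"
  unfolding annihilable_def
proof (intro allI impI)
  fix \<epsilon> :: real assume e: "\<epsilon> > 0"
  define \<delta> where "\<delta> = \<epsilon> / (cmod a + 1)"
  have d: "\<delta> > 0" "cmod a * \<delta> \<le> \<epsilon>"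
    using e by (auto simp: \<delta>_def field_simps add_pos_nonneg add_nonneg_pos)
  obtain q where q: "finite {n. q n \<noteq> 0}" "\<And>n. cmod (c n - q n) \<le> \<delta> * \<rho> ^ nat \<bar>n\<bar>"
    "sup_L1_le \<delta> \<delta> (translate_sum q \<psi>)"
    using d(1) assms unfolding annihilable_def by meson
  have sub: "{n. a * q n \<noteq> 0} \<subseteq> {n. q n \<noteq> 0}" by auto
  show "\<exists>q. finite {n. q n \<noteq> 0} \<and> (\<forall>n. cmod (a * c n - q n) \<le> \<epsilon> * \<rho> ^ nat \<bar>n\<bar>) \<and>
     sup_L1_le \<epsilon> \<epsilon> (translate_sum q \<psi>)"
  proof (intro exI[of _ "\<lambda>n. a * q n"] conjI allI)
    show "finite {n. a * q n \<noteq> 0}" by (rule finite_subset[OF sub q(1)])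
    show "cmod (a * c n - a * q n) \<le> \<epsilon> * \<rho> ^ nat \<bar>n\<bar>" for n
    proof -
      \<comment> \<open>The sign of the weight is read off from the approximation bound, whose left
        side is nonnegative.\<close>
      have r: "0 \<le> \<rho> ^ nat \<bar>n\<bar>"
        using q(2)[of n] norm_ge_zero[of "c n - q n"] d(1) by (meson order_trans zero_le_mult_iff not_le)
      have "cmod (a * c n - a * q n) = cmod a * cmod (c n - q n)"
        by (simp flip: right_diff_distrib norm_mult)
      also have "\<dots> \<le> cmod a * (\<delta> * \<rho> ^ nat \<bar>n\<bar>)" by (intro mult_left_mono q(2)) auto
      also have "\<dots> \<le> \<epsilon> * \<rho> ^ nat \<bar>n\<bar>"
        using mult_right_mono[OF d(2) r] by (simp add: mult.assoc)
      finally show ?thesis .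
    qed
    have "translate_sum (\<lambda>n. a * q n) \<psi> = (\<lambda>t. a * translate_sum q \<psi> t)"
      by (rule ext, subst translate_sum_superset[OF q(1) sub])
         (simp add: translate_sum_def sum_distrib_left mult.assoc)
    then show "sup_L1_le \<epsilon> \<epsilon> (translate_sum (\<lambda>n. a * q n) \<psi>)"
      using sup_L1_le_mono[OF sup_L1_le_cmult[OF q(3), of a] d(2) d(2)] by simp
  qed
qed

lemma annihilable_sum:
  assumes "\<rho> \<ge> 0" "\<And>i. i \<in> I \<Longrightarrow> annihilable \<rho> \<psi> (c i)"
  shows "annihilable \<rho> \<psi> (\<lambda>n. \<Sum>i\<in>I. c i n)"
  using assms(2)
  by (induction I rule: infinite_finite_induct) (simp_all add: annihilable_zero annihilable_add assms(1))

section \<open>Powers of the index are annihilable\<close>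

lemma power_le_exponential:
  assumes "\<rho> > (1::real)"
  obtains C where "C > 0" "\<And>n::int. \<bar>real_of_int n\<bar> ^ m \<le> C * \<rho> ^ nat \<bar>n\<bar>"
proof
  have l: "ln \<rho> > 0" using assms by simp
  show "fact m / ln \<rho> ^ m > 0" using l by simp
  fix n :: int
  have "(ln \<rho> * \<bar>real_of_int n\<bar>) ^ m \<le> fact m * exp (ln \<rho> * \<bar>real_of_int n\<bar>)"
    using l by (intro power_le_fact_mult_exp) auto
  also have "exp (ln \<rho> * \<bar>real_of_int n\<bar>) = \<rho> ^ nat \<bar>n\<bar>"
    using assms exp_of_nat_mult[of "nat \<bar>n\<bar>" "ln \<rho>"] by (simp add: mult.commute)
  finally show "\<bar>real_of_int n\<bar> ^ m \<le> fact m / ln \<rho> ^ m * \<rho> ^ nat \<bar>n\<bar>"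
    using l by (simp add: power_mult_distrib field_simps)
qed

lemma int_diff_funpow_sample:
  assumes "real N > 0"
  shows "(int_diff ^^ i) (\<lambda>n. a * f (of_int n / real N)) n = a * (back_diff (1 / real N) ^^ i) f (of_int n / real N)"
proof (induction i arbitrary: n)
  case (Suc i)
  have "of_int (n - 1) / real N = of_int n / real N - 1 / real N" by (simp add: diff_divide_distrib)
  then show ?case using Suc by (simp add: int_diff_def back_diff_def right_diff_distrib)
qed simp

lemma l1_le_inverse_square:
  assumes q: "\<And>n. cmod (q n) \<le> K / (1 + (real_of_int n)\<^sup>2)" and "K \<ge> 0"
  shows "l1_le q (K * int_square_sum)"
  unfolding l1_le_def
proof (intro allI impI)
  fix A :: "int set" assume "finite A"
  have "(\<Sum>n\<in>A. cmod (q n)) \<le> (\<Sum>n\<in>A. K * (1 / (1 + (real_of_int n)\<^sup>2)))"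
    using q by (intro sum_mono) simp
  also have "\<dots> \<le> K * int_square_sum"
    unfolding sum_distrib_left[symmetric]
    by (intro mult_left_mono sum_int_inverse_square_le \<open>finite A\<close> assms(2))
  finally show "(\<Sum>n\<in>A. cmod (q n)) \<le> K * int_square_sum" .
qed

lemma one_plus_square_scale:
  assumes "x \<ge> (1::real)"
  shows "1 / (1 + (y/x)\<^sup>2) \<le> x\<^sup>2 / (1 + y\<^sup>2)"
proof -
  have x: "x\<^sup>2 \<ge> 1" using assms by simp
  have "1 + (y/x)\<^sup>2 = (x\<^sup>2 + y\<^sup>2) / x\<^sup>2" using assms by (simp add: power_divide field_simps)
  then have "1 / (1 + (y/x)\<^sup>2) = x\<^sup>2 / (x\<^sup>2 + y\<^sup>2)" by simp
  also have "\<dots> \<le> x\<^sup>2 / (1 + y\<^sup>2)"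
  proof (rule divide_left_mono)
    show "0 < (x\<^sup>2 + y\<^sup>2) * (1 + y\<^sup>2)"
      using x by (intro mult_pos_pos add_pos_nonneg) auto
  qed (use x in auto)
  finally show ?thesis .
qed

text \<open>Each difference of the samples at \<open>n / N\<close> gains \<open>1 / N\<close>. The
  prefactor costs \<open>N ^ D\<close>, and passing from decay in \<open>n / N\<close> to decay in
  \<open>n\<close> costs \<open>N ^ 2\<close>; with \<open>D + 3\<close> differences
  \<open>1 / N\<close> remains. The condition on \<open>N\<close> keeps the points reached by the
  differences within distance 1.\<close>

lemma l1_le_int_diff_gauss:
  "\<exists>K\<ge>0. \<forall>N. N \<ge> D + 3 \<longrightarrow> l1_le ((int_diff ^^ (D + 3)) (\<lambda>n. of_nat N ^ D * gauss_poly P (of_int n / real N))) (K / real N)"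
proof -
  define i where "i = D + 3"
  define F where "F j = gauss_poly ((gauss_pderiv ^^ j) P)" for j
  have F: "(F j has_vector_derivative F (Suc j) y) (at y)" for j y
    using gauss_poly_has_vector_derivative by (simp add: F_def)
  obtain C where C: "\<And>y. cmod (F i y) \<le> C / (1 + y\<^sup>2)" using gauss_poly_decay unfolding F_def by blast
  have C0: "C \<ge> 0" using C[of 0] norm_ge_zero[of "F i 0"] by (simp del: norm_ge_zero)
  show ?thesis
  proof (intro exI[of _ "4 * C * int_square_sum"] conjI allI impI)
    show "0 \<le> 4 * C * int_square_sum" using C0 int_square_sum_nonneg by simp
    fix N assume N: "N \<ge> D + 3"
    then have N1: "real N \<ge> 1" by simp
    let ?q = "(int_diff ^^ i) (\<lambda>n. of_nat N ^ D * gauss_poly P (of_int n / real N))"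
    have "l1_le ?q (4 * C / real N * int_square_sum)"
    proof (rule l1_le_inverse_square)
      fix n :: int
      let ?x = "of_int n / real N"
      have "cmod ((back_diff (1 / real N) ^^ i) (F 0) ?x) \<le> (1 / real N) ^ i * (C * (4 * (1 / (1 + ?x\<^sup>2))))"
      proof (rule back_diff_funpow_bound[where F = F, OF F])
        fix y assume "y \<in> {?x - real i * (1 / real N)..?x}"
        moreover have "real i * (1 / real N) \<le> 1" using N N1 by (simp add: i_def field_simps)
        ultimately have "\<bar>?x - y\<bar> \<le> 1" by (simp add: abs_le_iff)
        from one_plus_square_le[OF this] have "1 / (1 + y\<^sup>2) \<le> 4 * (1 / (1 + ?x\<^sup>2))" by simp
        then have "C * (1 / (1 + y\<^sup>2)) \<le> C * (4 * (1 / (1 + ?x\<^sup>2)))" using C0 by (rule mult_left_mono)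
        then show "cmod (F i y) \<le> C * (4 * (1 / (1 + ?x\<^sup>2)))" using C[of y] by simp
      qed simp
      also have "\<dots> \<le> (1 / real N) ^ i * (C * (4 * ((real N)\<^sup>2 / (1 + (real_of_int n)\<^sup>2))))"
        using C0 N1 by (intro mult_left_mono one_plus_square_scale) auto
      finally have *: "cmod ((back_diff (1 / real N) ^^ i) (F 0) ?x)
          \<le> (1 / real N) ^ i * (C * (4 * ((real N)\<^sup>2 / (1 + (real_of_int n)\<^sup>2))))" .
      have "cmod (?q n) = real N ^ D * cmod ((back_diff (1 / real N) ^^ i) (F 0) ?x)"
        using N1 by (subst int_diff_funpow_sample) (simp_all add: F_def norm_mult norm_power)
      also have "\<dots> \<le> real N ^ D * ((1 / real N) ^ i * (C * (4 * ((real N)\<^sup>2 / (1 + (real_of_int n)\<^sup>2)))))"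
        using * by (rule mult_left_mono) simp
      also have "\<dots> = (real N ^ D * real N ^ 2 * (1 / real N) ^ i) * (4 * C / (1 + (real_of_int n)\<^sup>2))"
        by simp
      also have "real N ^ D * real N ^ 2 * (1 / real N) ^ i = 1 / real N"
        using N1 by (simp add: i_def power_add power_one_over power2_eq_square power3_eq_cube)
      finally show "cmod (?q n) \<le> 4 * C / real N / (1 + (real_of_int n)\<^sup>2)" by simp
    qed (use C0 in \<open>auto intro!: divide_nonneg_nonneg\<close>)
    then show "l1_le ((int_diff ^^ (D + 3)) (\<lambda>n. of_nat N ^ D * gauss_poly P (of_int n / real N))) (4 * C * int_square_sum / real N)"
      by (simp add: i_def)
  qed
qed

text \<open>In the tail \<open>1 \<le> \<bar>n\<bar> / L\<close>, and the additional power of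
  \<open>n\<close> is absorbed by passing from \<open>P\<close> to \<open>monom 1 1 * P\<close>. The
  constant depends on \<open>N\<close>, which is harmless because \<open>L\<close> is chosen after
  \<open>N\<close>.\<close>

lemma l1_le_gauss_tail:
  assumes N: "N \<ge> 1"
  shows "\<exists>K\<ge>0. \<forall>L\<ge>1. l1_le (\<lambda>n. if \<bar>n\<bar> \<le> int L then 0 else of_nat N ^ D * gauss_poly P (of_int n / real N)) (K / real L)"
proof -
  obtain C where C: "\<And>t. cmod (gauss_poly (monom 1 1 * P) t) \<le> C / (1 + t\<^sup>2)"
    using gauss_poly_decay by blast
  have C0: "C \<ge> 0" using C[of 0] norm_ge_zero[of "gauss_poly (monom 1 1 * P) 0"] by (simp del: norm_ge_zero)
  define K where "K = real N ^ D * (real N * (C * (real N)\<^sup>2))"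
  have K0: "K \<ge> 0" using C0 by (simp add: K_def)
  show ?thesis
  proof (intro exI[of _ "K * int_square_sum"] conjI allI impI)
    show "0 \<le> K * int_square_sum" using K0 int_square_sum_nonneg by simp
    fix L :: nat assume L: "L \<ge> 1"
    have "l1_le (\<lambda>n. if \<bar>n\<bar> \<le> int L then 0 else of_nat N ^ D * gauss_poly P (of_int n / real N)) (K / real L * int_square_sum)"
    proof (rule l1_le_inverse_square)
      fix n :: int
      let ?x = "of_int n / real N"
      show "cmod (if \<bar>n\<bar> \<le> int L then 0 else of_nat N ^ D * gauss_poly P ?x) \<le> K / real L / (1 + (real_of_int n)\<^sup>2)"
      proof (cases "\<bar>n\<bar> \<le> int L")
        case False
        have Lp: "0 < real L" using L by simp
        have nL: "real L \<le> \<bar>real_of_int n\<bar>" using False by linarith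
        have "\<bar>?x\<bar> * cmod (gauss_poly P ?x) = cmod (gauss_poly (monom 1 1 * P) ?x)"
          by (simp add: gauss_poly_def norm_mult poly_monom norm_divide)
        also have "\<dots> \<le> C * (1 / (1 + ?x\<^sup>2))" using C[of ?x] by simp
        also have "\<dots> \<le> C * ((real N)\<^sup>2 / (1 + (real_of_int n)\<^sup>2))"
          using N C0 by (intro mult_left_mono one_plus_square_scale) auto
        finally have "\<bar>real_of_int n\<bar> * cmod (gauss_poly P ?x) \<le> real N * (C * ((real N)\<^sup>2 / (1 + (real_of_int n)\<^sup>2)))"
          using N by (simp add: field_simps)
        moreover have "real L * cmod (gauss_poly P ?x) \<le> \<bar>real_of_int n\<bar> * cmod (gauss_poly P ?x)"
          using nL by (rule mult_right_mono) simp
        ultimately have "real L * cmod (gauss_poly P ?x) \<le> real N * (C * ((real N)\<^sup>2 / (1 + (real_of_int n)\<^sup>2)))"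
          by linarith
        then have "cmod (gauss_poly P ?x) \<le> real N * (C * ((real N)\<^sup>2 / (1 + (real_of_int n)\<^sup>2))) / real L"
          unfolding pos_le_divide_eq[OF Lp] mult.commute[of _ "real L"] .
        then have "real N ^ D * cmod (gauss_poly P ?x)
            \<le> real N ^ D * (real N * (C * ((real N)\<^sup>2 / (1 + (real_of_int n)\<^sup>2))) / real L)"
          by (rule mult_left_mono) simp
        then show ?thesis using False by (simp add: norm_mult norm_power K_def mult_ac)
      qed (use K0 in \<open>auto intro!: divide_nonneg_nonneg\<close>)
    qed (use K0 in \<open>auto intro!: divide_nonneg_nonneg\<close>)
    then show "l1_le (\<lambda>n. if \<bar>n\<bar> \<le> int L then 0 else of_nat N ^ D * gauss_poly P (of_int n / real N)) (K * int_square_sum / real L)"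
      by simp
  qed
qed

lemma int_diff_diff: "int_diff (\<lambda>n. p n - q n) = (\<lambda>n. int_diff p n - int_diff q n)"
  by (rule ext) (simp add: int_diff_def)

lemma int_diff_funpow_diff:
  "(int_diff ^^ i) (\<lambda>n. p n - q n) = (\<lambda>n. (int_diff ^^ i) p n - (int_diff ^^ i) q n)"
  by (induction i) (simp_all add: int_diff_diff)

text \<open>The power is damped by a Gaussian of width \<open>N\<close>, which makes its differences
  of order \<open>D + 3\<close> small in \<open>l1\<close>, and is then truncated at
  \<open>L\<close>, which makes the support finite.\<close>

lemma annihilable_power:
  assumes \<rho>: "\<rho> > 1" and \<psi>: "\<psi> = (fun_diff ^^ (D + 3)) g" and g: "sup_L1_le A B g"
  shows "annihilable \<rho> \<psi> (\<lambda>n. of_int n ^ D)"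
  unfolding annihilable_def
proof (intro allI impI)
  fix \<epsilon> :: real assume e: "\<epsilon> > 0"
  define M where "M = max A B"
  have M: "M \<ge> 0" "A \<le> M" "B \<le> M" using sup_L1_leD(5)[OF g] by (auto simp: M_def)
  have gM: "sup_L1_le M M g" by (rule sup_L1_le_mono[OF g M(2,3)])
  obtain C1 where C1: "C1 > 0" "\<And>n::int. \<bar>real_of_int n\<bar> ^ (D + 2) \<le> C1 * \<rho> ^ nat \<bar>n\<bar>"
    using power_le_exponential[OF \<rho>] by metis
  obtain C2 where C2: "C2 > 0" "\<And>n::int. \<bar>real_of_int n\<bar> ^ (D + 1) \<le> C2 * \<rho> ^ nat \<bar>n\<bar>"
    using power_le_exponential[OF \<rho>] by metis
  define P :: "complex poly" where "P = monom 1 D"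
  obtain K1 where K1: "K1 \<ge> 0" "\<And>N. N \<ge> D + 3 \<Longrightarrow>
      l1_le ((int_diff ^^ (D + 3)) (\<lambda>n. of_nat N ^ D * gauss_poly P (of_int n / real N))) (K1 / real N)"
    using l1_le_int_diff_gauss by meson
  obtain N :: nat where N: "N \<ge> D + 3" "real N > C1 / \<epsilon>" "real N > 2 * K1 * M / \<epsilon>"
    using reals_Archimedean2[of "max (real (D + 3)) (max (C1 / \<epsilon>) (2 * K1 * M / \<epsilon>))"]
    by (metis less_imp_le max_less_iff_conj of_nat_le_iff)
  have N1: "N \<ge> 1" "real N \<ge> 1" using N(1) by auto
  define q where "q n = of_nat N ^ D * gauss_poly P (of_int n / real N)" for n :: int
  have qn: "q n = of_real (real_of_int n ^ D * exp (- ((of_int n / real N)\<^sup>2)))" for n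
    using N1 by (simp add: q_def gauss_poly_def P_def poly_monom power_divide)
  obtain K2 where K2: "K2 \<ge> 0" "\<And>L. L \<ge> 1 \<Longrightarrow> l1_le (\<lambda>n. if \<bar>n\<bar> \<le> int L then 0 else q n) (K2 / real L)"
    using l1_le_gauss_tail[OF N1(1)] unfolding q_def by meson
  obtain L :: nat where L: "L \<ge> 1" "real L > C2 / \<epsilon>" "real L > 2 ^ (D + 3) * K2 * 2 * M / \<epsilon>"
    using reals_Archimedean2[of "max (real 1) (max (C2 / \<epsilon>) (2 ^ (D + 3) * K2 * 2 * M / \<epsilon>))"]
    by (metis less_imp_le max_less_iff_conj of_nat_le_iff)
  have L1: "real L > 0" using L(1) by simp
  define qL where "qL n = (if \<bar>n\<bar> \<le> int L then q n else 0)" for n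
  have fin: "finite {n. qL n \<noteq> 0}"
    by (rule finite_subset[of _ "{- int L..int L}"]) (auto simp: qL_def split: if_splits)
  \<comment> \<open>The truncated tail is not smooth, so its differences are merely bounded by
    \<open>2 ^ (D + 3)\<close> times its \<open>l1\<close> norm; here the smallness comes from
    \<open>L\<close>.\<close>
  have "l1_le ((int_diff ^^ (D + 3)) (\<lambda>n. q n - (if \<bar>n\<bar> \<le> int L then 0 else q n)))
      (K1 / real N + 2 ^ (D + 3) * (K2 / real L))"
    unfolding int_diff_funpow_diff
    using l1_le_diff[OF K1(2)[OF N(1)] l1_le_int_diff_funpow[OF K2(2)[OF L(1)]]]
    unfolding q_def .
  moreover have "(\<lambda>n. q n - (if \<bar>n\<bar> \<le> int L then 0 else q n)) = qL"
    by (auto simp: qL_def)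
  ultimately have "l1_le ((int_diff ^^ (D + 3)) qL) (K1 / real N + 2 ^ (D + 3) * (K2 / real L))"
    by simp
  then have "sup_L1_le ((K1 / real N + 2 ^ (D + 3) * (K2 / real L)) * M) ((K1 / real N + 2 ^ (D + 3) * (K2 / real L)) * M)
     (translate_sum ((int_diff ^^ (D + 3)) qL) g)"
    by (intro sup_L1_le_translate_sum finite_support_int_diff_funpow fin gM)
  moreover have "(K1 / real N + 2 ^ (D + 3) * (K2 / real L)) * M \<le> \<epsilon>"
  proof -
    have "K1 * M / real N \<le> \<epsilon> / 2" using N(3) N1(2) e by (simp add: field_simps)
    moreover have "2 ^ (D + 3) * K2 * M / real L \<le> \<epsilon> / 2" using L(3) L1 e by (simp add: field_simps)
    ultimately have "K1 * M / real N + 2 ^ (D + 3) * K2 * M / real L \<le> \<epsilon>" by linarith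
    then show ?thesis by (simp add: distrib_right)
  qed
  ultimately have small: "sup_L1_le \<epsilon> \<epsilon> (translate_sum qL \<psi>)"
    unfolding \<psi> translate_sum_fun_diff_funpow[OF fin] by (elim sup_L1_le_mono)
  show "\<exists>q. finite {n. q n \<noteq> 0} \<and> (\<forall>n. cmod (of_int n ^ D - q n) \<le> \<epsilon> * \<rho> ^ nat \<bar>n\<bar>) \<and>
     sup_L1_le \<epsilon> \<epsilon> (translate_sum q \<psi>)"
  proof (intro exI[of _ qL] conjI allI fin small)
    fix n :: int
    have r0: "0 \<le> \<rho> ^ nat \<bar>n\<bar>" using \<rho> by simp
    show "cmod (of_int n ^ D - qL n) \<le> \<epsilon> * \<rho> ^ nat \<bar>n\<bar>"
    proof (cases "\<bar>n\<bar> \<le> int L")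
      case True
      let ?y = "(of_int n / real N)\<^sup>2"
      have "of_int n ^ D - qL n = of_real (real_of_int n ^ D * (1 - exp (- ?y)))"
        using True by (simp add: qL_def qn right_diff_distrib)
      then have "cmod (of_int n ^ D - qL n) = \<bar>real_of_int n\<bar> ^ D * \<bar>1 - exp (- ?y)\<bar>"
        by (simp only: norm_of_real abs_mult power_abs)
      \<comment> \<open>Two more powers of \<open>n\<close> are handed to the exponential weight,
        and in exchange \<open>N\<close> enters the denominator.\<close>
      also have "\<bar>1 - exp (- ?y)\<bar> \<le> ?y" using exp_ge_add_one_self[of "- ?y"] by (simp add: abs_if)
      also have "\<bar>real_of_int n\<bar> ^ D * ?y = \<bar>real_of_int n\<bar> ^ (D + 2) / (real N)\<^sup>2"
        by (simp add: power_add power_divide power2_eq_square)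
      also have "\<dots> \<le> (C1 * \<rho> ^ nat \<bar>n\<bar>) / (real N)\<^sup>2" by (intro divide_right_mono C1(2)) simp
      also have "\<dots> \<le> (C1 * \<rho> ^ nat \<bar>n\<bar>) / real N"
        using N1(2) C1(1) r0 by (intro divide_left_mono) (auto simp: power2_eq_square)
      also have "\<dots> = (C1 / real N) * \<rho> ^ nat \<bar>n\<bar>" by simp
      also have "\<dots> \<le> \<epsilon> * \<rho> ^ nat \<bar>n\<bar>"
        using N(2) N1(2) e r0 by (intro mult_right_mono) (auto simp: field_simps)
      finally show ?thesis by (simp add: mult_left_mono)
    next
      case False
      have nL: "real L \<le> \<bar>real_of_int n\<bar>" using False by linarith
      have "cmod (of_int n ^ D - qL n) = \<bar>real_of_int n\<bar> ^ D"
        using False by (simp add: qL_def norm_power)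
      also have "\<dots> \<le> \<bar>real_of_int n\<bar> ^ (D + 1) / real L"
        using L1 mult_right_mono[OF nL, of "\<bar>real_of_int n\<bar> ^ D"] by (simp add: field_simps)
      also have "\<dots> \<le> (C2 * \<rho> ^ nat \<bar>n\<bar>) / real L" by (intro divide_right_mono C2(2)) simp
      also have "\<dots> = (C2 / real L) * \<rho> ^ nat \<bar>n\<bar>" by simp
      also have "\<dots> \<le> \<epsilon> * \<rho> ^ nat \<bar>n\<bar>"
        using L(2) L1 e r0 by (intro mult_right_mono) (auto simp: field_simps)
      finally show ?thesis .
    qed
  qed
qed

text \<open>The Taylor terms of \<open>exp (\<i> * s * n)\<close> are powers of \<open>n\<close>,
  which is why all \<open>j\<close> are carried along. The expansion converges in the weighted norm
  because \<open>s\<close> is small against \<open>ln \<rho>\<close>.\<close>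

lemma annihilable_exp_step:
  assumes \<rho>: "\<rho> > 1" and s: "\<bar>s\<bar> \<le> ln \<rho> / 8"
    and c: "\<And>j. annihilable \<rho> \<psi> (\<lambda>n. of_int n ^ j * exp (\<i> * of_real x * of_int n))"
  shows "annihilable \<rho> \<psi> (\<lambda>n. of_int n ^ j * exp (\<i> * of_real (x + s) * of_int n))"
proof (rule annihilable_limit)
  fix \<epsilon> :: real assume e: "\<epsilon> > 0"
  have sq: "sqrt \<rho> > 1" using \<rho> by simp
  obtain C where C: "C > 0" "\<And>n::int. \<bar>real_of_int n\<bar> ^ (j + 1) \<le> C * sqrt \<rho> ^ nat \<bar>n\<bar>"
    using power_le_exponential[OF sq] by metis
  have "(\<lambda>M. (1/2::real) ^ M) \<longlonglongrightarrow> 0" by (rule LIMSEQ_power_zero) simp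
  then have "(\<lambda>M. \<bar>s\<bar> * C * (1/2) ^ M) \<longlonglongrightarrow> 0" by (rule tendsto_mult_right_zero)
  then have "eventually (\<lambda>M. \<bar>s\<bar> * C * (1/2) ^ M < \<epsilon>) sequentially"
    using e by (rule order_tendstoD)
  then obtain M where M: "\<bar>s\<bar> * C * (1/2) ^ M < \<epsilon>"
    by (auto simp: eventually_sequentially)
  define c' where "c' n = (\<Sum>m\<le>M. ((\<i> * of_real s) ^ m / fact m) *
      (of_int n ^ (j + m) * exp (\<i> * of_real x * of_int n)))" for n :: int
  have "annihilable \<rho> \<psi> c'"
    unfolding c'_def[abs_def] using \<rho> by (intro annihilable_sum annihilable_cmult c) auto
  moreover have "cmod (of_int n ^ j * exp (\<i> * of_real (x + s) * of_int n) - c' n) \<le> \<epsilon> * \<rho> ^ nat \<bar>n\<bar>" for n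
  proof -
    define z where "z = \<i> * of_real s * of_int n"
    define y where "y = \<bar>s\<bar> * \<bar>real_of_int n\<bar>"
    have y: "cmod z = y" by (simp add: z_def y_def norm_mult)
    have y0: "y \<ge> 0" by (simp add: y_def)
    have "c' n = of_int n ^ j * exp (\<i> * of_real x * of_int n) * (\<Sum>m\<le>M. z ^ m / fact m)"
      unfolding c'_def sum_distrib_left z_def
      by (intro sum.cong refl) (simp add: power_add power_mult_distrib)
    moreover have "exp (\<i> * of_real (x + s) * of_int n) = exp (\<i> * of_real x * of_int n) * exp z"
      by (simp add: z_def exp_add[symmetric] algebra_simps)
    ultimately have "of_int n ^ j * exp (\<i> * of_real (x + s) * of_int n) - c' n
        = of_int n ^ j * exp (\<i> * of_real x * of_int n) * (exp z - (\<Sum>m\<le>M. z ^ m / fact m))"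
      by (simp add: algebra_simps)
    then have "cmod (of_int n ^ j * exp (\<i> * of_real (x + s) * of_int n) - c' n)
        = \<bar>real_of_int n\<bar> ^ j * cmod (exp z - (\<Sum>m\<le>M. z ^ m / fact m))"
      by (simp add: norm_mult norm_power)
    also have "\<dots> \<le> \<bar>real_of_int n\<bar> ^ j * (exp \<bar>Re z\<bar> * cmod z ^ Suc M / fact M)"
      by (intro mult_left_mono Taylor_exp) auto
    also have "exp \<bar>Re z\<bar> = 1" by (simp add: z_def)
    \<comment> \<open>A factor \<open>(1/2) ^ M\<close> is gained at the price of
      \<open>exp (2 * y)\<close>. The bound on \<open>s\<close> keeps this below
      \<open>sqrt \<rho> ^ nat \<bar>n\<bar>\<close>; the other square root of the weight is left
      for the powers of \<open>n\<close>.\<close>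
    also have "1 * cmod z ^ Suc M / fact M \<le> y * (exp (2 * y) * (1/2) ^ M)"
    proof -
      have "(2 * y) ^ M \<le> fact M * exp (2 * y)" using y0 by (intro power_le_fact_mult_exp) auto
      then have "y ^ M / fact M \<le> exp (2 * y) * (1/2) ^ M"
        by (simp add: power_mult_distrib power_one_over field_simps)
      from mult_left_mono[OF this y0] show ?thesis by (simp add: y)
    qed
    also have "exp (2 * y) \<le> sqrt \<rho> ^ nat \<bar>n\<bar>"
    proof -
      have "2 * y \<le> (ln \<rho> / 2) * \<bar>real_of_int n\<bar>"
        using mult_right_mono[of "2 * \<bar>s\<bar>" "ln \<rho> / 2" "\<bar>real_of_int n\<bar>"] s \<rho> by (simp add: y_def)
      then have "exp (2 * y) \<le> exp (real (nat \<bar>n\<bar>) * (ln \<rho> / 2))" by (simp add: mult.commute)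
      also have "\<dots> = exp (ln (sqrt \<rho>)) ^ nat \<bar>n\<bar>"
        using \<rho> exp_of_nat_mult[of "nat \<bar>n\<bar>" "ln \<rho> / 2"] by (simp add: ln_sqrt)
      finally show ?thesis using \<rho> by simp
    qed
    also have "\<bar>real_of_int n\<bar> ^ j * (y * (sqrt \<rho> ^ nat \<bar>n\<bar> * (1/2) ^ M))
        = \<bar>s\<bar> * (1/2) ^ M * (\<bar>real_of_int n\<bar> ^ (j + 1) * sqrt \<rho> ^ nat \<bar>n\<bar>)"
      by (simp add: y_def)
    also have "\<dots> \<le> \<bar>s\<bar> * (1/2) ^ M * ((C * sqrt \<rho> ^ nat \<bar>n\<bar>) * sqrt \<rho> ^ nat \<bar>n\<bar>)"
      using \<rho> by (intro mult_left_mono mult_right_mono C(2)) auto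
    also have "\<dots> = (\<bar>s\<bar> * C * (1/2) ^ M) * (sqrt \<rho> * sqrt \<rho>) ^ nat \<bar>n\<bar>"
      by (simp only: power_mult_distrib mult_ac)
    also have "\<dots> \<le> \<epsilon> * \<rho> ^ nat \<bar>n\<bar>"
      using M \<rho> by (simp add: mult_right_mono)
    finally show ?thesis using y0 \<rho> by (simp add: mult_left_mono mult_right_mono)
  qed
  ultimately show "\<exists>c'. annihilable \<rho> \<psi> c' \<and>
     (\<forall>n. cmod (of_int n ^ j * exp (\<i> * of_real (x + s) * of_int n) - c' n) \<le> \<epsilon> * \<rho> ^ nat \<bar>n\<bar>)"
    by blast
qed

text \<open>The admissible step depends only on \<open>\<rho>\<close>, so any \<open>x\<close> is
  reached by finitely many equal steps.\<close>

lemma annihilable_exp: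
  assumes \<rho>: "\<rho> > 1" and c: "\<And>j. annihilable \<rho> \<psi> (\<lambda>n. of_int n ^ j)"
  shows "annihilable \<rho> \<psi> (\<lambda>n. of_int n ^ j * exp (\<i> * of_real x * of_int n))"
proof -
  define s0 where "s0 = ln \<rho> / 8"
  have s0: "s0 > 0" using \<rho> by (simp add: s0_def)
  obtain k :: nat where k: "\<bar>x\<bar> / s0 < real k" using reals_Archimedean2 by blast
  have kp: "real k > 0" using k s0 by (meson abs_ge_zero divide_nonneg_pos le_less_trans)
  define s where "s = x / real k"
  have s: "\<bar>s\<bar> \<le> ln \<rho> / 8"
    using k s0 kp unfolding s0_def[symmetric] s_def by (simp add: field_simps)
  have "annihilable \<rho> \<psi> (\<lambda>n. of_int n ^ j * exp (\<i> * of_real (real m * s) * of_int n))" for m j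
  proof (induction m arbitrary: j)
    case 0 then show ?case using c by simp
  next
    case (Suc m)
    have "annihilable \<rho> \<psi> (\<lambda>n. of_int n ^ j * exp (\<i> * of_real (real m * s + s) * of_int n))"
      by (rule annihilable_exp_step[OF \<rho> s Suc])
    moreover have "real m * s + s = real (Suc m) * s" by (simp add: algebra_simps)
    ultimately show ?case by simp
  qed
  from this[of j k] show ?thesis using kp by (simp add: s_def)
qed

lemma sum_roots_of_unity:
  assumes "M > 0"
  shows "(\<Sum>k<M. exp (\<i> * of_real (2 * pi * real k / real M) * of_int n)) = (if int M dvd n then of_nat M else 0)"
proof -
  define w where "w = exp (\<i> * of_real (2 * pi * of_int n / real M))"
  have "exp (\<i> * of_real (2 * pi * real k / real M) * of_int n) = w ^ k" for k
    by (simp add: w_def exp_of_nat_mult[symmetric] algebra_simps)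
  then have s: "(\<Sum>k<M. exp (\<i> * of_real (2 * pi * real k / real M) * of_int n)) = (\<Sum>k<M. w ^ k)" by simp
  have "w ^ M = exp (\<i> * of_real (2 * pi * of_int n))"
    using assms by (simp add: w_def exp_of_nat_mult[symmetric])
  also have "\<dots> = 1" unfolding exp_eq_1 by (auto intro: exI[of _ n])
  finally have wM: "w ^ M = 1" .
  have "w = 1 \<longleftrightarrow> int M dvd n"
  proof
    assume "w = 1"
    then obtain k :: int where "2 * pi * of_int n / real M = of_int (2 * k) * pi"
      unfolding w_def exp_eq_1 by auto
    then have "real_of_int n = real_of_int (int M * k)" using assms by (simp add: field_simps)
    then have "n = int M * k" by (simp only: of_int_eq_iff)
    then show "int M dvd n" by simp
  next
    assume "int M dvd n"
    then obtain k where "n = int M * k" by blast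
    then show "w = 1" using assms unfolding w_def exp_eq_1 by (auto intro!: exI[of _ k])
  qed
  then show ?thesis unfolding s sum_gp_strict using wM by simp
qed

text \<open>Polynomials are dense in the weighted sequence space: by Taylor expansion their closure contains
  the functions \<open>exp (i x n)\<close> for small \<open>x\<close>, hence for all \<open>x\<close>, and averaging over the
  \<open>M\<close>-th roots of unity leaves only the multiples of \<open>M\<close>.\<close>

lemma annihilable_delta:
  assumes \<rho>: "\<rho> > 1" and \<psi>: "\<And>i. \<exists>g A B. \<psi> = (fun_diff ^^ i) g \<and> sup_L1_le A B g"
  shows "annihilable \<rho> \<psi> (\<lambda>n. if n = 0 then 1 else 0)"
proof (rule annihilable_limit)
  fix \<epsilon> :: real assume e: "\<epsilon> > 0"
  have p: "annihilable \<rho> \<psi> (\<lambda>n. of_int n ^ j)" for j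
    using \<psi>[of "j + 3"] annihilable_power[OF \<rho>] by blast
  have "(\<lambda>M. (1/\<rho>) ^ M) \<longlonglongrightarrow> 0" using \<rho> by (intro LIMSEQ_power_zero) simp
  then have "eventually (\<lambda>M. (1/\<rho>) ^ M < \<epsilon>) sequentially" using e by (rule order_tendstoD)
  then have "eventually (\<lambda>M. (1/\<rho>) ^ M < \<epsilon> \<and> M \<ge> 1) sequentially"
    by (intro eventually_conj eventually_ge_at_top)
  then obtain M where M: "(1/\<rho>) ^ M < \<epsilon>" "M \<ge> 1"
    by (auto simp: eventually_sequentially)
  \<comment> \<open>This is the indicator of the multiples of \<open>M\<close>. It differs from the
    target only where \<open>n \<noteq> 0\<close> and \<open>\<bar>n\<bar> \<ge> M\<close>, and
    there the allowed error \<open>\<epsilon> * \<rho> ^ nat \<bar>n\<bar>\<close> is at least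
    1.\<close>
  define c' where "c' n = (1 / of_nat M) * (\<Sum>k<M. of_int n ^ 0 * exp (\<i> * of_real (2 * pi * real k / real M) * of_int n))"
    for n :: int
  have "annihilable \<rho> \<psi> c'"
    unfolding c'_def[abs_def] using \<rho> by (intro annihilable_sum annihilable_cmult annihilable_exp p) auto
  moreover have "cmod ((if n = 0 then 1 else 0) - c' n) \<le> \<epsilon> * \<rho> ^ nat \<bar>n\<bar>" for n
  proof -
    have c'n: "c' n = (if int M dvd n then 1 else 0)"
      using sum_roots_of_unity[of M n] M(2) by (simp add: c'_def)
    have pos: "0 \<le> \<epsilon> * \<rho> ^ nat \<bar>n\<bar>" using e \<rho> by simp
    show ?thesis
    proof (cases "n \<noteq> 0 \<and> int M dvd n")
      case True
      then have "int M \<le> \<bar>n\<bar>" using dvd_imp_le_int by force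
      then have "M \<le> nat \<bar>n\<bar>" by linarith
      then have "\<rho> ^ M \<le> \<rho> ^ nat \<bar>n\<bar>" using \<rho> by (intro power_increasing) auto
      moreover have "1 \<le> \<epsilon> * \<rho> ^ M"
        using M(1) \<rho> by (simp add: power_one_over field_simps)
      ultimately have "1 \<le> \<epsilon> * \<rho> ^ nat \<bar>n\<bar>" using e by (meson mult_left_mono order_trans less_imp_le)
      then show ?thesis using True by (simp add: c'n)
    qed (use pos in \<open>auto simp: c'n\<close>)
  qed
  ultimately show "\<exists>c'. annihilable \<rho> \<psi> c' \<and>
     (\<forall>n. cmod ((if n = 0 then 1 else 0) - c' n) \<le> \<epsilon> * \<rho> ^ nat \<bar>n\<bar>)" by blast
qed

section \<open>The generator\<close>

lemma conv_has_vector_derivative: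
  assumes a: "summable (\<lambda>k. \<bar>a k\<bar>)" and d: "\<And>t. (f has_vector_derivative f' t) (at t)"
    and f: "\<And>t. cmod (f t) \<le> A" and f': "\<And>t. cmod (f' t) \<le> B"
  shows "(conv a f has_vector_derivative conv a f' t) (at t)"
proof -
  have B: "B \<ge> 0" using f'[of 0] norm_ge_zero[of "f' 0"] by linarith
  have ul: "uniform_limit UNIV (\<lambda>n t. \<Sum>k<n. a k *\<^sub>R f' (t - real k)) (conv a f') sequentially"
    unfolding conv_def[abs_def]
  proof (rule Weierstrass_m_test)
    show "summable (\<lambda>k. \<bar>a k\<bar> * B)" using a by (rule summable_mult2)
    show "norm (a k *\<^sub>R f' (t - real k)) \<le> \<bar>a k\<bar> * B" for k t
      using f' by (auto intro: mult_left_mono)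
  qed
  have "\<exists>g. \<forall>x\<in>UNIV. (\<lambda>k. a k *\<^sub>R f (x - real k)) sums g x \<and>
      (g has_derivative (\<lambda>h. h *\<^sub>R conv a f' x)) (at x within UNIV)"
  proof (rule has_derivative_series[where f' = "\<lambda>k x h. h *\<^sub>R (a k *\<^sub>R f' (x - real k))" and x = 0])
    show "((\<lambda>x. a k *\<^sub>R f (x - real k)) has_derivative (\<lambda>h. h *\<^sub>R (a k *\<^sub>R f' (x - real k)))) (at x within UNIV)" for k x
    proof -
      have "((\<lambda>x. f (x - real k)) has_vector_derivative f' (x - real k)) (at x)"
        using vector_diff_chain_at[of "\<lambda>x. x - real k" 1 x f "f' (x - real k)"] d
        by (simp add: o_def has_vector_derivative_diff_const)
      then have "((\<lambda>x. a k *\<^sub>R f (x - real k)) has_vector_derivative a k *\<^sub>R f' (x - real k)) (at x)"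
        by (rule bounded_linear.has_vector_derivative[OF bounded_linear_scaleR_right])
      then show ?thesis by (simp add: has_vector_derivative_def)
    qed
    show "(\<lambda>k. a k *\<^sub>R f (0 - real k)) sums conv a f 0"
      unfolding conv_def by (rule summable_sums[OF summable_conv[where f = f, OF a f]])
    fix e :: real assume "e > 0"
    from uniform_limitD[OF ul this]
    show "\<forall>\<^sub>F n in sequentially. \<forall>x\<in>UNIV. \<forall>h.
        norm ((\<Sum>i<n. h *\<^sub>R (a i *\<^sub>R f' (x - real i))) - h *\<^sub>R conv a f' x) \<le> e * norm h"
    proof eventually_elim
      case (elim n)
      show ?case
      proof (intro ballI allI)
        fix x h :: real
        have "(\<Sum>i<n. h *\<^sub>R (a i *\<^sub>R f' (x - real i))) - h *\<^sub>R conv a f' x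
            = h *\<^sub>R ((\<Sum>k<n. a k *\<^sub>R f' (x - real k)) - conv a f' x)"
          by (simp only: scaleR_right_diff_distrib scaleR_sum_right)
        then have "norm ((\<Sum>i<n. h *\<^sub>R (a i *\<^sub>R f' (x - real i))) - h *\<^sub>R conv a f' x)
            = \<bar>h\<bar> * dist (\<Sum>k<n. a k *\<^sub>R f' (x - real k)) (conv a f' x)"
          by (simp only: dist_norm norm_scaleR)
        also have "\<dots> \<le> \<bar>h\<bar> * e" using elim by (intro mult_left_mono) (auto intro: less_imp_le)
        finally show "norm ((\<Sum>i<n. h *\<^sub>R (a i *\<^sub>R f' (x - real i))) - h *\<^sub>R conv a f' x) \<le> e * norm h"
          by (simp add: mult.commute)
      qed
    qed
  qed auto
  then obtain g where g: "\<And>x. (\<lambda>k. a k *\<^sub>R f (x - real k)) sums g x"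
      "\<And>x. (g has_derivative (\<lambda>h. h *\<^sub>R conv a f' x)) (at x)" by auto
  have "g = conv a f" unfolding conv_def[abs_def] using g(1) by (auto simp: sums_iff)
  then show ?thesis using g(2) by (simp add: has_vector_derivative_def)
qed

text \<open>\<open>seq_diff_flat_seq_power\<close> carried over to functions; the witness is, up to
  sign, the convolution of \<open>f\<close> with \<open>flat_seq 0 (2 ^ i)\<close>.\<close>

lemma conv_flat_seq_fun_diff:
  assumes f: "sup_L1_le A B f"
  shows "\<exists>g A' B'. conv (flat_seq 0 1) f = (fun_diff ^^ i) g \<and> sup_L1_le A' B' g"
proof -
  have "\<exists>s. conv (flat_seq 0 1) f = (fun_diff ^^ i) (\<lambda>t. s * conv (flat_seq 0 (2 ^ i)) f t)"
  proof (induction i)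
    case 0 then show ?case by (auto intro: exI[of _ 1])
  next
    case (Suc i)
    then obtain s where s: "conv (flat_seq 0 1) f = (fun_diff ^^ i) (\<lambda>t. s * conv (flat_seq 0 (2 ^ i)) f t)" by blast
    have "conv (flat_seq 0 (2 ^ i)) f t = - fun_diff (conv (flat_seq 0 (2 ^ Suc i)) f) t" for t
    proof -
      have "fun_diff (conv (flat_seq 0 (2 ^ Suc i)) f) t = conv (seq_diff (flat_seq 0 (2 ^ Suc i))) f t"
        by (rule conv_seq_diff[symmetric, where f = f, OF summable_abs_flat_seq sup_L1_leD(2)[OF f]])
      also have "\<dots> = - conv (flat_seq 0 (2 ^ i)) f t"
        unfolding conv_def seq_diff_flat_seq_power scaleR_minus_left
        by (rule suminf_minus[OF summable_conv[where f = f, OF summable_abs_flat_seq sup_L1_leD(2)[OF f]]])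
      finally show ?thesis by simp
    qed
    then have "(\<lambda>t. s * conv (flat_seq 0 (2 ^ i)) f t) = fun_diff (\<lambda>t. - s * conv (flat_seq 0 (2 ^ Suc i)) f t)"
      unfolding fun_eq_iff by (simp only: fun_diff_def right_diff_distrib mult_minus_left mult_minus_right minus_diff_eq) simp
    then show ?case using s by (intro exI[of _ "- s"]) (simp add: funpow_swap1)
  qed
  then show ?thesis
    using sup_L1_le_cmult[OF sup_L1_le_conv[OF summable_abs_flat_seq f]] by blast
qed

text \<open>Index 0 is \<open>\<phi>\<close>. The derivatives are written out because each is again
  the flat sequence convolved with a polynomial times the Gaussian, so that flatness and decay apply
  to all of them alike.\<close>

definition generator_deriv :: "nat \<Rightarrow> real \<Rightarrow> complex" where
  "generator_deriv j = conv (flat_seq 0 1) (gauss_poly ((gauss_pderiv ^^ j) 1))"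

lemma summable_flat_seq_power: "summable (\<lambda>k. \<bar>flat_seq s x k\<bar> * real (Suc k) ^ m)"
proof -
  obtain C where C: "\<And>k. real (Suc k) ^ (m + 2) * \<bar>flat_seq s x k\<bar> \<le> C" using flat_seq_decay by blast
  show ?thesis
  proof (rule summable_comparison_test'[where N = 0])
    have "summable (\<lambda>n. inverse (real n ^ 2))" using inverse_power_summable[of 2, where 'a = real] by simp
    then have "summable (\<lambda>k. inverse (real (Suc k) ^ 2))" by (subst summable_Suc_iff)
    then show "summable (\<lambda>k. C * inverse (real (Suc k) ^ 2))" by (rule summable_mult)
    fix k
    have p: "real (Suc k) ^ 2 > 0" by simp
    have "(\<bar>flat_seq s x k\<bar> * real (Suc k) ^ m) * real (Suc k) ^ 2 \<le> C"
      using C[of k] by (simp only: power_add mult_ac)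
    then have "\<bar>flat_seq s x k\<bar> * real (Suc k) ^ m \<le> C / real (Suc k) ^ 2"
      by (subst pos_le_divide_eq[OF p])
    then show "norm (\<bar>flat_seq s x k\<bar> * real (Suc k) ^ m) \<le> C * inverse (real (Suc k) ^ 2)"
      by (simp add: divide_inverse del: of_nat_Suc)
  qed
qed

text \<open>The inequality \<open>1 + \<bar>t\<bar> \<le> (1 + k) * (1 + \<bar>t - k\<bar>)\<close>
  splits the weight between the rapidly decreasing sequence and the Gaussian.\<close>

lemma conv_gauss_poly_power_bounded:
  "\<exists>K. \<forall>t. (1 + \<bar>t\<bar>) ^ m * cmod (conv (flat_seq s x) (gauss_poly P) t) \<le> K"
proof -
  obtain C where C: "\<And>t. exp \<bar>t\<bar> * cmod (gauss_poly P t) \<le> C" using gauss_poly_exp_bounded by blast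
  have C0: "C \<ge> 0" using C[of 0] norm_ge_zero[of "gauss_poly P 0"] by (simp del: norm_ge_zero)
  obtain A where A: "\<And>t. cmod (gauss_poly P t) \<le> A" using gauss_poly_bounded by blast
  define D where "D = fact m * exp 1 * C"
  have D: "(1 + \<bar>t\<bar>) ^ m * cmod (gauss_poly P t) \<le> D" for t
  proof -
    have "(1 + \<bar>t\<bar>) ^ m \<le> fact m * exp (1 + \<bar>t\<bar>)" by (rule power_le_fact_mult_exp) auto
    then have "(1 + \<bar>t\<bar>) ^ m * cmod (gauss_poly P t) \<le> fact m * exp (1 + \<bar>t\<bar>) * cmod (gauss_poly P t)"
      by (rule mult_right_mono) simp
    also have "\<dots> = fact m * exp 1 * (exp \<bar>t\<bar> * cmod (gauss_poly P t))" by (simp add: exp_add)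
    also have "\<dots> \<le> fact m * exp 1 * C" by (intro mult_left_mono C) auto
    finally show ?thesis by (simp add: D_def)
  qed
  note sm = summable_norm_conv[where f = "gauss_poly P", OF summable_abs_flat_seq[of s x] A]
  show ?thesis
  proof (intro exI allI)
    fix t
    have "(1 + \<bar>t\<bar>) ^ m * cmod (conv (flat_seq s x) (gauss_poly P) t)
        \<le> (1 + \<bar>t\<bar>) ^ m * (\<Sum>k. norm (flat_seq s x k *\<^sub>R gauss_poly P (t - real k)))"
      unfolding conv_def by (intro mult_left_mono summable_norm sm) auto
    also have "\<dots> = (\<Sum>k. (1 + \<bar>t\<bar>) ^ m * norm (flat_seq s x k *\<^sub>R gauss_poly P (t - real k)))"
      by (rule suminf_mult[symmetric, OF sm])
    also have "\<dots> \<le> (\<Sum>k. \<bar>flat_seq s x k\<bar> * real (Suc k) ^ m * D)"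
    proof (intro suminf_le summable_mult summable_mult2 sm summable_flat_seq_power)
      fix k
      have "1 + \<bar>t\<bar> \<le> 1 + \<bar>t - real k\<bar> + real k" by linarith
      also have "\<dots> \<le> real (Suc k) * (1 + \<bar>t - real k\<bar>)" by (simp add: algebra_simps)
      finally have "(1 + \<bar>t\<bar>) ^ m \<le> (real (Suc k) * (1 + \<bar>t - real k\<bar>)) ^ m" by (rule power_mono) simp
      then have "(1 + \<bar>t\<bar>) ^ m * cmod (gauss_poly P (t - real k))
          \<le> (real (Suc k) * (1 + \<bar>t - real k\<bar>)) ^ m * cmod (gauss_poly P (t - real k))"
        by (rule mult_right_mono) simp
      also have "\<dots> = real (Suc k) ^ m * ((1 + \<bar>t - real k\<bar>) ^ m * cmod (gauss_poly P (t - real k)))"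
        by (simp only: power_mult_distrib mult.assoc)
      also have "\<dots> \<le> real (Suc k) ^ m * D" by (intro mult_left_mono D) auto
      finally have "\<bar>flat_seq s x k\<bar> * ((1 + \<bar>t\<bar>) ^ m * cmod (gauss_poly P (t - real k)))
          \<le> \<bar>flat_seq s x k\<bar> * (real (Suc k) ^ m * D)" by (rule mult_left_mono) simp
      then show "(1 + \<bar>t\<bar>) ^ m * norm (flat_seq s x k *\<^sub>R gauss_poly P (t - real k))
          \<le> \<bar>flat_seq s x k\<bar> * real (Suc k) ^ m * D"
        unfolding norm_scaleR by (simp only: mult_ac)
    qed
    finally show "(1 + \<bar>t\<bar>) ^ m * cmod (conv (flat_seq s x) (gauss_poly P) t)
        \<le> (\<Sum>k. \<bar>flat_seq s x k\<bar> * real (Suc k) ^ m * D)" .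
  qed
qed

lemma generator_deriv_has_vector_derivative:
  "(generator_deriv j has_vector_derivative generator_deriv (Suc j) t) (at t)"
proof -
  obtain A where A: "\<And>t. cmod (gauss_poly ((gauss_pderiv ^^ j) 1) t) \<le> A" using gauss_poly_bounded by blast
  obtain B where B: "\<And>t. cmod (gauss_poly (gauss_pderiv ((gauss_pderiv ^^ j) 1)) t) \<le> B"
    using gauss_poly_bounded by blast
  show ?thesis
    using conv_has_vector_derivative[OF summable_abs_flat_seq gauss_poly_has_vector_derivative A B]
    by (simp add: generator_deriv_def)
qed

lemma nth_vderiv_generator: "nth_vderiv k (generator_deriv 0) = generator_deriv k"
proof (induction k)
  case (Suc k)
  then show ?case
    using vector_derivative_at[OF generator_deriv_has_vector_derivative] by (auto simp: nth_vderiv_def)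
qed (simp add: nth_vderiv_def)

lemma generator_in_schwartz_space: "generator_deriv 0 \<in> schwartz_space"
  unfolding schwartz_space_def mem_Collect_eq nth_vderiv_generator
proof (intro conjI allI)
  show "generator_deriv k differentiable at t" for k t
    using generator_deriv_has_vector_derivative by (rule differentiableI_vector)
  fix m k
  obtain K where K: "\<And>t. (1 + \<bar>t\<bar>) ^ m * cmod (generator_deriv k t) \<le> K"
    unfolding generator_deriv_def using conv_gauss_poly_power_bounded by blast
  show "bounded (range (\<lambda>t. t ^ m *\<^sub>R generator_deriv k t))"
    unfolding bounded_iff
  proof (intro exI ballI)
    fix y assume "y \<in> range (\<lambda>t. t ^ m *\<^sub>R generator_deriv k t)"
    then obtain t where t: "y = t ^ m *\<^sub>R generator_deriv k t" by blast
    have "norm y = \<bar>t\<bar> ^ m * cmod (generator_deriv k t)" by (simp add: t power_abs)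
    also have "\<dots> \<le> (1 + \<bar>t\<bar>) ^ m * cmod (generator_deriv k t)"
      by (intro mult_right_mono power_mono) auto
    finally show "norm y \<le> K" using K[of t] by linarith
  qed
qed

lemma continuous_generator_deriv: "continuous_on UNIV (generator_deriv j)"
proof -
  have "isCont (generator_deriv j) t" for t
    by (rule has_vector_derivative_continuous[OF generator_deriv_has_vector_derivative])
  then show ?thesis by (simp add: continuous_at_imp_continuous_on)
qed

lemma generator_deriv_measurable: "generator_deriv j \<in> borel_measurable borel"
  using continuous_generator_deriv by (rule borel_measurable_continuous_onI)

lemma generator_deriv_decay: "\<exists>C\<ge>0. \<forall>t. cmod (generator_deriv j t) \<le> C / (1 + t\<^sup>2)"
proof -
  obtain K where K: "\<And>t. (1 + \<bar>t\<bar>) ^ 2 * cmod (generator_deriv j t) \<le> K"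
    unfolding generator_deriv_def using conv_gauss_poly_power_bounded by blast
  have K0: "K \<ge> 0" using K[of 0] norm_ge_zero[of "generator_deriv j 0"] by (simp del: norm_ge_zero)
  have "cmod (generator_deriv j t) \<le> K / (1 + t\<^sup>2)" for t
  proof -
    have p: "1 + t\<^sup>2 > 0" by (simp add: add_pos_nonneg)
    have "1 + t\<^sup>2 \<le> (1 + \<bar>t\<bar>) ^ 2" by (simp add: power2_sum)
    then have "(1 + t\<^sup>2) * cmod (generator_deriv j t) \<le> (1 + \<bar>t\<bar>) ^ 2 * cmod (generator_deriv j t)"
      by (rule mult_right_mono) simp
    then have "cmod (generator_deriv j t) * (1 + t\<^sup>2) \<le> K" using K[of t] by (simp add: mult.commute)
    then show ?thesis unfolding pos_le_divide_eq[OF p] .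
  qed
  then show ?thesis using K0 by blast
qed

section \<open>Taylor's formula in the sup and L1 norms\<close>

lemma taylor_remainder_bound:
  fixes F :: "nat \<Rightarrow> real \<Rightarrow> complex"
  assumes "\<And>i y. (F i has_vector_derivative F (Suc i) y) (at y)"
    and "\<And>y. \<bar>y - t\<bar> \<le> \<bar>h\<bar> \<Longrightarrow> cmod (F (Suc n) y) \<le> B"
  shows "cmod (F 0 (t + h) - (\<Sum>i\<le>n. (of_real h ^ i / fact i) * F i t)) \<le> B * \<bar>h\<bar> ^ Suc n"
  using assms
proof (induction n arbitrary: F h)
  case 0
  have "norm (F 0 (t + h) - F 0 t) \<le> B * \<bar>(t + h) - t\<bar>"
  proof (rule vector_mean_value_bound[OF 0(1)])
    fix y assume "y \<in> closed_segment t (t + h)"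
    then have "\<bar>y - t\<bar> \<le> \<bar>h\<bar>" by (auto simp: closed_segment_eq_real_ivl split: if_splits)
    then show "norm (F (Suc 0) y) \<le> B" using 0(2) by simp
  qed
  then show ?case by simp
next
  case (Suc n)
  define G where "G s = F 0 (t + s) - (\<Sum>i\<le>Suc n. (of_real s ^ i / fact i) * F i t)" for s
  \<comment> \<open>The derivative of the remainder \<open>G\<close> is the remainder of the family
    shifted by one, to which the induction hypothesis applies.\<close>
  define G' where "G' s = F (Suc 0) (t + s) - (\<Sum>i\<le>n. (of_real s ^ i / fact i) * F (Suc i) t)" for s
  have "norm (G h - G 0) \<le> (B * \<bar>h\<bar> ^ Suc n) * \<bar>h - 0\<bar>"
  proof (rule vector_mean_value_bound)
    fix s
    have p: "((\<lambda>s. (of_real s ^ i / fact i) * c) has_vector_derivative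
        (of_nat i * of_real s ^ (i - 1) / fact i) * c) (at s)" for i and c :: complex
    proof -
      have "((\<lambda>z. (z ^ i / fact i) * c) has_field_derivative (of_nat i * of_real s ^ (i - 1) / fact i) * c) (at (of_real s))"
        by (auto intro!: derivative_eq_intros)
      from has_vector_derivative_real_field[OF this] show ?thesis by simp
    qed
    have shift: "((\<lambda>s. t + s) has_vector_derivative 1) (at s)"
      by (auto intro!: derivative_eq_intros)
    have "((\<lambda>s. F 0 (t + s)) has_vector_derivative F (Suc 0) (t + s)) (at s)"
      using vector_diff_chain_at[of "\<lambda>s. t + s" 1 s "F 0" "F (Suc 0) (t + s)"] Suc.prems(1)[of 0 "t + s"]
      by (simp add: o_def shift)
    then have "(G has_vector_derivative F (Suc 0) (t + s)
        - (\<Sum>i\<le>Suc n. (of_nat i * of_real s ^ (i - 1) / fact i) * F i t)) (at s)"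
      unfolding G_def[abs_def] by (intro has_vector_derivative_diff has_vector_derivative_sum p)
    moreover have "(\<Sum>i\<le>Suc n. (of_nat i * of_real s ^ (i - 1) / fact i) * F i t)
        = (\<Sum>i\<le>n. (of_real s ^ i / fact i) * F (Suc i) t)"
      by (subst sum.atMost_Suc_shift) (simp add: field_simps del: of_nat_Suc)
    ultimately show "(G has_vector_derivative G' s) (at s)" by (simp add: G'_def)
  next
    fix s assume "s \<in> closed_segment 0 h"
    then have s: "\<bar>s\<bar> \<le> \<bar>h\<bar>" by (auto simp: closed_segment_eq_real_ivl split: if_splits)
    have B: "B \<ge> 0" using Suc.prems(2)[of t] norm_ge_zero[of "F (Suc (Suc n)) t"] by (simp del: norm_ge_zero)
    have "cmod (G' s) \<le> B * \<bar>s\<bar> ^ Suc n"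
      unfolding G'_def using Suc.IH[of "\<lambda>i. F (Suc i)" s] Suc.prems s by force
    also have "\<dots> \<le> B * \<bar>h\<bar> ^ Suc n" using B s by (intro mult_left_mono power_mono) auto
    finally show "norm (G' s) \<le> B * \<bar>h\<bar> ^ Suc n" .
  qed
  moreover have "G 0 = 0" by (simp add: G_def sum.atMost_Suc_shift del: sum.atMost_Suc)
  ultimately show ?case by (simp add: G_def mult_ac)
qed

text \<open>The decay of the next derivative is transferred from the intermediate points to
  \<open>t\<close> by \<open>one_plus_square_le\<close>, which makes the remainder small in L1 as
  well. The factor 4 exceeds \<open>pi\<close>, so that one constant serves both norms.\<close>

lemma generator_taylor:
  "\<exists>K\<ge>0. \<forall>h. \<bar>h\<bar> \<le> R \<longrightarrow> sup_L1_le (K * \<bar>h\<bar> ^ Suc n) (K * \<bar>h\<bar> ^ Suc n)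
     (\<lambda>t. generator_deriv 0 (t + h) - (\<Sum>i\<le>n. (of_real h ^ i / fact i) * generator_deriv i t))"
proof -
  obtain C where C: "C \<ge> 0" "\<And>t. cmod (generator_deriv (Suc n) t) \<le> C / (1 + t\<^sup>2)"
    using generator_deriv_decay by blast
  define K where "K = C * (2 + 2 * R\<^sup>2)"
  have K: "K \<ge> 0" using C(1) by (simp add: K_def)
  show ?thesis
  proof (intro exI[of _ "K * 4"] conjI allI impI)
    show "0 \<le> K * 4" using K by simp
    fix h assume h: "\<bar>h\<bar> \<le> R"
    let ?f = "\<lambda>t. generator_deriv 0 (t + h) - (\<Sum>i\<le>n. (of_real h ^ i / fact i) * generator_deriv i t)"
    have "sup_L1_le (K * \<bar>h\<bar> ^ Suc n) ((K * \<bar>h\<bar> ^ Suc n) * pi) ?f"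
    proof (rule sup_L1_le_decay)
      have "continuous_on UNIV ?f"
        by (intro continuous_intros continuous_on_compose2[OF continuous_generator_deriv]
            continuous_generator_deriv) auto
      then show "?f \<in> borel_measurable borel" by (rule borel_measurable_continuous_onI)
      fix t
      have "cmod (?f t) \<le> (K / (1 + t\<^sup>2)) * \<bar>h\<bar> ^ Suc n"
      proof (rule taylor_remainder_bound[where F = generator_deriv, OF generator_deriv_has_vector_derivative])
        fix y assume "\<bar>y - t\<bar> \<le> \<bar>h\<bar>"
        then have "\<bar>t - y\<bar> \<le> R" using h by (simp add: abs_minus_commute)
        from one_plus_square_le[OF this]
        have "C * (1 / (1 + y\<^sup>2)) \<le> C * ((2 + 2 * R\<^sup>2) / (1 + t\<^sup>2))" using C(1) by (rule mult_left_mono)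
        then show "cmod (generator_deriv (Suc n) y) \<le> K / (1 + t\<^sup>2)" using C(2)[of y] by (simp add: K_def)
      qed
      then show "cmod (?f t) \<le> K * \<bar>h\<bar> ^ Suc n / (1 + t\<^sup>2)" by simp
    qed
    then show "sup_L1_le (K * 4 * \<bar>h\<bar> ^ Suc n) (K * 4 * \<bar>h\<bar> ^ Suc n) ?f"
    proof (rule sup_L1_le_mono)
      have p: "K * \<bar>h\<bar> ^ Suc n \<ge> 0" using K by simp
      show "K * \<bar>h\<bar> ^ Suc n \<le> K * 4 * \<bar>h\<bar> ^ Suc n" using p by (simp add: mult_ac)
      have "K * \<bar>h\<bar> ^ Suc n * pi \<le> K * \<bar>h\<bar> ^ Suc n * 4" using p pi_less_4 by (intro mult_left_mono) auto
      then show "K * \<bar>h\<bar> ^ Suc n * pi \<le> K * 4 * \<bar>h\<bar> ^ Suc n" by (simp only: mult_ac)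
    qed
  qed
qed

section \<open>Closed spans\<close>

text \<open>Combinations are indexed by integers, not by functions: distinct \<open>n\<close> may
  give the same translate. The coefficients are merged only in \<open>theorem1\<close>.\<close>

definition finite_comb :: "(int \<Rightarrow> real \<Rightarrow> complex) \<Rightarrow> (real \<Rightarrow> complex) \<Rightarrow> bool" where
  "finite_comb g v \<longleftrightarrow> (\<exists>A c. finite A \<and> v = (\<lambda>t. \<Sum>n\<in>A. c n * g n t))"

lemma finite_comb_member: "finite_comb g (g n)"
  unfolding finite_comb_def by (intro exI[of _ "{n}"] exI[of _ "\<lambda>_. 1"]) auto

lemma finite_comb_zero: "finite_comb g (\<lambda>t. 0)"
  unfolding finite_comb_def by (intro exI[of _ "{}"]) auto

lemma finite_comb_cmult:
  assumes "finite_comb g v" shows "finite_comb g (\<lambda>t. a * v t)"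
proof -
  obtain A c where "finite A" "v = (\<lambda>t. \<Sum>n\<in>A. c n * g n t)" using assms finite_comb_def by blast
  then show ?thesis unfolding finite_comb_def
    by (intro exI[of _ A] exI[of _ "\<lambda>n. a * c n"]) (simp add: sum_distrib_left mult.assoc)
qed

lemma finite_comb_add:
  assumes "finite_comb g v" "finite_comb g w" shows "finite_comb g (\<lambda>t. v t + w t)"
proof -
  obtain A c where A: "finite A" "v = (\<lambda>t. \<Sum>n\<in>A. c n * g n t)" using assms(1) finite_comb_def by blast
  obtain B d where B: "finite B" "w = (\<lambda>t. \<Sum>n\<in>B. d n * g n t)" using assms(2) finite_comb_def by blast
  have "(\<Sum>n\<in>A. c n * g n t) = (\<Sum>n\<in>A \<union> B. (if n \<in> A then c n else 0) * g n t)" for t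
    using A(1) B(1) by (intro sum.mono_neutral_cong_left) auto
  moreover have "(\<Sum>n\<in>B. d n * g n t) = (\<Sum>n\<in>A \<union> B. (if n \<in> B then d n else 0) * g n t)" for t
    using A(1) B(1) by (intro sum.mono_neutral_cong_left) auto
  ultimately have "(\<lambda>t. v t + w t)
      = (\<lambda>t. \<Sum>n\<in>A \<union> B. ((if n \<in> A then c n else 0) + (if n \<in> B then d n else 0)) * g n t)"
    unfolding A(2) B(2) by (simp add: sum.distrib distrib_right)
  moreover have "finite (A \<union> B)" using A(1) B(1) by simp
  ultimately show ?thesis unfolding finite_comb_def by (intro exI conjI)
qed

text \<open>The distance \<open>K\<close> is kept explicit because the translates are at first only
  known to lie near the span, with a distance that decays in \<open>n\<close>.\<close>

definition near_span :: "(int \<Rightarrow> real \<Rightarrow> complex) \<Rightarrow> real \<Rightarrow> (real \<Rightarrow> complex) \<Rightarrow> bool" where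
  "near_span g K f \<longleftrightarrow> (\<exists>v. finite_comb g v \<and> sup_L1_le K K (\<lambda>t. f t - v t))"

lemma near_span_member: "near_span g 0 (g n)"
  unfolding near_span_def by (intro exI[of _ "g n"]) (simp add: finite_comb_member sup_L1_le_zero)

lemma near_span_small: "sup_L1_le K K f \<Longrightarrow> near_span g K f"
  unfolding near_span_def by (intro exI[of _ "\<lambda>t. 0"]) (simp add: finite_comb_zero)

lemma near_span_mono: "near_span g K f \<Longrightarrow> K \<le> K' \<Longrightarrow> near_span g K' f"
  unfolding near_span_def by (meson sup_L1_le_mono)

lemma near_span_add:
  assumes "near_span g K f" "near_span g L h"
  shows "near_span g (K + L) (\<lambda>t. f t + h t)"
proof -
  obtain v where v: "finite_comb g v" "sup_L1_le K K (\<lambda>t. f t - v t)" using assms(1) near_span_def by blast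
  obtain w where w: "finite_comb g w" "sup_L1_le L L (\<lambda>t. h t - w t)" using assms(2) near_span_def by blast
  have "(\<lambda>t. f t - v t + (h t - w t)) = (\<lambda>t. f t + h t - (v t + w t))" by auto
  then show ?thesis unfolding near_span_def
    using finite_comb_add[OF v(1) w(1)] sup_L1_le_add[OF v(2) w(2)] by auto
qed

lemma near_span_cmult:
  assumes "near_span g K f"
  shows "near_span g (cmod a * K) (\<lambda>t. a * f t)"
proof -
  obtain v where v: "finite_comb g v" "sup_L1_le K K (\<lambda>t. f t - v t)" using assms near_span_def by blast
  show ?thesis unfolding near_span_def
    using finite_comb_cmult[OF v(1), of a] sup_L1_le_cmult[OF v(2), of a]
    by (auto simp: right_diff_distrib)
qed

lemma near_span_sum:
  assumes "\<And>i. i \<in> I \<Longrightarrow> near_span g (K i) (f i)"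
  shows "near_span g (\<Sum>i\<in>I. K i) (\<lambda>t. \<Sum>i\<in>I. f i t)"
  using assms
proof (induction I rule: infinite_finite_induct)
  case (insert x F)
  then show ?case by (simp add: near_span_add)
qed (simp_all add: near_span_small sup_L1_le_zero)

definition in_closure :: "(int \<Rightarrow> real \<Rightarrow> complex) \<Rightarrow> (real \<Rightarrow> complex) \<Rightarrow> bool" where
  "in_closure g f \<longleftrightarrow> (\<forall>\<epsilon>>0. near_span g \<epsilon> f)"

lemma in_closure_add:
  assumes "in_closure g f" "in_closure g h"
  shows "in_closure g (\<lambda>t. f t + h t)"
  unfolding in_closure_def
proof (intro allI impI)
  fix \<epsilon> :: real assume "\<epsilon> > 0"
  then have "near_span g (\<epsilon>/2 + \<epsilon>/2) (\<lambda>t. f t + h t)"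
    using assms unfolding in_closure_def by (intro near_span_add) auto
  then show "near_span g \<epsilon> (\<lambda>t. f t + h t)" by simp
qed

lemma in_closure_cmult:
  assumes "in_closure g f"
  shows "in_closure g (\<lambda>t. a * f t)"
  unfolding in_closure_def
proof (intro allI impI)
  fix \<epsilon> :: real assume e: "\<epsilon> > 0"
  have "near_span g (cmod a * (\<epsilon> / (cmod a + 1))) (\<lambda>t. a * f t)"
    using assms e unfolding in_closure_def by (intro near_span_cmult) (auto simp: add_nonneg_pos)
  moreover have "cmod a * (\<epsilon> / (cmod a + 1)) \<le> \<epsilon>"
    using e mult_right_mono[of "cmod a" "cmod a + 1" \<epsilon>]
    by (simp add: pos_divide_le_eq add_nonneg_pos mult.commute)
  ultimately show "near_span g \<epsilon> (\<lambda>t. a * f t)" by (rule near_span_mono)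
qed

lemma in_closure_zero: "in_closure g (\<lambda>t. 0)"
  unfolding in_closure_def by (auto intro!: near_span_small sup_L1_le_zero)

lemma in_closure_sum:
  assumes "\<And>i. i \<in> I \<Longrightarrow> in_closure g (f i)"
  shows "in_closure g (\<lambda>t. \<Sum>i\<in>I. f i t)"
  using assms
  by (induction I rule: infinite_finite_induct) (simp_all add: in_closure_zero in_closure_add)

lemma in_closure_limit:
  assumes "\<And>\<epsilon>. \<epsilon> > 0 \<Longrightarrow> \<exists>h. in_closure g h \<and> sup_L1_le \<epsilon> \<epsilon> (\<lambda>t. f t - h t)"
  shows "in_closure g f"
  unfolding in_closure_def
proof (intro allI impI)
  fix \<epsilon> :: real assume e: "\<epsilon> > 0"
  then obtain h where h: "in_closure g h" "sup_L1_le (\<epsilon>/2) (\<epsilon>/2) (\<lambda>t. f t - h t)"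
    using assms[of "\<epsilon>/2"] by auto
  have "near_span g (\<epsilon>/2) h" using h(1) e unfolding in_closure_def by simp
  with near_span_small[OF h(2)] have "near_span g (\<epsilon>/2 + \<epsilon>/2) (\<lambda>t. (f t - h t) + h t)"
    by (rule near_span_add)
  then show "near_span g \<epsilon> f" by simp
qed

section \<open>From exponentially near to the closed span\<close>

lemma geometric_int_bounded:
  assumes "0 \<le> \<theta>" "\<theta> < (1::real)"
  shows "\<exists>S\<ge>0. \<forall>A::int set. finite A \<longrightarrow> (\<Sum>n\<in>A. \<theta> ^ nat \<bar>n\<bar>) \<le> S"
proof -
  have "\<exists>K\<ge>0. \<forall>n. \<theta> ^ nat \<bar>n\<bar> \<le> K / (1 + (real_of_int n)\<^sup>2)"
  proof (cases "\<theta> = 0")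
    case True
    show ?thesis
    proof (intro exI[of _ 1] conjI allI)
      show "\<theta> ^ nat \<bar>n\<bar> \<le> 1 / (1 + (real_of_int n)\<^sup>2)" for n
        using True by (cases "n = 0") (auto simp: zero_power add_nonneg_nonneg)
    qed simp
  next
    case False
    then have r: "1 / \<theta> > 1" using assms by (simp add: field_simps)
    obtain C where C: "C > 0" "\<And>n::int. \<bar>real_of_int n\<bar> ^ 2 \<le> C * (1 / \<theta>) ^ nat \<bar>n\<bar>"
      using power_le_exponential[OF r] by metis
    have "\<theta> ^ nat \<bar>n\<bar> \<le> (1 + C) / (1 + (real_of_int n)\<^sup>2)" for n
    proof -
      have "1 \<le> (1 / \<theta>) ^ nat \<bar>n\<bar>" using r by (intro one_le_power) auto
      then have "1 + (real_of_int n)\<^sup>2 \<le> (1 + C) * (1 / \<theta>) ^ nat \<bar>n\<bar>"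
        using C(2)[of n] by (simp add: distrib_right)
      moreover have "\<theta> ^ nat \<bar>n\<bar> > 0" using False assms by simp
      moreover have "1 + (real_of_int n)\<^sup>2 > 0" by (simp add: add_pos_nonneg)
      ultimately show ?thesis by (simp add: power_one_over field_simps)
    qed
    then show ?thesis using C(1) by (intro exI[of _ "1 + C"]) auto
  qed
  then obtain K where K: "K \<ge> 0" "\<And>n. \<theta> ^ nat \<bar>n\<bar> \<le> K / (1 + (real_of_int n)\<^sup>2)" by blast
  have "(\<Sum>n\<in>A. \<theta> ^ nat \<bar>n\<bar>) \<le> K * int_square_sum" if "finite A" for A
  proof -
    have "(\<Sum>n\<in>A. \<theta> ^ nat \<bar>n\<bar>) \<le> (\<Sum>n\<in>A. K * (1 / (1 + (real_of_int n)\<^sup>2)))"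
      using K(2) by (intro sum_mono) simp
    also have "\<dots> \<le> K * int_square_sum"
      unfolding sum_distrib_left[symmetric] by (intro mult_left_mono sum_int_inverse_square_le that K(1))
    finally show ?thesis .
  qed
  then show ?thesis using K(1) int_square_sum_nonneg by (intro exI[of _ "K * int_square_sum"]) simp
qed

text \<open>For \<open>m = 0\<close>, write \<open>\<psi>\<close> as the combination with
  coefficients \<open>c = \<delta>_0 - q\<close>, where \<open>\<delta>_0\<close> is the unit
  sequence at 0, plus \<open>translate_sum q \<psi>\<close>. The latter is small by
  \<open>annihilable_delta\<close>; in the former the coefficients may grow like
  \<open>\<rho> ^ nat \<bar>n\<bar>\<close>, but the distances from the span decay faster. Other
  \<open>m\<close> follow by translation.\<close>

lemma in_closure_of_exponentially_near:
  assumes r: "0 < r" "r < 1" and K: "K \<ge> 0"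
    and \<psi>: "\<And>i. \<exists>h A B. \<psi> = (fun_diff ^^ i) h \<and> sup_L1_le A B h"
    and near: "\<And>n. near_span g (K * r ^ nat \<bar>n\<bar>) (\<lambda>t. \<psi> (t - of_int n))"
  shows "in_closure g (\<lambda>t. \<psi> (t - of_int m))"
  unfolding in_closure_def
proof (intro allI impI)
  fix \<epsilon> :: real assume e: "\<epsilon> > 0"
  \<comment> \<open>Half of the decay of \<open>r ^ nat \<bar>n\<bar>\<close> is spent on the
    growing coefficients; the other half, \<open>\<theta>\<close>, makes the sum converge.\<close>
  define \<rho> where "\<rho> = 1 / sqrt r"
  define \<theta> where "\<theta> = sqrt r"
  have sr: "0 < sqrt r" "sqrt r < 1" using r by auto
  have \<rho>: "\<rho> > 1" using sr by (simp add: \<rho>_def field_simps)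
  have \<rho>r: "\<rho> * r = \<theta>" using r by (simp add: \<rho>_def \<theta>_def real_div_sqrt)
  obtain S where S: "S \<ge> 0" "\<And>A::int set. finite A \<Longrightarrow> (\<Sum>n\<in>A. \<theta> ^ nat \<bar>n\<bar>) \<le> S"
    using geometric_int_bounded[of \<theta>] sr unfolding \<theta>_def by (metis less_imp_le)
  \<comment> \<open>Recentring the distances at \<open>m\<close> costs this factor, since
    \<open>\<bar>n\<bar> \<le> \<bar>m + n\<bar> + \<bar>m\<bar>\<close>.\<close>
  define M where "M = K / r ^ nat \<bar>m\<bar>"
  have M: "M \<ge> 0" using K r by (simp add: M_def)
  define \<delta> where "\<delta> = \<epsilon> / (M * S + 1)"
  have d: "\<delta> > 0" "\<delta> * (M * S + 1) = \<epsilon>"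
  proof -
    have p: "M * S + 1 > 0" using M S(1) by (simp add: add_nonneg_pos)
    then show "\<delta> > 0" "\<delta> * (M * S + 1) = \<epsilon>" using e by (simp_all add: \<delta>_def)
  qed
  obtain q where q: "finite {n. q n \<noteq> 0}"
      "\<And>n. cmod ((if n = 0 then 1 else 0) - q n) \<le> \<delta> * \<rho> ^ nat \<bar>n\<bar>"
      "sup_L1_le \<delta> \<delta> (translate_sum q \<psi>)"
    using annihilable_delta[OF \<rho> \<psi>] d(1) unfolding annihilable_def by meson
  \<comment> \<open>The index 0 is inserted because \<open>c 0\<close> must be summed even if
    \<open>q 0 = 0\<close>.\<close>
  define F where "F = insert 0 {n. q n \<noteq> 0}"
  have F: "finite F" "0 \<in> F" using q(1) by (auto simp: F_def)
  define c where "c n = (if n = 0 then 1 else 0) - q n" for n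
  have near': "near_span g (\<delta> * M * \<theta> ^ nat \<bar>n\<bar>) (\<lambda>t. c n * \<psi> (t - of_int (m + n)))" for n
  proof (rule near_span_mono[OF near_span_cmult[OF near]])
    have "r ^ nat \<bar>m + n\<bar> * r ^ nat \<bar>m\<bar> = r ^ (nat \<bar>m + n\<bar> + nat \<bar>m\<bar>)" by (simp add: power_add)
    also have "\<dots> \<le> r ^ nat \<bar>n\<bar>" using r by (intro power_decreasing) auto
    finally have "r ^ nat \<bar>m + n\<bar> \<le> r ^ nat \<bar>n\<bar> / r ^ nat \<bar>m\<bar>" using r by (simp add: field_simps)
    then have "K * r ^ nat \<bar>m + n\<bar> \<le> M * r ^ nat \<bar>n\<bar>"
      using mult_left_mono[OF _ K] by (fastforce simp: M_def)
    from mult_mono[OF _ this] have "cmod (c n) * (K * r ^ nat \<bar>m + n\<bar>) \<le> (\<delta> * \<rho> ^ nat \<bar>n\<bar>) * (M * r ^ nat \<bar>n\<bar>)"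
      using q(2)[of n] K r d(1) \<rho> by (auto simp: c_def)
    also have "\<dots> = \<delta> * M * (\<rho> * r) ^ nat \<bar>n\<bar>" by (simp only: power_mult_distrib mult_ac)
    finally show "cmod (c n) * (K * r ^ nat \<bar>m + n\<bar>) \<le> \<delta> * M * \<theta> ^ nat \<bar>n\<bar>" unfolding \<rho>r .
  qed
  have "near_span g ((\<Sum>n\<in>F. \<delta> * M * \<theta> ^ nat \<bar>n\<bar>) + \<delta>)
     (\<lambda>t. (\<Sum>n\<in>F. c n * \<psi> (t - of_int (m + n))) + translate_sum q \<psi> (t - of_int m))"
    by (intro near_span_add near_span_sum near' near_span_small sup_L1_le_translate q(3))
  moreover have "(\<Sum>n\<in>F. c n * \<psi> (t - of_int (m + n))) + translate_sum q \<psi> (t - of_int m)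
      = \<psi> (t - of_int m)" for t
  proof -
    have "translate_sum q \<psi> (t - of_int m) = (\<Sum>n\<in>F. q n * \<psi> (t - of_int m - of_int n))"
      by (rule translate_sum_superset[OF F(1)]) (auto simp: F_def)
    then have "(\<Sum>n\<in>F. c n * \<psi> (t - of_int (m + n))) + translate_sum q \<psi> (t - of_int m)
        = (\<Sum>n\<in>F. (c n + q n) * \<psi> (t - of_int (m + n)))"
      by (simp add: sum.distrib distrib_right diff_diff_eq)
    also have "\<dots> = (\<Sum>n\<in>F. if n = 0 then \<psi> (t - of_int m) else 0)"
      by (intro sum.cong) (auto simp: c_def)
    finally show ?thesis using F by simp
  qed
  moreover have "(\<Sum>n\<in>F. \<delta> * M * \<theta> ^ nat \<bar>n\<bar>) + \<delta> \<le> \<epsilon>"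
  proof -
    have "(\<Sum>n\<in>F. \<delta> * M * \<theta> ^ nat \<bar>n\<bar>) \<le> \<delta> * M * S"
      unfolding sum_distrib_left[symmetric] using d(1) M by (intro mult_left_mono S(2) F(1)) auto
    then show ?thesis using d(2) by (simp add: distrib_left mult.assoc)
  qed
  ultimately show "near_span g \<epsilon> (\<lambda>t. \<psi> (t - of_int m))"
    using near_span_mono by simp
qed

lemma generator_deriv_fun_diff:
  "\<exists>h A B. generator_deriv j = (fun_diff ^^ i) h \<and> sup_L1_le A B h"
proof -
  obtain C where C: "\<And>t. cmod (gauss_poly ((gauss_pderiv ^^ j) 1) t) \<le> C / (1 + t\<^sup>2)"
    using gauss_poly_decay by blast
  have "sup_L1_le C (C * pi) (gauss_poly ((gauss_pderiv ^^ j) 1))"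
    by (rule sup_L1_le_decay[OF borel_measurable_continuous_onI[OF continuous_gauss_poly] C])
  from conv_flat_seq_fun_diff[OF this] show ?thesis unfolding generator_deriv_def .
qed

text \<open>If all the derivatives of order less than \<open>j\<close> are available, then Taylor's formula at \<open>n\<close> with
  increment \<open>a n \<noteq> 0\<close>, divided by \<open>(a n) ^ j\<close>, shows that the \<open>j\<close>-th derivative translated by
  \<open>n\<close> is at distance \<open>O(a n)\<close> from the span; so the exponential decay of \<open>a\<close> can be used again.\<close>

lemma generator_deriv_in_closure:
  assumes a: "\<And>n. a n \<noteq> 0" and r: "0 < r" "r < 1" and C: "C > 0"
    and bound: "\<And>n. \<bar>a n\<bar> < C * r ^ nat \<bar>n\<bar>"
    and g: "g = (\<lambda>n t. generator_deriv 0 (t - (of_int n + a n)))"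
  shows "in_closure g (\<lambda>t. generator_deriv j (t - of_int m))"
proof (induction j arbitrary: m rule: less_induct)
  case (less j)
  have aC: "\<bar>a n\<bar> \<le> C" for n
  proof -
    have "C * r ^ nat \<bar>n\<bar> \<le> C * 1" using r C by (intro mult_left_mono power_le_one) auto
    then show ?thesis using bound[of n] by simp
  qed
  obtain K where K: "K \<ge> 0" "\<And>h. \<bar>h\<bar> \<le> C \<Longrightarrow> sup_L1_le (K * \<bar>h\<bar> ^ Suc j) (K * \<bar>h\<bar> ^ Suc j)
     (\<lambda>t. generator_deriv 0 (t + h) - (\<Sum>i\<le>j. (of_real h ^ i / fact i) * generator_deriv i t))"
    using generator_taylor by blast
  have near: "near_span g (fact j * (K + 1) * C * r ^ nat \<bar>n\<bar>) (\<lambda>t. generator_deriv j (t - of_int n))" for n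
  proof -
    \<comment> \<open>The \<open>\<Lambda>\<close>-translate with index \<open>n\<close> is
      \<open>\<phi>\<close> evaluated at \<open>(t - n) + h\<close>.\<close>
    define h where "h = - a n"
    have h: "h \<noteq> 0" "\<bar>h\<bar> \<le> C" using a aC by (auto simp: h_def)
    have hp: "\<bar>h\<bar> ^ Suc j > 0" using h by simp
    let ?G = "\<lambda>i t. generator_deriv i (t - of_int n)"
    define rem where "rem t = ?G 0 (t + h) - (\<Sum>i\<le>j. (of_real h ^ i / fact i) * ?G i t)" for t
    have "sup_L1_le (K * \<bar>h\<bar> ^ Suc j) (K * \<bar>h\<bar> ^ Suc j) rem"
      using sup_L1_le_translate[OF K(2)[OF h(2)], of "of_int n"] unfolding rem_def[abs_def]
      by (simp add: algebra_simps)
    then have n1: "near_span g (cmod (-1) * (K * \<bar>h\<bar> ^ Suc j)) (\<lambda>t. (-1) * rem t)"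
      by (intro near_span_cmult near_span_small)
    have n2: "near_span g 0 (\<lambda>t. ?G 0 (t + h))"
      using near_span_member[of g n] unfolding g h_def by (simp add: algebra_simps)
    have "in_closure g (\<lambda>t. \<Sum>i<j. (- (of_real h ^ i / fact i)) * ?G i t)"
      by (intro in_closure_sum in_closure_cmult less) simp
    \<comment> \<open>The lower derivatives are approximated to within
      \<open>\<bar>h\<bar> ^ Suc j\<close>, a tolerance depending on \<open>n\<close>. After
      division by \<open>h ^ j\<close> an error of order \<open>\<bar>h\<bar>\<close> is left,
      however small \<open>h\<close> may be.\<close>
    then have n3: "near_span g (\<bar>h\<bar> ^ Suc j) (\<lambda>t. \<Sum>i<j. (- (of_real h ^ i / fact i)) * ?G i t)"
      using hp unfolding in_closure_def by blast
    define s :: complex where "s = fact j / of_real h ^ j"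
    have "near_span g (cmod s * (0 + \<bar>h\<bar> ^ Suc j + cmod (-1) * (K * \<bar>h\<bar> ^ Suc j)))
       (\<lambda>t. s * (?G 0 (t + h) + (\<Sum>i<j. (- (of_real h ^ i / fact i)) * ?G i t) + (-1) * rem t))"
      by (intro near_span_cmult near_span_add n1 n2 n3)
    moreover have "s * (?G 0 (t + h) + (\<Sum>i<j. (- (of_real h ^ i / fact i)) * ?G i t) + (-1) * rem t) = ?G j t" for t
    proof -
      have "?G 0 (t + h) + (\<Sum>i<j. (- (of_real h ^ i / fact i)) * ?G i t) + (-1) * rem t
          = (of_real h ^ j / fact j) * ?G j t"
        unfolding rem_def lessThan_Suc_atMost[symmetric] by (simp add: sum_negf)
      then show ?thesis using h by (simp add: s_def)
    qed
    moreover have "cmod s * (0 + \<bar>h\<bar> ^ Suc j + cmod (-1) * (K * \<bar>h\<bar> ^ Suc j)) = fact j * (K + 1) * \<bar>h\<bar>"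
      using h by (simp add: s_def norm_divide norm_power field_simps)
    moreover have "fact j * (K + 1) * \<bar>h\<bar> \<le> fact j * (K + 1) * (C * r ^ nat \<bar>n\<bar>)"
      using bound[of n] K(1) by (intro mult_left_mono) (auto simp: h_def)
    ultimately show ?thesis using near_span_mono by (simp add: mult.assoc)
  qed
  show ?case
    by (rule in_closure_of_exponentially_near[OF r _ generator_deriv_fun_diff near])
       (use K(1) C in simp)
qed

section \<open>Density of polynomials times a Gaussian\<close>

lemma degree_gauss_pderiv_power:
  "degree ((gauss_pderiv ^^ j) 1) = j \<and> (gauss_pderiv ^^ j) (1 :: complex poly) \<noteq> 0"
proof (induction j)
  case (Suc j)
  define P where "P = (gauss_pderiv ^^ j) (1 :: complex poly)"
  have P: "degree P = j" "P \<noteq> 0" using Suc by (auto simp: P_def)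
  define R where "R = [:0, 2:] * P"
  have d: "degree (- R) = Suc j" unfolding R_def degree_minus using P by (subst degree_mult_eq) auto
  have "degree (pderiv P) < degree (- R)" unfolding d using P(1) by (simp add: degree_pderiv)
  then have "degree (pderiv P + - R) = Suc j" by (simp only: degree_add_eq_right d)
  then have "degree (gauss_pderiv P) = Suc j" by (simp only: gauss_pderiv_def R_def diff_conv_add_uminus)
  then show ?case by (auto simp: P_def)
qed simp

text \<open>The \<open>j\<close>-th iterate has degree exactly \<open>j\<close>, so a suitable
  multiple of it cancels the leading term of a polynomial of degree \<open>j\<close>.\<close>

lemma hermite_induct:
  assumes zero: "Q (0 :: complex poly)" and add: "\<And>P R. Q P \<Longrightarrow> Q R \<Longrightarrow> Q (P + R)"
    and smult: "\<And>c P. Q P \<Longrightarrow> Q (smult c P)" and herm: "\<And>j. Q ((gauss_pderiv ^^ j) 1)"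
  shows "Q P"
proof (induction "degree P" arbitrary: P rule: less_induct)
  case less
  define H where "H = (gauss_pderiv ^^ degree P) (1 :: complex poly)"
  have H: "degree H = degree P" "lead_coeff H \<noteq> 0"
    using degree_gauss_pderiv_power[of "degree P"] unfolding leading_coeff_0_iff H_def by auto
  define c where "c = lead_coeff P / lead_coeff H"
  define R where "R = P - smult c H"
  have eq: "P = R + smult c H" by (simp add: R_def)
  have "degree R \<le> degree P"
    unfolding R_def using H(1) degree_smult_le[of c H] by (intro degree_diff_le) auto
  moreover have "coeff R (degree P) = 0" using H by (simp add: R_def c_def)
  ultimately have "degree R < degree P \<or> R = 0"
    using leading_coeff_0_iff[of R] by (cases "degree R = degree P") auto
  then have "Q R" using zero less by auto
  then show ?case using add smult herm eq unfolding H_def by metis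
qed

lemma gauss_poly_add: "gauss_poly (P + R) t = gauss_poly P t + gauss_poly R t"
  by (simp add: gauss_poly_def distrib_right)

lemma gauss_poly_smult: "gauss_poly (smult c P) t = c * gauss_poly P t"
  by (simp add: gauss_poly_def)

lemma conv_gauss_poly_in_closure:
  assumes "\<And>j. in_closure g (generator_deriv j)"
  shows "in_closure g (conv (flat_seq 0 1) (gauss_poly P))"
proof (induction P rule: hermite_induct)
  case 1
  show ?case using in_closure_zero by (simp add: gauss_poly_def[abs_def] conv_def[abs_def])
next
  case (2 P R)
  obtain A where A: "\<And>t. cmod (gauss_poly P t) \<le> A" using gauss_poly_bounded by blast
  obtain B where B: "\<And>t. cmod (gauss_poly R t) \<le> B" using gauss_poly_bounded by blast
  have "conv (flat_seq 0 1) (gauss_poly (P + R))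
      = (\<lambda>t. conv (flat_seq 0 1) (gauss_poly P) t + conv (flat_seq 0 1) (gauss_poly R) t)"
    using conv_add[where f = "gauss_poly P" and g = "gauss_poly R", OF summable_abs_flat_seq A B]
    by (auto simp: gauss_poly_add[abs_def])
  then show ?case using in_closure_add[OF 2] by simp
next
  case (3 c P)
  obtain A where A: "\<And>t. cmod (gauss_poly P t) \<le> A" using gauss_poly_bounded by blast
  have "conv (flat_seq 0 1) (gauss_poly (smult c P)) = (\<lambda>t. c * conv (flat_seq 0 1) (gauss_poly P) t)"
    using conv_cmult[where f = "gauss_poly P", OF summable_abs_flat_seq A]
    by (auto simp: gauss_poly_smult[abs_def])
  then show ?case using in_closure_cmult[OF 3] by simp
next
  case (4 j)
  show ?case using assms[of j] by (simp add: generator_deriv_def)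
qed

text \<open>The weight is chosen because a bound \<open>\<epsilon> / (1 + t^2)\<close> controls the
  sup norm and the L1 norm together, by \<open>sup_L1_le_decay\<close>.\<close>

definition gauss_poly_limit :: "(real \<Rightarrow> complex) \<Rightarrow> bool" where
  "gauss_poly_limit f \<longleftrightarrow> (\<forall>\<epsilon>>0. \<exists>P. \<forall>t. cmod (f t - gauss_poly P t) \<le> \<epsilon> / (1 + t\<^sup>2))"

lemma gauss_poly_limit_add:
  assumes "gauss_poly_limit f" "gauss_poly_limit h"
  shows "gauss_poly_limit (\<lambda>t. f t + h t)"
  unfolding gauss_poly_limit_def
proof (intro allI impI)
  fix \<epsilon> :: real assume "\<epsilon> > 0"
  then obtain P R where P: "\<And>t. cmod (f t - gauss_poly P t) \<le> (\<epsilon>/2) / (1 + t\<^sup>2)"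
    and R: "\<And>t. cmod (h t - gauss_poly R t) \<le> (\<epsilon>/2) / (1 + t\<^sup>2)"
    using assms half_gt_zero unfolding gauss_poly_limit_def by metis
  show "\<exists>P. \<forall>t. cmod (f t + h t - gauss_poly P t) \<le> \<epsilon> / (1 + t\<^sup>2)"
  proof (intro exI[of _ "P + R"] allI)
    fix t
    have "cmod (f t + h t - gauss_poly (P + R) t) \<le> cmod (f t - gauss_poly P t) + cmod (h t - gauss_poly R t)"
      using norm_triangle_ineq[of "f t - gauss_poly P t" "h t - gauss_poly R t"]
      by (simp add: gauss_poly_add algebra_simps)
    also have "\<dots> \<le> (\<epsilon>/2) / (1 + t\<^sup>2) + (\<epsilon>/2) / (1 + t\<^sup>2)" by (intro add_mono P R)
    also have "\<dots> = \<epsilon> / (1 + t\<^sup>2)" 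
      using add_divide_distrib[of "\<epsilon>/2" "\<epsilon>/2" "1 + t\<^sup>2"] by (simp only: field_sum_of_halves)
    finally show "cmod (f t + h t - gauss_poly (P + R) t) \<le> \<epsilon> / (1 + t\<^sup>2)" .
  qed
qed

lemma gauss_poly_limit_cmult:
  assumes "gauss_poly_limit f"
  shows "gauss_poly_limit (\<lambda>t. c * f t)"
  unfolding gauss_poly_limit_def
proof (intro allI impI)
  fix \<epsilon> :: real assume e: "\<epsilon> > 0"
  have p: "cmod c + 1 > 0" by (simp add: add_nonneg_pos)
  then have "\<epsilon> / (cmod c + 1) > 0" using e by simp
  then obtain P where P: "\<And>t. cmod (f t - gauss_poly P t) \<le> (\<epsilon> / (cmod c + 1)) / (1 + t\<^sup>2)"
    using assms unfolding gauss_poly_limit_def by metis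
  show "\<exists>P. \<forall>t. cmod (c * f t - gauss_poly P t) \<le> \<epsilon> / (1 + t\<^sup>2)"
  proof (intro exI[of _ "smult c P"] allI)
    fix t
    have "cmod (c * f t - gauss_poly (smult c P) t) = cmod c * cmod (f t - gauss_poly P t)"
      by (simp add: gauss_poly_smult flip: norm_mult right_diff_distrib)
    also have "\<dots> \<le> (cmod c + 1) * ((\<epsilon> / (cmod c + 1)) / (1 + t\<^sup>2))"
      using P p by (intro mult_mono) auto
    also have "\<dots> = \<epsilon> / (1 + t\<^sup>2)" using p by simp
    finally show "cmod (c * f t - gauss_poly (smult c P) t) \<le> \<epsilon> / (1 + t\<^sup>2)" .
  qed
qed

text \<open>The Taylor polynomials of the exponential converge on the whole line after
  multiplication by the Gaussian: the remainder of order \<open>M\<close> is at most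
  \<open>(1/2) ^ M * exp (3 * \<bar>\<xi> * t\<bar>)\<close>.\<close>

lemma gauss_poly_limit_exp:
  "gauss_poly_limit (\<lambda>t. exp (\<i> * of_real (\<xi> * t)) * of_real (exp (- t\<^sup>2)))"
  unfolding gauss_poly_limit_def
proof (intro allI impI)
  fix \<epsilon> :: real assume e: "\<epsilon> > 0"
  \<comment> \<open>The first summand comes from the Taylor remainder, the second from
    \<open>1 + t^2 \<le> 3 * exp \<bar>t\<bar>\<close>; then
    \<open>b * \<bar>t\<bar> - t^2 \<le> b^2\<close>.\<close>
  define b where "b = 3 * \<bar>\<xi>\<bar> + 1"
  have "(\<lambda>M. (1/2::real) ^ M) \<longlonglongrightarrow> 0" by (rule LIMSEQ_power_zero) simp
  then have "(\<lambda>M. 3 * exp (b\<^sup>2) * (1/2) ^ M) \<longlonglongrightarrow> 0" by (rule tendsto_mult_right_zero)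
  then have "eventually (\<lambda>M. 3 * exp (b\<^sup>2) * (1/2) ^ M < \<epsilon>) sequentially"
    using e by (rule order_tendstoD)
  then obtain M where M: "3 * exp (b\<^sup>2) * (1/2) ^ M < \<epsilon>"
    by (auto simp: eventually_sequentially)
  define P where "P = (\<Sum>m\<le>M. monom ((\<i> * of_real \<xi>) ^ m / fact m) m)"
  show "\<exists>P. \<forall>t. cmod (exp (\<i> * of_real (\<xi> * t)) * of_real (exp (- t\<^sup>2)) - gauss_poly P t) \<le> \<epsilon> / (1 + t\<^sup>2)"
  proof (intro exI[of _ P] allI)
    fix t :: real
    define z where "z = \<i> * complex_of_real (\<xi> * t)"
    define y where "y = \<bar>\<xi>\<bar> * \<bar>t\<bar>"
    have y: "cmod z = y" "y \<ge> 0" by (simp_all add: z_def y_def norm_mult abs_mult)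
    have pP: "poly P (of_real t) = (\<Sum>m\<le>M. z ^ m / fact m)"
      by (simp add: P_def poly_sum poly_monom z_def power_mult_distrib mult_ac)
    have "exp (\<i> * of_real (\<xi> * t)) * of_real (exp (- t\<^sup>2)) - gauss_poly P t
        = (exp z - (\<Sum>m\<le>M. z ^ m / fact m)) * of_real (exp (- t\<^sup>2))"
      by (simp add: gauss_poly_def pP z_def left_diff_distrib)
    then have "cmod (exp (\<i> * of_real (\<xi> * t)) * of_real (exp (- t\<^sup>2)) - gauss_poly P t)
        = cmod (exp z - (\<Sum>m\<le>M. z ^ m / fact m)) * exp (- t\<^sup>2)"
      by (simp only: norm_mult norm_of_real abs_exp_cancel)
    also have "\<dots> \<le> (exp \<bar>Re z\<bar> * cmod z ^ Suc M / fact M) * exp (- t\<^sup>2)"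
      by (intro mult_right_mono Taylor_exp) auto
    also have "exp \<bar>Re z\<bar> * cmod z ^ Suc M / fact M = y * (y ^ M / fact M)"
      by (simp add: y(1)) (simp add: z_def)
    also have "y * (y ^ M / fact M) \<le> exp y * (exp (2 * y) * (1/2) ^ M)"
    proof (rule mult_mono)
      show "y \<le> exp y" using exp_ge_add_one_self[of y] by linarith
      have "(2 * y) ^ M \<le> fact M * exp (2 * y)" using y(2) by (intro power_le_fact_mult_exp) auto
      then show "y ^ M / fact M \<le> exp (2 * y) * (1/2) ^ M"
        by (simp add: power_mult_distrib power_one_over field_simps)
    qed (use y(2) in auto)
    also have "exp y * (exp (2 * y) * (1/2) ^ M) * exp (- t\<^sup>2) = (1/2) ^ M * exp (3 * y - t\<^sup>2)"
    proof -
      have "exp (3 * y - t\<^sup>2) = exp (y + 2 * y + (- t\<^sup>2))" by simp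
      also have "\<dots> = exp y * exp (2 * y) * exp (- t\<^sup>2)" by (simp only: exp_add)
      finally show ?thesis by (simp only: mult_ac)
    qed
    also have "exp (3 * y - t\<^sup>2) \<le> 3 * exp (b\<^sup>2) / (1 + t\<^sup>2)"
    proof -
      have p: "1 + t\<^sup>2 > 0" by (simp add: add_pos_nonneg)
      have "\<bar>t\<bar> ^ 2 \<le> fact 2 * exp \<bar>t\<bar>" by (rule power_le_fact_mult_exp) simp
      moreover have "1 \<le> exp \<bar>t\<bar>" by simp
      ultimately have t3: "1 + t\<^sup>2 \<le> 3 * exp \<bar>t\<bar>" by (simp del: one_le_exp_iff)
      have "0 \<le> (b - \<bar>t\<bar>) ^ 2 + b * \<bar>t\<bar>" by (intro add_nonneg_nonneg mult_nonneg_nonneg) (auto simp: b_def)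
      also have "(b - \<bar>t\<bar>) ^ 2 + b * \<bar>t\<bar> = b\<^sup>2 - b * \<bar>t\<bar> + t\<^sup>2"
        by (simp add: power2_eq_square algebra_simps)
      finally have bt: "b * \<bar>t\<bar> - t\<^sup>2 \<le> b\<^sup>2" by linarith
      have "exp (3 * y - t\<^sup>2) * (1 + t\<^sup>2) \<le> exp (3 * y - t\<^sup>2) * (3 * exp \<bar>t\<bar>)"
        using t3 by (rule mult_left_mono) simp
      also have "\<dots> = 3 * exp (3 * y - t\<^sup>2 + \<bar>t\<bar>)" by (simp only: exp_add mult_ac)
      also have "\<dots> = 3 * exp (b * \<bar>t\<bar> - t\<^sup>2)" by (simp add: b_def y_def algebra_simps)
      also have "\<dots> \<le> 3 * exp (b\<^sup>2)" using bt by simp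
      finally show ?thesis unfolding pos_le_divide_eq[OF p] .
    qed
    also have "(1/2) ^ M * (3 * exp (b\<^sup>2) / (1 + t\<^sup>2)) = (3 * exp (b\<^sup>2) * (1/2) ^ M) / (1 + t\<^sup>2)" by simp
    also have "\<dots> \<le> \<epsilon> / (1 + t\<^sup>2)" using M by (intro divide_right_mono) auto
    finally show "cmod (exp (\<i> * of_real (\<xi> * t)) * of_real (exp (- t\<^sup>2)) - gauss_poly P t) \<le> \<epsilon> / (1 + t\<^sup>2)"
      by (simp add: mult_left_mono mult_right_mono)
  qed
qed

section \<open>Trigonometric polynomials and uniform approximation on the circle\<close>

inductive trig_poly :: "(real \<Rightarrow> complex) \<Rightarrow> bool" where
  exp: "trig_poly (\<lambda>t. exp (\<i> * of_real (\<xi> * t)))"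
| add: "trig_poly f \<Longrightarrow> trig_poly h \<Longrightarrow> trig_poly (\<lambda>t. f t + h t)"
| cmult: "trig_poly f \<Longrightarrow> trig_poly (\<lambda>t. c * f t)"

lemma trig_poly_const: "trig_poly (\<lambda>t. c)"
  using trig_poly.cmult[OF trig_poly.exp[of 0], of c] by simp

lemma trig_poly_mult:
  assumes "trig_poly f" "trig_poly h"
  shows "trig_poly (\<lambda>t. f t * h t)"
  using assms
proof (induction f)
  case (exp \<xi>)
  from exp show ?case
  proof (induction h)
    case (exp \<eta>)
    have "(\<lambda>t. exp (\<i> * of_real (\<xi> * t)) * exp (\<i> * of_real (\<eta> * t)))
        = (\<lambda>t. exp (\<i> * complex_of_real ((\<xi> + \<eta>) * t)))"
      by (simp add: algebra_simps flip: exp_add)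
    then show ?case using trig_poly.exp[of "\<xi> + \<eta>"] by simp
  next
    case (add f h) then show ?case using trig_poly.add by (simp add: distrib_left)
  next
    case (cmult f c) then show ?case using trig_poly.cmult by (simp add: mult.left_commute)
  qed
next
  case (add f1 f2) then show ?case using trig_poly.add by (simp add: distrib_right)
next
  case (cmult f c) then show ?case using trig_poly.cmult by (simp add: mult.assoc)
qed

lemma trig_poly_gauss_limit:
  "trig_poly f \<Longrightarrow> gauss_poly_limit (\<lambda>t. f t * of_real (exp (- t\<^sup>2)))"
proof (induction f rule: trig_poly.induct)
  case (exp \<xi>) show ?case by (rule gauss_poly_limit_exp)
next
  case (add f h) then show ?case by (simp add: distrib_right gauss_poly_limit_add)
next
  case (cmult f c) then show ?case by (simp add: mult.assoc gauss_poly_limit_cmult)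
qed

text \<open>Links the polynomials in the real and imaginary parts, which Stone-Weierstrass provides
  on the unit circle, with combinations of exponentials; the linear case is Euler's formula for
  cosine and sine.\<close>

lemma real_polynomial_function_cis:
  "real_polynomial_function p \<Longrightarrow> trig_poly (\<lambda>t. of_real (p (cis (\<theta> * t))))"
proof (induction p rule: real_polynomial_function.induct)
  case (linear l)
  interpret bounded_linear l by fact
  have "l (cis x) = cos x * l 1 + sin x * l \<i>" for x
  proof -
    have "cis x = cos x *\<^sub>R 1 + sin x *\<^sub>R \<i>" by (simp add: complex_eq_iff)
    then show ?thesis by (simp only: add scaleR real_scaleR_def)
  qed
  moreover have "complex_of_real (cos x) = 1/2 * exp (\<i> * of_real x) + 1/2 * exp (\<i> * of_real (- x))" for x
    by (simp add: complex_eq_iff Re_exp Im_exp)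
  moreover have "complex_of_real (sin x) = (- \<i>/2) * exp (\<i> * of_real x) + (\<i>/2) * exp (\<i> * of_real (- x))" for x
    by (simp add: complex_eq_iff Re_exp Im_exp)
  ultimately have "(\<lambda>t. complex_of_real (l (cis (\<theta> * t))))
      = (\<lambda>t. (1/2 * exp (\<i> * of_real (\<theta> * t)) + 1/2 * exp (\<i> * of_real ((- \<theta>) * t))) * of_real (l 1)
         + ((- \<i>/2) * exp (\<i> * of_real (\<theta> * t)) + (\<i>/2) * exp (\<i> * of_real ((- \<theta>) * t))) * of_real (l \<i>))"
    by simp
  then show ?case
    by (simp only:) (intro trig_poly.intros trig_poly_mult trig_poly_const)
qed (simp_all add: trig_poly_const trig_poly.add trig_poly_mult)

lemma polynomial_function_cis:
  fixes p :: "complex \<Rightarrow> complex"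
  assumes "polynomial_function p"
  shows "trig_poly (\<lambda>t. p (cis (\<theta> * t)))"
proof -
  have "real_polynomial_function (Re \<circ> p)" "real_polynomial_function (Im \<circ> p)"
    using assms bounded_linear_Re bounded_linear_Im unfolding polynomial_function_def by blast+
  then have "trig_poly (\<lambda>t. of_real (Re (p (cis (\<theta> * t)))) + \<i> * of_real (Im (p (cis (\<theta> * t)))))"
    using trig_poly.add[OF _ trig_poly.cmult] real_polynomial_function_cis by (fastforce simp: o_def)
  then show ?thesis by (simp flip: complex_eq)
qed

definition compact_support :: "(real \<Rightarrow> complex) \<Rightarrow> bool" where
  "compact_support f \<longleftrightarrow> continuous_on UNIV f \<and> (\<exists>R. \<forall>t. R \<le> \<bar>t\<bar> \<longrightarrow> f t = 0)"

text \<open>The factor \<open>1 / \<bar>t\<bar>\<close> beyond the inverse-square weight makes the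
  bound small outside a large period. It results from squaring
  \<open>1 + t^2/2 \<le> exp (t^2/2)\<close>.\<close>

lemma exp_minus_square_le:
  fixes t :: real
  assumes "1 \<le> \<bar>t\<bar>"
  shows "exp (- t\<^sup>2) \<le> (4 / \<bar>t\<bar>) / (1 + t\<^sup>2)"
proof -
  have p: "1 + t\<^sup>2 > 0" by (simp add: add_pos_nonneg)
  have "(1 + t\<^sup>2/2)\<^sup>2 \<le> exp (t\<^sup>2/2) ^ 2" by (intro power_mono exp_ge_add_one_self) auto
  also have "exp (t\<^sup>2/2) ^ 2 = exp (t\<^sup>2)" by (simp add: power2_eq_square flip: exp_add)
  finally have "(1 + t\<^sup>2/2)\<^sup>2 \<le> exp (t\<^sup>2)" .
  moreover have "(1 + t\<^sup>2/2)\<^sup>2 = (1 + t\<^sup>2) * (t\<^sup>2 / 4) + (1 + 3/4 * t\<^sup>2)"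
    by (simp add: power2_eq_square field_simps)
  moreover have "\<bar>t\<bar> \<le> t\<^sup>2" 
    using mult_left_mono[OF assms abs_ge_zero[of t]] by (simp add: power2_eq_square)
  then have "(1 + t\<^sup>2) * (\<bar>t\<bar> / 4) \<le> (1 + t\<^sup>2) * (t\<^sup>2 / 4)" using p by (intro mult_left_mono) auto
  moreover have "0 \<le> 1 + 3/4 * t\<^sup>2" by simp
  ultimately have "(1 + t\<^sup>2) * (\<bar>t\<bar> / 4) \<le> exp (t\<^sup>2)" by linarith
  moreover have "0 < (1 + t\<^sup>2) * (\<bar>t\<bar> / 4)" using p assms by (intro mult_pos_pos) auto
  ultimately have "1 / exp (t\<^sup>2) \<le> 1 / ((1 + t\<^sup>2) * (\<bar>t\<bar> / 4))"
    by (intro divide_left_mono) auto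
  then show ?thesis by (simp add: exp_minus inverse_eq_divide mult.commute)
qed

lemma exp_minus_square_le_inverse: "exp (- t\<^sup>2) \<le> 1 / (1 + (t::real)\<^sup>2)"
proof -
  have "1 + t\<^sup>2 \<le> exp (t\<^sup>2)" by (rule exp_ge_add_one_self)
  moreover have "1 + t\<^sup>2 > 0" by (simp add: add_pos_nonneg)
  ultimately show ?thesis by (simp add: exp_minus inverse_eq_divide frac_le)
qed

text \<open>\<open>Arg\<close> jumps only on the negative real axis, and there the function vanishes
  because \<open>R < R'\<close>. The circle is cut at \<open>Re z = c\<close> into two closed arcs:
  on one \<open>Arg\<close> is continuous, on the other the function is 0.\<close>

lemma continuous_on_sphere_Arg:
  fixes F :: "real \<Rightarrow> complex"
  assumes F: "continuous_on UNIV F" and supp: "\<And>t. R \<le> \<bar>t\<bar> \<Longrightarrow> F t = 0"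
    and R: "0 < R" "R < R'"
  shows "continuous_on (sphere 0 1) (\<lambda>z. F (R' * Arg z / pi))"
proof -
  define c where "c = cos (pi * R / R')"
  have x: "0 < pi * R / R'" "pi * R / R' < pi" using R by (auto simp: field_simps)
  have c: "c > -1" unfolding c_def using cos_monotone_0_pi[of "pi * R / R'" pi] x by simp
  let ?h = "\<lambda>z. F (R' * Arg z / pi)"
  let ?S = "sphere (0::complex) 1 \<inter> {z. Re z \<ge> c}" and ?T = "sphere (0::complex) 1 \<inter> {z. Re z \<le> c}"
  have "continuous_on (?S \<union> ?T) ?h"
  proof (rule continuous_on_closed_Un)
    show "closed ?S" "closed ?T"
      by (intro closed_Int closed_sphere closed_halfspace_Re_ge closed_halfspace_Re_le)+
    have nR: "z \<notin> \<real>\<^sub>\<le>\<^sub>0" if "z \<in> ?S" for z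
    proof
      assume "z \<in> \<real>\<^sub>\<le>\<^sub>0"
      then have "Im z = 0" "Re z \<le> 0" by (auto simp: complex_nonpos_Reals_iff)
      moreover have "cmod z = 1" using that by simp
      ultimately have "Re z = -1" by (simp add: cmod_eq_Re)
      then show False using that c by simp
    qed
    have "continuous_on ?S (\<lambda>z. R' * Arg z / pi)"
      using nR by (intro continuous_intros) auto
    then show "continuous_on ?S ?h" by (rule continuous_on_compose2[OF F]) auto
    have "?h z = 0" if "z \<in> ?T" for z
    proof (rule supp, rule ccontr)
      assume "\<not> R \<le> \<bar>R' * Arg z / pi\<bar>"
      then have a: "\<bar>Arg z\<bar> < pi * R / R'" using R by (simp add: abs_mult field_simps)
      have "cmod z = 1" using that by simp
      then have "Re z = cos (Arg z)" using rcis_cmod_Arg[of z] by (metis Re_rcis mult_1)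
      also have "\<dots> = cos \<bar>Arg z\<bar>" by simp
      also have "\<dots> > c" unfolding c_def using a x by (intro cos_monotone_0_pi) auto
      finally show False using that by simp
    qed
    then show "continuous_on ?T ?h" by (subst continuous_on_cong[OF refl, of _ _ "\<lambda>_. 0"]) auto
  qed
  moreover have "?S \<union> ?T = sphere 0 1" by auto
  ultimately show ?thesis by simp
qed

text \<open>Multiplied by \<open>exp (t\<^sup>2)\<close> and made periodic with a large period \<open>2 R'\<close>, the function
  is uniformly close to a trigonometric polynomial whose size does not depend on \<open>R'\<close>; so after
  division by \<open>exp (t\<^sup>2)\<close> the error outside the period is negligible.\<close>

lemma compact_support_gauss_poly_limit:
  assumes "compact_support w"
  shows "gauss_poly_limit w"
  unfolding gauss_poly_limit_def
proof (intro allI impI)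
  fix \<epsilon> :: real assume e: "\<epsilon> > 0"
  have cont: "continuous_on UNIV w" using assms by (simp add: compact_support_def)
  obtain R0 where R0: "\<And>t. R0 \<le> \<bar>t\<bar> \<Longrightarrow> w t = 0" using assms unfolding compact_support_def by blast
  define R where "R = max R0 1"
  have R: "R > 0" "\<And>t. R \<le> \<bar>t\<bar> \<Longrightarrow> w t = 0" using R0 by (auto simp: R_def)
  define F where "F t = w t * of_real (exp (t\<^sup>2))" for t
  have Fc: "continuous_on UNIV F" unfolding F_def[abs_def] by (intro continuous_intros cont)
  have F0: "F t = 0" if "R \<le> \<bar>t\<bar>" for t using R(2)[OF that] by (simp add: F_def)
  have "compact (F ` {-R..R})" by (intro compact_continuous_image continuous_on_subset[OF Fc]) auto
  then obtain K where K: "K > 0" "\<And>t. t \<in> {-R..R} \<Longrightarrow> cmod (F t) \<le> K"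
    using compact_imp_bounded bounded_pos by (metis imageI)
  have FK: "cmod (F t) \<le> K" for t
  proof -
    have "t \<in> {-R..R} \<or> R \<le> \<bar>t\<bar>" by (simp add: abs_if) linarith
    then show ?thesis using K(2)[of t] F0[of t] K(1) by auto
  qed
  define d where "d = min 1 (\<epsilon>/2)"
  have d: "d > 0" "d \<le> 1" "d \<le> \<epsilon>/2" using e by (auto simp: d_def)
  \<comment> \<open>Since \<open>d \<le> 1\<close>, the trigonometric polynomial is bounded by
    \<open>K + 1\<close> for every period; the last term makes
    \<open>(K + 1) * (4 / \<bar>t\<bar>)\<close> at most \<open>\<epsilon>/2\<close> once
    \<open>\<bar>t\<bar> \<ge> R'\<close>.\<close>
  define R' where "R' = max (R + 1) (8 * (K + 1) / \<epsilon>)"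
  have R': "R < R'" "1 \<le> R'" "8 * (K + 1) / \<epsilon> \<le> R'" using R(1) by (auto simp: R'_def)
  let ?h = "\<lambda>z. F (R' * Arg z / pi)"
  have "continuous_on (sphere 0 1) ?h" by (rule continuous_on_sphere_Arg[OF Fc F0 R(1) R'(1)])
  then obtain p where p: "polynomial_function p" "\<And>z. z \<in> sphere 0 1 \<Longrightarrow> cmod (?h z - p z) < d"
    using Stone_Weierstrass_polynomial_function[of "sphere 0 1" ?h d] d(1) by auto
  define Q where "Q t = p (cis ((pi / R') * t))" for t
  have "gauss_poly_limit (\<lambda>t. Q t * of_real (exp (- t\<^sup>2)))"
    unfolding Q_def by (intro trig_poly_gauss_limit polynomial_function_cis p(1))
  then obtain P where P: "\<And>t. cmod (Q t * of_real (exp (- t\<^sup>2)) - gauss_poly P t) \<le> (\<epsilon>/2) / (1 + t\<^sup>2)"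
    using e half_gt_zero unfolding gauss_poly_limit_def by metis
  have Q: "cmod (w t - Q t * of_real (exp (- t\<^sup>2))) \<le> (\<epsilon>/2) / (1 + t\<^sup>2)" for t
  proof (cases "\<bar>t\<bar> < R'")
    case True
    have "\<bar>(pi / R') * t\<bar> < pi" using True R' by (simp add: abs_mult field_simps)
    then have "(pi / R') * t \<in> {- pi<..pi}" unfolding greaterThanAtMost_iff abs_less_iff by linarith
    then have "Arg (cis ((pi / R') * t)) = (pi / R') * t" by (rule Arg_cis)
    then have "?h (cis ((pi / R') * t)) = F t" using R' by simp
    then have "cmod (F t - Q t) \<le> d"
      using p(2)[of "cis ((pi / R') * t)"] by (simp add: Q_def)
    moreover have "w t - Q t * of_real (exp (- t\<^sup>2)) = (F t - Q t) * of_real (exp (- t\<^sup>2))"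
      by (simp add: F_def left_diff_distrib mult.assoc flip: of_real_mult exp_add)
    then have "cmod (w t - Q t * of_real (exp (- t\<^sup>2))) = cmod (F t - Q t) * exp (- t\<^sup>2)"
      by (simp only: norm_mult norm_of_real abs_exp_cancel)
    ultimately have "cmod (w t - Q t * of_real (exp (- t\<^sup>2))) \<le> (\<epsilon>/2) * exp (- t\<^sup>2)"
      using d(3) by (simp add: mult_right_mono)
    also have "\<dots> \<le> (\<epsilon>/2) * (1 / (1 + t\<^sup>2))"
      using e by (intro mult_left_mono exp_minus_square_le_inverse) auto
    finally show ?thesis by simp
  next
    case False
    have t: "R' \<le> \<bar>t\<bar>" "1 \<le> \<bar>t\<bar>" using False R' by auto
    have w0: "w t = 0" using t R' R(2) by simp
    have "cmod (Q t) \<le> K + 1"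
      using p(2)[of "cis ((pi / R') * t)"] FK[of "R' * Arg (cis ((pi / R') * t)) / pi"] d(2)
        norm_triangle_ineq2[of "Q t" "?h (cis ((pi / R') * t))"]
      by (simp add: Q_def norm_minus_commute)
    then have "cmod (w t - Q t * of_real (exp (- t\<^sup>2))) \<le> (K + 1) * exp (- t\<^sup>2)"
      by (simp add: w0 norm_mult mult_right_mono)
    also have "\<dots> \<le> (K + 1) * ((4 / \<bar>t\<bar>) / (1 + t\<^sup>2))"
      using K(1) t by (intro mult_left_mono exp_minus_square_le) auto
    also have "\<dots> = ((K + 1) * (4 / \<bar>t\<bar>)) / (1 + t\<^sup>2)" by simp
    also have "\<dots> \<le> (\<epsilon>/2) / (1 + t\<^sup>2)"
    proof (rule divide_right_mono)
      have "8 * (K + 1) \<le> \<epsilon> * \<bar>t\<bar>"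
        using order_trans[OF R'(3) t(1)] e by (simp add: pos_divide_le_eq mult.commute)
      then show "(K + 1) * (4 / \<bar>t\<bar>) \<le> \<epsilon>/2" using t by (simp add: pos_divide_le_eq)
    qed simp
    finally show ?thesis .
  qed
  show "\<exists>P. \<forall>t. cmod (w t - gauss_poly P t) \<le> \<epsilon> / (1 + t\<^sup>2)"
  proof (intro exI[of _ P] allI)
    fix t
    have "cmod (w t - gauss_poly P t) \<le> cmod (w t - Q t * of_real (exp (- t\<^sup>2)))
        + cmod (Q t * of_real (exp (- t\<^sup>2)) - gauss_poly P t)"
      using norm_triangle_ineq[of "w t - Q t * of_real (exp (- t\<^sup>2))" "Q t * of_real (exp (- t\<^sup>2)) - gauss_poly P t"]
      by simp
    also have "\<dots> \<le> (\<epsilon>/2) / (1 + t\<^sup>2) + (\<epsilon>/2) / (1 + t\<^sup>2)" by (intro add_mono Q P)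
    also have "\<dots> = \<epsilon> / (1 + t\<^sup>2)"
      using add_divide_distrib[of "\<epsilon>/2" "\<epsilon>/2" "1 + t\<^sup>2"] by (simp only: field_sum_of_halves)
    finally show "cmod (w t - gauss_poly P t) \<le> \<epsilon> / (1 + t\<^sup>2)" .
  qed
qed

lemma compact_support_decay:
  assumes "compact_support f"
  shows "f \<in> borel_measurable borel" "\<exists>C\<ge>0. \<forall>t. cmod (f t) \<le> C / (1 + t\<^sup>2)"
proof -
  have cont: "continuous_on UNIV f" using assms by (simp add: compact_support_def)
  then show "f \<in> borel_measurable borel" by (rule borel_measurable_continuous_onI)
  obtain R where R: "\<And>t. R \<le> \<bar>t\<bar> \<Longrightarrow> f t = 0" using assms unfolding compact_support_def by blast
  have cont': "continuous_on UNIV (\<lambda>t. f t * of_real (1 + t\<^sup>2))" by (intro continuous_intros cont)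
  have "compact ((\<lambda>t. f t * of_real (1 + t\<^sup>2)) ` {-\<bar>R\<bar>..\<bar>R\<bar>})"
    by (intro compact_continuous_image continuous_on_subset[OF cont']) auto
  then obtain K where K: "K > 0" "\<forall>y\<in>(\<lambda>t. f t * of_real (1 + t\<^sup>2)) ` {-\<bar>R\<bar>..\<bar>R\<bar>}. norm y \<le> K"
    using compact_imp_bounded bounded_pos by blast
  have "cmod (f t) \<le> K / (1 + t\<^sup>2)" for t
  proof -
    have p: "1 + t\<^sup>2 > 0" by (simp add: add_pos_nonneg)
    have "cmod (f t * of_real (1 + t\<^sup>2)) \<le> K"
    proof -
      have "t \<in> {-\<bar>R\<bar>..\<bar>R\<bar>} \<or> R \<le> \<bar>t\<bar>" by (simp add: abs_if) linarith
      then show ?thesis using K(2) R[of t] K(1) by auto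
    qed
    then have "cmod (f t) * (1 + t\<^sup>2) \<le> K" unfolding norm_mult norm_of_real using p by simp
    then show ?thesis unfolding pos_le_divide_eq[OF p] .
  qed
  then show "\<exists>C\<ge>0. \<forall>t. cmod (f t) \<le> C / (1 + t\<^sup>2)" using K(1) by (meson less_imp_le)
qed

lemma conv_compact_support_in_closure:
  assumes g: "\<And>j. in_closure g (generator_deriv j)" and w: "compact_support w"
  shows "in_closure g (conv (flat_seq 0 1) w)"
proof (rule in_closure_limit)
  fix \<epsilon> :: real assume e: "\<epsilon> > 0"
  define U where "U = (\<Sum>k. \<bar>flat_seq 0 1 k\<bar>)"
  have U: "U \<ge> 0" unfolding U_def by (intro suminf_nonneg summable_abs_flat_seq) auto
  define \<delta> where "\<delta> = \<epsilon> / (U * 4 + 1)"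
  have p: "U * 4 + 1 > 0" using U by simp
  have d: "\<delta> > 0" "\<delta> * (U * 4 + 1) = \<epsilon>" using e p by (simp_all add: \<delta>_def)
  obtain P where P: "\<And>t. cmod (w t - gauss_poly P t) \<le> \<delta> / (1 + t\<^sup>2)"
    using compact_support_gauss_poly_limit[OF w] d(1) unfolding gauss_poly_limit_def by blast
  obtain A where A: "\<And>t. cmod (gauss_poly P t) \<le> A" using gauss_poly_bounded by blast
  have m: "gauss_poly P \<in> borel_measurable borel"
    by (rule borel_measurable_continuous_onI[OF continuous_gauss_poly])
  obtain C where C: "\<And>t. cmod (w t) \<le> C / (1 + t\<^sup>2)" using compact_support_decay(2)[OF w] by blast
  have wC: "cmod (w t) \<le> C" for t
    using sup_L1_leD(2)[OF sup_L1_le_decay[OF compact_support_decay(1)[OF w] C]] .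
  have "sup_L1_le \<delta> (\<delta> * pi) (\<lambda>t. w t - gauss_poly P t)"
    by (rule sup_L1_le_decay[OF _ P]) (intro borel_measurable_diff compact_support_decay(1)[OF w] m)
  then have "sup_L1_le (U * \<delta>) (U * (\<delta> * pi)) (conv (flat_seq 0 1) (\<lambda>t. w t - gauss_poly P t))"
    unfolding U_def by (rule sup_L1_le_conv[OF summable_abs_flat_seq])
  moreover have "conv (flat_seq 0 1) (\<lambda>t. w t - gauss_poly P t)
      = (\<lambda>t. conv (flat_seq 0 1) w t - conv (flat_seq 0 1) (gauss_poly P) t)"
    using conv_diff[where f = w and g = "gauss_poly P", OF summable_abs_flat_seq wC A] by auto
  moreover have "U * \<delta> \<le> \<epsilon>" "U * (\<delta> * pi) \<le> \<epsilon>"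
  proof -
    have "U * (\<delta> * pi) \<le> U * (\<delta> * 4)" using U d(1) pi_less_4 by (intro mult_left_mono) auto
    moreover have "U * \<delta> \<le> U * (\<delta> * 4)" using U d(1) by (intro mult_left_mono) auto
    moreover have "U * (\<delta> * 4) + \<delta> = \<epsilon>" using d(2) by (simp add: algebra_simps)
    ultimately show "U * \<delta> \<le> \<epsilon>" "U * (\<delta> * pi) \<le> \<epsilon>" using d(1) by linarith+
  qed
  ultimately have "sup_L1_le \<epsilon> \<epsilon> (\<lambda>t. conv (flat_seq 0 1) w t - conv (flat_seq 0 1) (gauss_poly P) t)"
    using sup_L1_le_mono by auto
  then show "\<exists>h. in_closure g h \<and> sup_L1_le \<epsilon> \<epsilon> (\<lambda>t. conv (flat_seq 0 1) w t - h t)"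
    using conv_gauss_poly_in_closure[OF g] by blast
qed

section \<open>The closed span in the Lebesgue spaces\<close>

text \<open>Bounds the \<open>p\<close>-th power of the norm. The crude constant
  \<open>2 powr p\<close> for sums is enough, since only closure under sums and limits is
  wanted.\<close>

definition Lp_int_le :: "real \<Rightarrow> real \<Rightarrow> (real \<Rightarrow> complex) \<Rightarrow> bool" where
  "Lp_int_le p B f \<longleftrightarrow> f \<in> borel_measurable lebesgue \<and> integrable lebesgue (\<lambda>t. cmod (f t) powr p) \<and>
     (LINT t|lebesgue. cmod (f t) powr p) \<le> B"

lemma Lp_int_le_mono: "Lp_int_le p B f \<Longrightarrow> B \<le> B' \<Longrightarrow> Lp_int_le p B' f"
  unfolding Lp_int_le_def by auto

lemma powr_add_le:
  assumes "0 \<le> a" "0 \<le> b" "0 < (p::real)"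
  shows "(a + b) powr p \<le> 2 powr p * (a powr p + b powr p)"
proof -
  have "(a + b) powr p \<le> (2 * max a b) powr p" using assms by (intro powr_mono2) auto
  also have "\<dots> = 2 powr p * max a b powr p" using assms by (simp add: powr_mult)
  also have "max a b powr p \<le> a powr p + b powr p" by (simp add: max_def)
  finally show ?thesis by (simp add: mult_left_mono)
qed

lemma Lp_int_le_add:
  assumes p: "p > 0" and f: "Lp_int_le p A f" and h: "Lp_int_le p B h"
  shows "Lp_int_le p (2 powr p * (A + B)) (\<lambda>t. f t + h t)"
  unfolding Lp_int_le_def
proof (intro conjI)
  have m: "f \<in> borel_measurable lebesgue" "h \<in> borel_measurable lebesgue"
    and i: "integrable lebesgue (\<lambda>t. cmod (f t) powr p)" "integrable lebesgue (\<lambda>t. cmod (h t) powr p)"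
    and b: "(LINT t|lebesgue. cmod (f t) powr p) \<le> A" "(LINT t|lebesgue. cmod (h t) powr p) \<le> B"
    using f h by (auto simp: Lp_int_le_def)
  show mf: "(\<lambda>t. f t + h t) \<in> borel_measurable lebesgue" using m by (rule borel_measurable_add)
  have i2: "integrable lebesgue (\<lambda>t. 2 powr p * (cmod (f t) powr p + cmod (h t) powr p))"
    using i by simp
  have le: "cmod (f t + h t) powr p \<le> 2 powr p * (cmod (f t) powr p + cmod (h t) powr p)" for t
  proof -
    have "cmod (f t + h t) powr p \<le> (cmod (f t) + cmod (h t)) powr p"
      using p by (intro powr_mono2 norm_triangle_ineq) auto
    also have "\<dots> \<le> 2 powr p * (cmod (f t) powr p + cmod (h t) powr p)"
      using p by (intro powr_add_le) auto
    finally show ?thesis .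
  qed
  show i3: "integrable lebesgue (\<lambda>t. cmod (f t + h t) powr p)"
  proof (rule Bochner_Integration.integrable_bound[OF i2])
    show "(\<lambda>t. cmod (f t + h t) powr p) \<in> borel_measurable lebesgue" using mf by measurable
    show "AE t in lebesgue. norm (cmod (f t + h t) powr p) \<le> norm (2 powr p * (cmod (f t) powr p + cmod (h t) powr p))"
      using le by (intro AE_I2) (simp add: abs_of_nonneg)
  qed
  have "(LINT t|lebesgue. cmod (f t + h t) powr p)
      \<le> (LINT t|lebesgue. 2 powr p * (cmod (f t) powr p + cmod (h t) powr p))"
    by (intro integral_mono i2 i3 le)
  also have "\<dots> = 2 powr p * ((LINT t|lebesgue. cmod (f t) powr p) + (LINT t|lebesgue. cmod (h t) powr p))"
    using i by simp
  also have "\<dots> \<le> 2 powr p * (A + B)" using b by (intro mult_left_mono) auto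
  finally show "(LINT t|lebesgue. cmod (f t + h t) powr p) \<le> 2 powr p * (A + B)" .
qed

lemma Lp_int_le_cmult:
  assumes "Lp_int_le p A f"
  shows "Lp_int_le p (cmod c powr p * A) (\<lambda>t. c * f t)"
  using assms unfolding Lp_int_le_def
  by (auto simp: norm_mult powr_mult intro!: mult_left_mono borel_measurable_times)

lemma Lp_int_le_of_sup_L1:
  assumes p: "p > 1" and f: "sup_L1_le A B f"
  shows "Lp_int_le p (A powr (p - 1) * B) f"
proof -
  note f' = sup_L1_leD[OF f]
  have le: "cmod (f t) powr p \<le> A powr (p - 1) * cmod (f t)" for t
  proof -
    have "cmod (f t) powr p = cmod (f t) powr (p - 1) * cmod (f t)"
      using powr_add[of "cmod (f t)" "p - 1" 1] by simp
    also have "\<dots> \<le> A powr (p - 1) * cmod (f t)"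
      using p f'(2) by (intro mult_right_mono powr_mono2) auto
    finally show ?thesis .
  qed
  have m: "(\<lambda>t. cmod (f t) powr p) \<in> borel_measurable lborel" using f'(1) by simp
  have i2: "integrable lborel (\<lambda>t. A powr (p - 1) * cmod (f t))" using f'(3) by simp
  have i3: "integrable lborel (\<lambda>t. cmod (f t) powr p)"
    by (rule Bochner_Integration.integrable_bound[OF i2 m]) (use le in \<open>simp add: abs_of_nonneg\<close>)
  have "(LINT t|lborel. cmod (f t) powr p) \<le> (LINT t|lborel. A powr (p - 1) * cmod (f t))"
    by (intro integral_mono i2 i3 le)
  also have "\<dots> \<le> A powr (p - 1) * B" using f'(4) by (simp add: mult_left_mono)
  finally have "(LINT t|lborel. cmod (f t) powr p) \<le> A powr (p - 1) * B" .
  then show ?thesis unfolding Lp_int_le_def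
    using f'(1) i3 m by (simp add: integral_completion measurable_completion integrable_completion)
qed

definition in_Lp_closure :: "real \<Rightarrow> (int \<Rightarrow> real \<Rightarrow> complex) \<Rightarrow> (real \<Rightarrow> complex) \<Rightarrow> bool" where
  "in_Lp_closure p g f \<longleftrightarrow> (\<forall>\<epsilon>>0. \<exists>v. finite_comb g v \<and> Lp_int_le p \<epsilon> (\<lambda>t. f t - v t))"

lemma in_Lp_closure_add:
  assumes p: "p > 0" and "in_Lp_closure p g f" "in_Lp_closure p g h"
  shows "in_Lp_closure p g (\<lambda>t. f t + h t)"
  unfolding in_Lp_closure_def
proof (intro allI impI)
  fix \<epsilon> :: real assume e: "\<epsilon> > 0"
  define \<delta> where "\<delta> = \<epsilon> / (2 powr p * 2)"
  have d: "\<delta> > 0" "2 powr p * (\<delta> + \<delta>) = \<epsilon>" using e by (simp_all add: \<delta>_def)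
  obtain v where v: "finite_comb g v" "Lp_int_le p \<delta> (\<lambda>t. f t - v t)"
    using assms(2) d(1) unfolding in_Lp_closure_def by blast
  obtain w where w: "finite_comb g w" "Lp_int_le p \<delta> (\<lambda>t. h t - w t)"
    using assms(3) d(1) unfolding in_Lp_closure_def by blast
  have "(\<lambda>t. f t - v t + (h t - w t)) = (\<lambda>t. f t + h t - (v t + w t))" by auto
  then show "\<exists>v. finite_comb g v \<and> Lp_int_le p \<epsilon> (\<lambda>t. f t + h t - v t)"
    using finite_comb_add[OF v(1) w(1)] Lp_int_le_add[OF p v(2) w(2)] d(2) by auto
qed

lemma in_Lp_closure_cmult:
  assumes "in_Lp_closure p g f"
  shows "in_Lp_closure p g (\<lambda>t. c * f t)"
  unfolding in_Lp_closure_def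
proof (intro allI impI)
  fix \<epsilon> :: real assume e: "\<epsilon> > 0"
  have q: "cmod c powr p + 1 > 0" by (simp add: add_nonneg_pos)
  define \<delta> where "\<delta> = \<epsilon> / (cmod c powr p + 1)"
  have d: "\<delta> > 0" "\<delta> * (cmod c powr p + 1) = \<epsilon>" using e q by (simp_all add: \<delta>_def)
  obtain v where v: "finite_comb g v" "Lp_int_le p \<delta> (\<lambda>t. f t - v t)"
    using assms d(1) unfolding in_Lp_closure_def by blast
  have "cmod c powr p * \<delta> \<le> \<epsilon>" using d by (simp add: algebra_simps)
  then have "Lp_int_le p \<epsilon> (\<lambda>t. c * f t - c * v t)"
    using Lp_int_le_mono[OF Lp_int_le_cmult[OF v(2), of c]] by (simp add: right_diff_distrib)
  then show "\<exists>v. finite_comb g v \<and> Lp_int_le p \<epsilon> (\<lambda>t. c * f t - v t)"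
    using finite_comb_cmult[OF v(1)] by blast
qed

lemma in_Lp_closure_limit:
  assumes p: "p > 0" and "\<And>\<epsilon>. \<epsilon> > 0 \<Longrightarrow> \<exists>h. in_Lp_closure p g h \<and> Lp_int_le p \<epsilon> (\<lambda>t. f t - h t)"
  shows "in_Lp_closure p g f"
  unfolding in_Lp_closure_def
proof (intro allI impI)
  fix \<epsilon> :: real assume e: "\<epsilon> > 0"
  define \<delta> where "\<delta> = \<epsilon> / (2 powr p * 2)"
  have d: "\<delta> > 0" "2 powr p * (\<delta> + \<delta>) = \<epsilon>" using e by (simp_all add: \<delta>_def)
  obtain h where h: "in_Lp_closure p g h" "Lp_int_le p \<delta> (\<lambda>t. f t - h t)"
    using assms(2) d(1) by blast
  obtain v where v: "finite_comb g v" "Lp_int_le p \<delta> (\<lambda>t. h t - v t)"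
    using h(1) d(1) unfolding in_Lp_closure_def by blast
  show "\<exists>v. finite_comb g v \<and> Lp_int_le p \<epsilon> (\<lambda>t. f t - v t)"
    using v(1) Lp_int_le_add[OF p h(2) v(2)] d(2) by auto
qed

text \<open>This is why \<open>p > 1\<close> is needed: errors that are uniformly small but
  merely bounded in \<open>L\<^sup>1\<close> are negligible.\<close>

lemma in_Lp_closure_limit_sup:
  assumes p: "p > 1"
    and h: "\<And>\<delta>. \<delta> > 0 \<Longrightarrow> \<exists>h. in_Lp_closure p g h \<and> sup_L1_le \<delta> B (\<lambda>t. f t - h t)"
  shows "in_Lp_closure p g f"
proof (rule in_Lp_closure_limit)
  fix \<epsilon> :: real assume e: "\<epsilon> > 0"
  have B: "B \<ge> 0" using h[of 1] sup_L1_leD(6) by force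
  define \<delta> where "\<delta> = (\<epsilon> / (B + 1)) powr (1 / (p - 1))"
  have d: "\<delta> > 0" using e B by (simp add: \<delta>_def)
  have "\<delta> powr (p - 1) = \<epsilon> / (B + 1)" using p e B by (simp add: \<delta>_def powr_powr)
  then have "\<delta> powr (p - 1) * B \<le> \<epsilon>" using e B by (simp add: pos_divide_le_eq mult_left_mono)
  moreover obtain h where "in_Lp_closure p g h" "sup_L1_le \<delta> B (\<lambda>t. f t - h t)" using h d by blast
  ultimately show "\<exists>h. in_Lp_closure p g h \<and> Lp_int_le p \<epsilon> (\<lambda>t. f t - h t)"
    using Lp_int_le_mono[OF Lp_int_le_of_sup_L1[OF p]] by blast
qed (use p in simp)

lemma in_closure_imp_in_Lp_closure:
  assumes p: "p > 1" and "in_closure g f"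
  shows "in_Lp_closure p g f"
  unfolding in_Lp_closure_def
proof (intro allI impI)
  fix \<epsilon> :: real assume e: "\<epsilon> > 0"
  define \<delta> where "\<delta> = \<epsilon> powr (1 / p)"
  have d: "\<delta> > 0" using e by (simp add: \<delta>_def)
  have "\<delta> powr (p - 1) * \<delta> = \<delta> powr p" using d powr_add[of \<delta> "p - 1" 1] by simp
  also have "\<dots> = \<epsilon>" using p e by (simp add: \<delta>_def powr_powr)
  finally have de: "\<delta> powr (p - 1) * \<delta> = \<epsilon>" .
  obtain v where v: "finite_comb g v" "sup_L1_le \<delta> \<delta> (\<lambda>t. f t - v t)"
    using assms(2) d unfolding in_closure_def near_span_def by blast
  show "\<exists>v. finite_comb g v \<and> Lp_int_le p \<epsilon> (\<lambda>t. f t - v t)"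
    using v(1) Lp_int_le_of_sup_L1[OF p v(2)] unfolding de by blast
qed

section \<open>Compactly supported functions and averages over translates\<close>

lemma compact_support_cmult: "compact_support f \<Longrightarrow> compact_support (\<lambda>t. c * f t)"
  unfolding compact_support_def by (auto intro!: continuous_intros)

lemma compact_support_add:
  assumes "compact_support f" "compact_support h"
  shows "compact_support (\<lambda>t. f t + h t)"
proof -
  obtain R R' where "\<And>t. R \<le> \<bar>t\<bar> \<Longrightarrow> f t = 0" "\<And>t. R' \<le> \<bar>t\<bar> \<Longrightarrow> h t = 0"
    using assms unfolding compact_support_def by blast
  then have "\<forall>t. max R R' \<le> \<bar>t\<bar> \<longrightarrow> f t + h t = 0" by auto
  moreover have "continuous_on UNIV (\<lambda>t. f t + h t)"
    using assms unfolding compact_support_def by (intro continuous_intros) auto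
  ultimately show ?thesis unfolding compact_support_def by blast
qed

lemma compact_support_zero: "compact_support (\<lambda>t. 0)"
  by (simp add: compact_support_def)

lemma compact_support_sum:
  "(\<And>i. i \<in> I \<Longrightarrow> compact_support (f i)) \<Longrightarrow> compact_support (\<lambda>t. \<Sum>i\<in>I. f i t)"
  by (induction I rule: infinite_finite_induct) (simp_all add: compact_support_zero compact_support_add)

lemma compact_support_translate:
  assumes "compact_support f"
  shows "compact_support (\<lambda>t. f (t - x))"
proof -
  obtain R where R: "\<And>t. R \<le> \<bar>t\<bar> \<Longrightarrow> f t = 0" using assms unfolding compact_support_def by blast
  have "f (t - x) = 0" if "R + \<bar>x\<bar> \<le> \<bar>t\<bar>" for t
    by (rule R) (use that in linarith)
  moreover have "continuous_on UNIV f" using assms by (simp add: compact_support_def)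
  then have "continuous_on UNIV (\<lambda>t. f (t - x))"
    by (rule continuous_on_compose2) (auto intro!: continuous_intros)
  ultimately show ?thesis unfolding compact_support_def by blast
qed

lemma compact_support_fun_diff:
  "compact_support f \<Longrightarrow> compact_support (fun_diff f)"
  using compact_support_add[OF _ compact_support_cmult[OF compact_support_translate[of f 1], of "-1"], of f]
  by (simp add: fun_diff_def[abs_def])

lemma compact_support_bounded: "compact_support f \<Longrightarrow> \<exists>C. \<forall>t. cmod (f t) \<le> C"
  using compact_support_decay[of f] sup_L1_leD(2)[OF sup_L1_le_decay] by metis

text \<open>Telescoping: with \<open>S\<close> the unit shift, \<open>1 - S ^ i\<close> is
  \<open>X\<close> times \<open>\<Sum>j<i. S ^ j\<close>, and this is averaged over
  \<open>i < L\<close>. The function under \<open>fun_diff\<close> has compact support if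
  \<open>f\<close> has.\<close>

lemma sub_average_eq_fun_diff:
  assumes "L > 0"
  shows "f t - (1 / of_nat L) * (\<Sum>i<L. f (t - real i))
    = fun_diff (\<lambda>t. (1 / of_nat L) * (\<Sum>i<L. \<Sum>j<i. f (t - real j))) t"
proof -
  have tel: "(\<Sum>j<i. f (t - real j)) - (\<Sum>j<i. f (t - 1 - real j)) = f t - f (t - real i)" for i
  proof -
    have "(\<Sum>j<i. f (t - real j) - f (t - real (Suc j))) = f (t - real 0) - f (t - real i)"
      by (rule sum_lessThan_telescope')
    then show ?thesis by (simp add: sum_subtractf algebra_simps)
  qed
  have "fun_diff (\<lambda>t. (1 / of_nat L) * (\<Sum>i<L. \<Sum>j<i. f (t - real j))) t
      = (1 / of_nat L) * (\<Sum>i<L. (\<Sum>j<i. f (t - real j)) - (\<Sum>j<i. f (t - 1 - real j)))"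
    by (simp add: fun_diff_def sum_subtractf right_diff_distrib)
  also have "\<dots> = (1 / of_nat L) * (\<Sum>i<L. f t - f (t - real i))" unfolding tel ..
  also have "\<dots> = f t - (1 / of_nat L) * (\<Sum>i<L. f (t - real i))"
    using assms by (simp add: sum_subtractf right_diff_distrib)
  finally show ?thesis by simp
qed

lemma sup_L1_le_sup: "sup_L1_le A B f \<Longrightarrow> (\<And>t. cmod (f t) \<le> A') \<Longrightarrow> sup_L1_le A' B f"
  unfolding sup_L1_le_def by blast

lemma compact_support_sup_L1:
  assumes "compact_support f"
  shows "\<exists>A B. sup_L1_le A B f"
  using compact_support_decay[OF assms] sup_L1_le_decay by blast

text \<open>The translates spread out, so \<open>conv_sup_le\<close> with the constant coefficients
  \<open>1 / L\<close> makes the sup norm decrease like \<open>1 / L\<close>, while the L1 norm is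
  only known to stay bounded.\<close>

lemma average_sup_L1_le:
  assumes f: "compact_support f"
  shows "\<exists>K B. \<forall>L>0. sup_L1_le (K / real L) B (\<lambda>t. (1 / of_nat L) * (\<Sum>i<L. f (t - real i)))"
proof -
  obtain C where C: "\<And>t. cmod (f t) \<le> C / (1 + t\<^sup>2)" using compact_support_decay(2)[OF f] by blast
  obtain A B where B: "sup_L1_le A B f" using compact_support_sup_L1[OF f] by blast
  show ?thesis
  proof (intro exI allI impI)
    fix L :: nat assume L: "L > 0"
    define a where "a k = (if k < L then 1 / real L else 0)" for k
    have a: "summable (\<lambda>k. \<bar>a k\<bar>)" by (rule summable_finite[of "{..<L}"]) (auto simp: a_def)
    have conv: "conv a f t = (1 / of_nat L) * (\<Sum>i<L. f (t - real i))" for t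
    proof -
      have "conv a f t = (\<Sum>k<L. a k *\<^sub>R f (t - real k))"
        unfolding conv_def by (rule suminf_finite) (auto simp: a_def)
      also have "\<dots> = (\<Sum>k<L. (1 / of_nat L) * f (t - real k))"
        by (intro sum.cong) (auto simp: a_def scaleR_conv_of_real)
      finally show ?thesis by (simp add: sum_distrib_left)
    qed
    have "sup_L1_le (cmod (1 / of_nat L) * (\<Sum>i<L. A)) (cmod (1 / of_nat L) * (\<Sum>i<L. B))
       (\<lambda>t. (1 / of_nat L) * (\<Sum>i<L. f (t - real i)))"
      by (intro sup_L1_le_cmult sup_L1_le_sum sup_L1_le_translate B)
    then have "sup_L1_le A B (\<lambda>t. (1 / of_nat L) * (\<Sum>i<L. f (t - real i)))"
      using L by (simp add: norm_divide)
    then show "sup_L1_le (4 * int_square_sum * C / real L) B (\<lambda>t. (1 / of_nat L) * (\<Sum>i<L. f (t - real i)))"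
    proof (rule sup_L1_le_sup)
      show "cmod ((1 / of_nat L) * (\<Sum>i<L. f (t - real i))) \<le> 4 * int_square_sum * C / real L" for t
        using conv_sup_le[OF a _ C, of "1 / real L" t] unfolding conv by (auto simp: a_def)
    qed
  qed
qed

text \<open>The relation \<open>(X + 2^(-s)) flat_seq s 1 = 2 X flat_seq (s + 1) 1\<close> allows one to pass from \<open>s\<close> to
  \<open>s + 1\<close> on functions in the range of \<open>X\<close>, and \<open>f\<close> minus its average over many translates is such
  a function. For large \<open>s\<close> the sequence \<open>2^s X flat_seq s 1\<close> is close to a multiple of the unit.\<close>

lemma conv_flat_seq_in_Lp_closure:
  assumes p: "p > 1" and g: "\<And>j. in_closure g (generator_deriv j)" and f: "compact_support f"
  shows "in_Lp_closure p g (conv (flat_seq s 1) f)"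
  using f
proof (induction s arbitrary: f)
  case 0
  show ?case
    by (rule in_closure_imp_in_Lp_closure[OF p conv_compact_support_in_closure[OF g 0]])
next
  case (Suc s)
  let ?u = "flat_seq (Suc s) 1"
  have diff: "in_Lp_closure p g (conv ?u (fun_diff h))" if h: "compact_support h" for h
  proof -
    obtain A where A: "\<And>t. cmod (h t) \<le> A" using compact_support_bounded[OF h] by blast
    have "conv ?u (fun_diff h) t
        = (1/2) * (conv (flat_seq s 1) (fun_diff h) t + of_real ((1/2) ^ s) * conv (flat_seq s 1) h t)" for t
    proof -
      note sm = summable_conv[where f = h, OF _ A]
      have "conv (flat_seq s 1) (fun_diff h) t + of_real ((1/2) ^ s) * conv (flat_seq s 1) h t
          = conv (seq_diff (flat_seq s 1)) h t + (1/2) ^ s *\<^sub>R conv (flat_seq s 1) h t"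
        using conv_fun_diff[where f = h, OF summable_abs_flat_seq A]
          conv_seq_diff[where f = h, OF summable_abs_flat_seq A]
        by (simp add: scaleR_conv_of_real)
      also have "\<dots> = (\<Sum>k. seq_diff (flat_seq s 1) k *\<^sub>R h (t - real k)
          + (1/2) ^ s *\<^sub>R (flat_seq s 1 k *\<^sub>R h (t - real k)))"
        unfolding conv_def
        by (subst suminf_add[symmetric])
           (auto simp only: suminf_scaleR_right[OF sm[OF summable_abs_flat_seq]]
              intro!: summable_scaleR_right sm summable_seq_diff summable_abs_flat_seq)
      also have "\<dots> = (\<Sum>k. 2 *\<^sub>R (seq_diff ?u k *\<^sub>R h (t - real k)))"
      proof (intro arg_cong[where f = suminf] ext)
        fix k
        have "seq_diff (flat_seq s 1) k *\<^sub>R h (t - real k) + (1/2) ^ s *\<^sub>R (flat_seq s 1 k *\<^sub>R h (t - real k))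
            = (seq_diff (flat_seq s 1) k + (1/2) ^ s * flat_seq s 1 k) *\<^sub>R h (t - real k)"
          by (simp only: scaleR_add_left scaleR_scaleR)
        then show "seq_diff (flat_seq s 1) k *\<^sub>R h (t - real k) + (1/2) ^ s *\<^sub>R (flat_seq s 1 k *\<^sub>R h (t - real k))
            = 2 *\<^sub>R (seq_diff ?u k *\<^sub>R h (t - real k))"
          unfolding seq_diff_add_flat_seq by (simp only: scaleR_scaleR)
      qed
      also have "\<dots> = 2 *\<^sub>R conv (seq_diff ?u) h t"
        unfolding conv_def
        by (rule suminf_scaleR_right[symmetric, OF sm[OF summable_seq_diff[OF summable_abs_flat_seq]]])
      also have "conv (seq_diff ?u) h t = conv ?u (fun_diff h) t"
        using conv_fun_diff[where f = h, OF summable_abs_flat_seq A]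
          conv_seq_diff[where f = h, OF summable_abs_flat_seq A] by simp
      finally show ?thesis by (simp add: scaleR_conv_of_real)
    qed
    moreover have "in_Lp_closure p g (\<lambda>t. (1/2) * (conv (flat_seq s 1) (fun_diff h) t
        + of_real ((1/2) ^ s) * conv (flat_seq s 1) h t))"
      using p by (intro in_Lp_closure_cmult in_Lp_closure_add Suc.IH compact_support_fun_diff h) auto
    ultimately show ?thesis by presburger
  qed
  define U where "U = (\<Sum>k. \<bar>?u k\<bar>)"
  obtain K B where K: "\<And>L. L > 0 \<Longrightarrow> sup_L1_le (K / real L) B (\<lambda>t. (1 / of_nat L) * (\<Sum>i<L. f (t - real i)))"
    using average_sup_L1_le[OF Suc.prems] by blast
  show ?case
  \<comment> \<open>The L1 bound \<open>U * B\<close> is independent of \<open>L\<close>; only the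
    sup bound tends to 0 as \<open>L\<close> grows.\<close>
  proof (rule in_Lp_closure_limit_sup[OF p, where B = "U * B"])
    fix \<delta> :: real assume d: "\<delta> > 0"
    obtain L :: nat where "U * K / \<delta> < real L \<and> 0 < real L"
      using reals_Archimedean2[of "max 0 (U * K / \<delta>)"] by (meson max_less_iff_conj)
    then have L: "L > 0" "U * (K / real L) \<le> \<delta>" using d by (auto simp: field_simps)
    define h where "h t = (1 / of_nat L) * (\<Sum>i<L. \<Sum>j<i. f (t - real j))" for t
    have h: "compact_support h"
      unfolding h_def[abs_def]
      by (intro compact_support_cmult compact_support_sum compact_support_translate Suc.prems)
    have "fun_diff h t = f t - (1 / of_nat L) * (\<Sum>i<L. f (t - real i))" for t
      unfolding h_def[abs_def] by (rule sub_average_eq_fun_diff[OF L(1), symmetric])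
    then have "(\<lambda>t. f t - fun_diff h t) = (\<lambda>t. (1 / of_nat L) * (\<Sum>i<L. f (t - real i)))"
      by (intro ext) (simp only: diff_diff_eq2 add_diff_cancel_left')
    with K[OF L(1)] have av: "sup_L1_le (K / real L) B (\<lambda>t. f t - fun_diff h t)" by (simp only:)
    obtain A where A: "\<And>t. cmod (f t) \<le> A" using compact_support_bounded[OF Suc.prems] by blast
    obtain A' where A': "\<And>t. cmod (fun_diff h t) \<le> A'"
      using compact_support_bounded[OF compact_support_fun_diff[OF h]] by blast
    have "sup_L1_le (U * (K / real L)) (U * B) (conv ?u (\<lambda>t. f t - fun_diff h t))"
      unfolding U_def by (rule sup_L1_le_conv[OF summable_abs_flat_seq av])
    moreover have "conv ?u (\<lambda>t. f t - fun_diff h t) = (\<lambda>t. conv ?u f t - conv ?u (fun_diff h) t)"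
      using conv_diff[where f = f and g = "fun_diff h", OF summable_abs_flat_seq A A'] by auto
    ultimately have "sup_L1_le \<delta> (U * B) (\<lambda>t. conv ?u f t - conv ?u (fun_diff h) t)"
      using sup_L1_le_mono[OF _ L(2) order_refl] by simp
    then show "\<exists>h. in_Lp_closure p g h \<and> sup_L1_le \<delta> (U * B) (\<lambda>t. conv ?u f t - h t)"
      using diff[OF h] by blast
  qed
qed

text \<open>\<open>seq_diff_flat_seq\<close> is solved for the unit: \<open>\<kappa> f\<close> is
  \<open>2 ^ M\<close> times the convolution of \<open>flat_seq M 1\<close> with \<open>X f\<close>,
  plus the convolution of \<open>flat_seq M (1/2)\<close> with \<open>f\<close>. The first lies in
  the closed span; the second is \<open>O((1/2) ^ M)\<close> uniformly and bounded in L1, hence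
  negligible.\<close>

lemma compact_support_in_Lp_closure:
  assumes p: "p > 1" and g: "\<And>j. in_closure g (generator_deriv j)" and f: "compact_support f"
  shows "in_Lp_closure p g f"
proof -
  define \<kappa> where "\<kappa> = euler_fun (1/2)"
  have \<kappa>: "\<kappa> \<noteq> 0" unfolding \<kappa>_def by (rule euler_fun_half)
  define E where "E = abs_euler (1/2)"
  have E: "E \<ge> 0" unfolding E_def by (rule abs_euler_nonneg)
  obtain C where C: "\<And>t. cmod (f t) \<le> C / (1 + t\<^sup>2)" using compact_support_decay(2)[OF f] by blast
  obtain A B where B: "sup_L1_le A B f" using compact_support_sup_L1[OF f] by blast
  note fA = sup_L1_leD(2)[OF B]
  show ?thesis
  proof (rule in_Lp_closure_limit_sup[OF p, where B = "cmod (1 / of_real \<kappa>) * (E * B)"])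
    fix \<delta> :: real assume d: "\<delta> > 0"
    have "(\<lambda>M. (1/2::real) ^ M) \<longlonglongrightarrow> 0" by (rule LIMSEQ_power_zero) simp
    then have "(\<lambda>M. (cmod (1 / of_real \<kappa>) * (4 * int_square_sum * C * E)) * (1/2) ^ M) \<longlonglongrightarrow> 0" by (rule tendsto_mult_right_zero)
    then have "eventually (\<lambda>M. (cmod (1 / of_real \<kappa>) * (4 * int_square_sum * C * E)) * (1/2) ^ M < \<delta>) sequentially"
      using d by (rule order_tendstoD)
    then obtain M where M: "(cmod (1 / of_real \<kappa>) * (4 * int_square_sum * C * E)) * (1/2) ^ M < \<delta>"
      by (auto simp: eventually_sequentially)
    let ?z = "flat_seq M (1/2)"
    have z: "sup_L1_le (4 * int_square_sum * C * ((1/2) ^ M * E)) (E * B) (conv ?z f)"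
    proof (rule sup_L1_le_sup)
      have "sup_L1_le ((\<Sum>k. \<bar>?z k\<bar>) * A) ((\<Sum>k. \<bar>?z k\<bar>) * B) (conv ?z f)"
        by (rule sup_L1_le_conv[OF summable_abs_flat_seq B])
      then show "sup_L1_le ((\<Sum>k. \<bar>?z k\<bar>) * A) (E * B) (conv ?z f)"
        using sup_L1_leD(6)[OF B] suminf_abs_flat_seq_le[of M "1/2"]
        by (elim sup_L1_le_mono) (auto simp: E_def intro: mult_right_mono)
      show "cmod (conv ?z f t) \<le> 4 * int_square_sum * C * ((1/2) ^ M * E)" for t
        by (rule conv_sup_le[OF summable_abs_flat_seq _ C]) (unfold E_def, rule flat_seq_sup)
    qed
    have "conv (flat_seq M 1) (fun_diff f) t = of_real ((1/2) ^ M) * (of_real \<kappa> * f t - conv ?z f t)" for t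
    proof -
      have s1: "summable (\<lambda>k. (if k = 0 then \<kappa> else 0) *\<^sub>R f (t - real k))"
        by (rule summable_finite[of "{0}"]) auto
      have s2: "summable (\<lambda>k. ?z k *\<^sub>R f (t - real k))"
        by (rule summable_conv[where f = f, OF summable_abs_flat_seq fA])
      have "conv (flat_seq M 1) (fun_diff f) t = conv (seq_diff (flat_seq M 1)) f t"
        using conv_fun_diff[where f = f, OF summable_abs_flat_seq fA]
          conv_seq_diff[where f = f, OF summable_abs_flat_seq fA] by simp
      also have "\<dots> = (\<Sum>k. (1/2) ^ M *\<^sub>R ((if k = 0 then \<kappa> else 0) *\<^sub>R f (t - real k) - ?z k *\<^sub>R f (t - real k)))"
        unfolding conv_def seq_diff_flat_seq \<kappa>_def[symmetric]
        by (simp only: scaleR_diff_left scaleR_diff_right scaleR_scaleR right_diff_distrib)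
      also have "\<dots> = (1/2) ^ M *\<^sub>R ((\<Sum>k. (if k = 0 then \<kappa> else 0) *\<^sub>R f (t - real k)) - conv ?z f t)"
        unfolding conv_def by (subst suminf_diff[OF s1 s2]) (rule suminf_scaleR_right[symmetric, OF summable_diff[OF s1 s2]])
      also have "(\<Sum>k. (if k = 0 then \<kappa> else 0) *\<^sub>R f (t - real k)) = of_real \<kappa> * f t"
        by (subst suminf_finite[of "{0}"]) (auto simp: scaleR_conv_of_real)
      finally show ?thesis by (simp add: scaleR_conv_of_real)
    qed
    then have eq: "(1 / of_real \<kappa>) * (of_real (2 ^ M) * conv (flat_seq M 1) (fun_diff f) t)
        = f t - (1 / of_real \<kappa>) * conv ?z f t" for t
      using \<kappa> by (simp add: power_one_over field_simps)
    have "in_Lp_closure p g (\<lambda>t. (1 / of_real \<kappa>) * (of_real (2 ^ M) * conv (flat_seq M 1) (fun_diff f) t))"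
      by (intro in_Lp_closure_cmult conv_flat_seq_in_Lp_closure[OF p g] compact_support_fun_diff f)
    then have "in_Lp_closure p g (\<lambda>t. f t - (1 / of_real \<kappa>) * conv ?z f t)" unfolding eq .
    moreover have "sup_L1_le \<delta> (cmod (1 / of_real \<kappa>) * (E * B)) (\<lambda>t. f t - (f t - (1 / of_real \<kappa>) * conv ?z f t))"
      using sup_L1_le_mono[OF sup_L1_le_cmult[OF z, of "1 / of_real \<kappa>"] _ order_refl, of \<delta>] M
      by (simp add: mult_ac)
    ultimately show "\<exists>h. in_Lp_closure p g h \<and> sup_L1_le \<delta> (cmod (1 / of_real \<kappa>) * (E * B)) (\<lambda>t. f t - h t)"
      by blast
  qed
qed

section \<open>Density of compactly supported functions in the Lebesgue spaces\<close>

definition clamp_norm :: "real \<Rightarrow> complex \<Rightarrow> complex" where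
  "clamp_norm N z = of_real (N / max N (cmod z)) * z"

lemma clamp_norm:
  assumes "N > 0"
  shows "cmod (clamp_norm N z) \<le> N" "cmod z \<le> N \<Longrightarrow> clamp_norm N z = z" "continuous_on UNIV (clamp_norm N)"
proof -
  have m: "max N (cmod z) > 0" for z using assms by simp
  have "cmod (clamp_norm N z) = N * (cmod z / max N (cmod z))"
    using assms m[of z] by (simp add: clamp_norm_def norm_mult norm_divide)
  also have "\<dots> \<le> N * 1" using assms m[of z] by (intro mult_left_mono) auto
  finally show "cmod (clamp_norm N z) \<le> N" by simp
  show "cmod z \<le> N \<Longrightarrow> clamp_norm N z = z" using assms by (simp add: clamp_norm_def max_def)
  show "continuous_on UNIV (clamp_norm N)" unfolding clamp_norm_def[abs_def]
    using m by (intro continuous_intros) (auto simp: less_le)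
qed

lemma Lp_approx_bounded:
  assumes p: "p > 0" and f: "f \<in> Lp_space p" and e: "\<epsilon> > 0"
  shows "\<exists>N>0. \<exists>h. h \<in> borel_measurable lebesgue \<and> (\<forall>t. cmod (h t) \<le> N) \<and> (\<forall>t. N < \<bar>t\<bar> \<longrightarrow> h t = 0)
    \<and> Lp_int_le p \<epsilon> (\<lambda>t. f t - h t)"
proof -
  have m: "f \<in> borel_measurable lebesgue" and i: "integrable lebesgue (\<lambda>t. cmod (f t) powr p)"
    using f by (auto simp: Lp_space_def)
  have idm: "(\<lambda>t. t) \<in> borel_measurable lebesgue"
    by (rule measurable_completion) simp
  define h where "h n t = (if cmod (f t) \<le> real (Suc n) \<and> \<bar>t\<bar> \<le> real (Suc n) then f t else 0)" for n t
  have hm: "h n \<in> borel_measurable lebesgue" for n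
    unfolding h_def[abs_def] using m idm by measurable
  have dm: "(\<lambda>t. f t - h n t) \<in> borel_measurable lebesgue" for n
    using m hm by (rule borel_measurable_diff)
  have pm: "(\<lambda>t. cmod (f t - h n t) powr p) \<in> borel_measurable lebesgue" for n
    using dm[of n] by measurable
  have le: "cmod (f t - h n t) powr p \<le> cmod (f t) powr p" for n t
    by (auto simp: h_def)
  have int: "integrable lebesgue (\<lambda>t. cmod (f t - h n t) powr p)" for n
    by (rule Bochner_Integration.integrable_bound[OF i pm]) (use le in auto)
  have "(\<lambda>n. LINT t|lebesgue. cmod (f t - h n t) powr p) \<longlonglongrightarrow> integral\<^sup>L lebesgue (\<lambda>t::real. 0::real)"
  proof (rule integral_dominated_convergence[where w = "\<lambda>t. cmod (f t) powr p"
        and s = "\<lambda>n t. cmod (f t - h n t) powr p" and f = "\<lambda>t. 0"])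
    show "AE t in lebesgue. (\<lambda>n. cmod (f t - h n t) powr p) \<longlonglongrightarrow> 0"
    proof (rule AE_I2)
      fix t
      obtain n0 :: nat where n0: "max (cmod (f t)) \<bar>t\<bar> < real n0" using reals_Archimedean2 by blast
      have "cmod (f t - h n t) powr p = 0" if "n \<ge> n0" for n using n0 that by (auto simp: h_def)
      then show "(\<lambda>n. cmod (f t - h n t) powr p) \<longlonglongrightarrow> 0"
        by (intro tendsto_eventually eventually_sequentiallyI)
    qed
  qed (use le pm i in auto)
  then have "eventually (\<lambda>n. (LINT t|lebesgue. cmod (f t - h n t) powr p) < \<epsilon>) sequentially"
    using e by (intro order_tendstoD) auto
  then obtain n where "(LINT t|lebesgue. cmod (f t - h n t) powr p) < \<epsilon>"
    by (auto simp: eventually_sequentially)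
  then have "Lp_int_le p \<epsilon> (\<lambda>t. f t - h n t)" using dm int by (simp add: Lp_int_le_def)
  then show ?thesis
    by (intro exI[of _ "real (Suc n)"] exI[of _ "h n"] conjI hm) (auto simp: h_def)
qed

text \<open>Measurability supplies continuous functions that converge to \<open>h\<close> almost
  everywhere. They are retracted radially onto the disc of radius \<open>N\<close> and multiplied by
  a cut-off equal to 1 on \<open>[-N, N]\<close> and 0 beyond \<open>N + 1\<close>; both operations
  preserve the limit and together give an integrable majorant.\<close>

lemma bounded_approx_compact_support:
  assumes p: "p > 0" and N: "N > 0" and h: "h \<in> borel_measurable lebesgue"
    and b: "\<And>t. cmod (h t) \<le> N" and s: "\<And>t. N < \<bar>t\<bar> \<Longrightarrow> h t = 0" and e: "\<epsilon> > 0"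
  shows "\<exists>w. compact_support w \<and> Lp_int_le p \<epsilon> (\<lambda>t. h t - w t)"
proof -
  have "h measurable_on UNIV" using h by (intro lebesgue_measurable_imp_measurable_on) auto
  then obtain Z g where Z: "negligible Z" and gc: "\<And>n. continuous_on UNIV (g n)"
      and gl: "\<And>t. t \<notin> Z \<Longrightarrow> (\<lambda>n. g n t) \<longlonglongrightarrow> h t"
    unfolding measurable_on_def by auto
  define u where "u t = max 0 (min 1 (N + 1 - \<bar>t\<bar>))" for t :: real
  define w where "w n t = of_real (u t) * clamp_norm N (g n t)" for n t
  have u: "0 \<le> u t" "u t \<le> 1" for t by (auto simp: u_def)
  have wc: "continuous_on UNIV (w n)" for n
    unfolding w_def[abs_def] u_def[abs_def]
    by (intro continuous_intros continuous_on_compose2[OF clamp_norm(3)[OF N] gc]) auto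
  have ws: "w n t = 0" if "N + 1 \<le> \<bar>t\<bar>" for n t using that by (simp add: w_def u_def)
  have wN: "cmod (w n t) \<le> N" for n t
    using mult_mono[OF u(2)[of t] clamp_norm(1)[OF N, of "g n t"]] u(1)[of t] by (simp add: w_def norm_mult)
  have wcs: "compact_support (w n)" for n unfolding compact_support_def using wc ws by blast
  have wm: "w n \<in> borel_measurable lebesgue" for n
    using borel_measurable_continuous_onI[OF wc[of n]] by (intro measurable_completion) simp
  have dm: "(\<lambda>t. h t - w n t) \<in> borel_measurable lebesgue" for n
    using h wm by (rule borel_measurable_diff)
  have pm: "(\<lambda>t. cmod (h t - w n t) powr p) \<in> borel_measurable lebesgue" for n
    using dm[of n] by measurable
  define D where "D t = (2 * N) powr p * indicator {-(N+1)..N+1} t" for t :: real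
  have Di: "integrable lebesgue D" unfolding D_def[abs_def]
    by (intro integrable_mult_right integrable_real_indicator) (auto simp: emeasure_lborel_Icc_eq)
  have le: "norm (cmod (h t - w n t) powr p) \<le> D t" for n t
  proof (cases "t \<in> {-(N+1)..N+1}")
    case True
    have "cmod (h t - w n t) \<le> 2 * N" using norm_triangle_ineq4[of "h t" "w n t"] b[of t] wN[of n t] by linarith
    then show ?thesis using True p by (simp add: D_def powr_mono2)
  next
    case False
    then have "N + 1 < \<bar>t\<bar>" by auto
    then show ?thesis using s[of t] ws[of t n] False by (simp add: D_def)
  qed
  have int: "integrable lebesgue (\<lambda>t. cmod (h t - w n t) powr p)" for n
    by (rule Bochner_Integration.integrable_bound[OF Di pm], rule AE_I2, rule order_trans[OF le]) simp
  have "(\<lambda>n. LINT t|lebesgue. cmod (h t - w n t) powr p) \<longlonglongrightarrow> integral\<^sup>L lebesgue (\<lambda>t::real. 0::real)"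
  proof (rule integral_dominated_convergence[where w = D
        and s = "\<lambda>n t. cmod (h t - w n t) powr p" and f = "\<lambda>t. 0"])
    have "AE t in lebesgue. t \<notin> Z" using Z negligible_iff_null_sets AE_not_in by blast
    then show "AE t in lebesgue. (\<lambda>n. cmod (h t - w n t) powr p) \<longlonglongrightarrow> 0"
    proof eventually_elim
      case (elim t)
      have "isCont (clamp_norm N) (h t)"
        using clamp_norm(3)[OF N] by (simp add: continuous_on_eq_continuous_at)
      then have "(\<lambda>n. clamp_norm N (g n t)) \<longlonglongrightarrow> clamp_norm N (h t)"
        by (rule isCont_tendsto_compose[OF _ gl[OF elim]])
      then have "(\<lambda>n. w n t) \<longlonglongrightarrow> of_real (u t) * clamp_norm N (h t)"
        unfolding w_def by (intro tendsto_intros)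
      moreover have "of_real (u t) * clamp_norm N (h t) = h t"
        using s[of t] clamp_norm(2)[OF N b[of t]] by (cases "N < \<bar>t\<bar>") (auto simp: u_def)
      ultimately have "(\<lambda>n. w n t) \<longlonglongrightarrow> h t" by simp
      then have "(\<lambda>n. cmod (h t - w n t)) \<longlonglongrightarrow> cmod (h t - h t)" by (intro tendsto_intros)
      then show ?case using p by (intro tendsto_zero_powrI) auto
    qed
  qed (use le pm Di in auto)
  then have "eventually (\<lambda>n. (LINT t|lebesgue. cmod (h t - w n t) powr p) < \<epsilon>) sequentially"
    using e by (intro order_tendstoD) auto
  then obtain n where "(LINT t|lebesgue. cmod (h t - w n t) powr p) < \<epsilon>"
    by (auto simp: eventually_sequentially)
  then have "Lp_int_le p \<epsilon> (\<lambda>t. h t - w n t)" using dm int by (simp add: Lp_int_le_def)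
  then show ?thesis using wcs by blast
qed

lemma Lp_space_in_Lp_closure:
  assumes p: "p > 1" and g: "\<And>j. in_closure g (generator_deriv j)" and f: "f \<in> Lp_space p"
  shows "in_Lp_closure p g f"
proof (rule in_Lp_closure_limit)
  show p0: "p > 0" using p by simp
  fix \<epsilon> :: real assume e: "\<epsilon> > 0"
  define \<delta> where "\<delta> = \<epsilon> / (2 powr p * 2)"
  have d: "\<delta> > 0" "2 powr p * (\<delta> + \<delta>) = \<epsilon>" using e by (simp_all add: \<delta>_def)
  obtain N h where N: "N > 0" and h: "h \<in> borel_measurable lebesgue" "\<And>t. cmod (h t) \<le> N"
      "\<And>t. N < \<bar>t\<bar> \<Longrightarrow> h t = 0" "Lp_int_le p \<delta> (\<lambda>t. f t - h t)"
    using Lp_approx_bounded[OF p0 f d(1)] by blast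
  obtain w where w: "compact_support w" "Lp_int_le p \<delta> (\<lambda>t. h t - w t)"
    using bounded_approx_compact_support[OF p0 N h(1-3) d(1)] by blast
  have "Lp_int_le p \<epsilon> (\<lambda>t. f t - w t)" using Lp_int_le_add[OF p0 h(4) w(2)] d(2) by simp
  then show "\<exists>h. in_Lp_closure p g h \<and> Lp_int_le p \<epsilon> (\<lambda>t. f t - h t)"
    using compact_support_in_Lp_closure[OF p g w(1)] by blast
qed

theorem theorem1:
  shows "\<exists>\<phi> \<in> schwartz_space. \<forall>\<Lambda> :: real set.
    (\<exists>(a :: int \<Rightarrow> real) (C :: real) (r :: real).
       \<Lambda> = {of_int n + a n | n. True} \<and>
       (\<forall>n. a n \<noteq> 0) \<and>
       C > 0 \<and> 0 < r \<and> r < 1 \<and>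
       (\<forall>n. \<bar>a n\<bar> < C * r ^ nat \<bar>n\<bar>)) \<longrightarrow>
    (\<forall>p :: real. 1 < p \<longrightarrow> spans_Lp p (translates \<phi> \<Lambda>))"
proof (intro bexI[of _ "generator_deriv 0"] generator_in_schwartz_space allI impI)
  fix \<Lambda> :: "real set" and p :: real
  assume "\<exists>(a :: int \<Rightarrow> real) (C :: real) (r :: real).
       \<Lambda> = {of_int n + a n | n. True} \<and> (\<forall>n. a n \<noteq> 0) \<and>
       C > 0 \<and> 0 < r \<and> r < 1 \<and> (\<forall>n. \<bar>a n\<bar> < C * r ^ nat \<bar>n\<bar>)"
    and p: "1 < p"
  then obtain a :: "int \<Rightarrow> real" and C r :: real
    where \<Lambda>: "\<Lambda> = {of_int n + a n | n. True}" and a: "\<And>n. a n \<noteq> 0" and C: "C > 0" and r: "0 < r" "r < 1"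
      and bound: "\<And>n. \<bar>a n\<bar> < C * r ^ nat \<bar>n\<bar>" by blast
  define g where "g n t = generator_deriv 0 (t - (of_int n + a n))" for n t
  have tr: "translates (generator_deriv 0) \<Lambda> = range g"
    unfolding translates_def \<Lambda> g_def[abs_def] by auto
  have clo: "in_closure g (generator_deriv j)" for j
    using generator_deriv_in_closure[OF a r C bound, of g j 0] by (simp add: g_def[abs_def])
  show "spans_Lp p (translates (generator_deriv 0) \<Lambda>)"
    unfolding spans_Lp_def tr
  proof (intro conjI ballI allI impI)
    obtain K where K: "\<And>t. cmod (generator_deriv 0 t) \<le> K / (1 + t\<^sup>2)" using generator_deriv_decay by blast
    have "Lp_int_le p (K powr (p - 1) * (K * pi)) (g n)" for n
      unfolding g_def[abs_def]
      by (intro Lp_int_le_of_sup_L1[OF p] sup_L1_le_translate sup_L1_le_decay[OF generator_deriv_measurable K])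
    then show "range g \<subseteq> Lp_space p" by (auto simp: Lp_space_def Lp_int_le_def)
    fix f and \<epsilon> :: real assume f: "f \<in> Lp_space p" and e: "\<epsilon> > 0"
    \<comment> \<open>Half of \<open>\<epsilon>\<close>, because the norm has to be strictly smaller
      than \<open>\<epsilon>\<close>.\<close>
    define \<delta> where "\<delta> = (\<epsilon>/2) powr p"
    have d: "\<delta> > 0" using e by (simp add: \<delta>_def)
    obtain v where v: "finite_comb g v" "Lp_int_le p \<delta> (\<lambda>t. f t - v t)"
      using Lp_space_in_Lp_closure[OF p clo f] d unfolding in_Lp_closure_def by blast
    obtain A c where A: "finite A" "v = (\<lambda>t. \<Sum>n\<in>A. c n * g n t)" using v(1) finite_comb_def by blast
    \<comment> \<open>Several \<open>n\<close> may give the same point \<open>n + a n\<close>; the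
      coefficients of equal translates are added up.\<close>
    define c' where "c' h = (\<Sum>n\<in>{n \<in> A. g n = h}. c n)" for h
    have v': "v t = (\<Sum>h\<in>g ` A. c' h * h t)" for t
    proof -
      have "v t = (\<Sum>h\<in>g ` A. \<Sum>n\<in>{n \<in> A. g n = h}. c n * g n t)"
        unfolding A(2) by (rule sum.image_gen[OF A(1)])
      also have "\<dots> = (\<Sum>h\<in>g ` A. c' h * h t)"
        by (intro sum.cong refl) (simp add: c'_def sum_distrib_right)
      finally show ?thesis .
    qed
    have "Lp_norm p (\<lambda>t. f t - v t) \<le> \<delta> powr (1 / p)"
      unfolding Lp_norm_def using v(2) p by (intro powr_mono2) (auto simp: Lp_int_le_def)
    also have "\<dots> < \<epsilon>" using e p by (simp add: \<delta>_def powr_powr)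
    finally have "Lp_norm p (\<lambda>t. f t - (\<Sum>h\<in>g ` A. c' h * h t)) < \<epsilon>" unfolding v' .
    then show "\<exists>F c. finite F \<and> F \<subseteq> range g \<and> Lp_norm p (\<lambda>t. f t - (\<Sum>g\<in>F. c g * g t)) < \<epsilon>"
      using A(1) by (intro exI[of _ "g ` A"] exI[of _ c'] conjI) auto
  qed
qed

end
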